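(* Let $i\in\mathbb{Z}_+$, $r\in\mathbb{N}$ and $s\in(-1/2,i]$ satisfy $r>\max\{s,i-1\}$. Let $\psi^1,\psi^2\in C^{\infty}([0,1])$ satisfy $\operatorname{supp}\psi^1\subset[0,\tfrac23]$, $\operatorname{supp}\psi^2\subset[\tfrac13,1]$ and $\psi^1+\psi^2\equiv1$ on $[0,1]$, and extend $\psi^1,\psi^2$ by zero to $\mathbb{R}$. Then there is a constant $C$ such that the following holds. Let $\{\Delta_m\}_{m\in\mathcal{M}}$, $\Delta_m=[a_m,b_m]$, be any finite or countable collection of pairwise disjoint intervals in $\mathbb{R}$, with lengths $l_m=b_m-a_m$, such that $0\notin(a_m,b_m)$ for every $m\in\mathcal{M}$. Put $$\psi^{\sigma}_m(\xi)=\psi^{\sigma}\Big(\frac{\xi-a_m}{l_m}\Big),\qquad \sigma=1,2,$$ and, for $f\in L^2(\mathbb{R})$, $$S^{1}f(x)=\Big\{e^{-2\pi i\,a_mx}\big(\widehat f\,\psi^1_m\big)^{\vee}(x)\Big\}_{m\in\mathcal{M}},\qquad S^{2}f(x)=\Big\{e^{-2\pi i\,b_mx}\big(\widehat f\,\psi^2_m\big)^{\vee}(x)\Big\}_{m\in\mathcal{M}}.$$ Then for every $f\in L^2(\mathbb{R})$ and $\sigma=1,2$, $$M_{r,2,s}(S^{\sigma}f)\le C\,M_{i,2,s}f\quad\text{pointwise on }\mathbb{R}.$$ The constant $C$ does not depend on $f$ or $\{\Delta_m\}$. (The function $M_{i,2,s}f$ is not assumed to be finite almost everywhere.)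
   Context: In the exponentials $e^{-2\pi i\,a_m x}$ and $e^{-2\pi i\,b_m x}$ the letter $i$ is the imaginary unit; as a parameter (in $M_{i,2,s}$, $\mathcal{P}_i$) it is a nonnegative integer. $\mathbb{Z}_+=\{0,1,2,\dots\}$, $\mathbb{N}=\{1,2,\dots\}$. The Fourier transform is $\widehat f(\xi)=\int f(x)e^{-2\pi i x\xi}\,dx$, and $^{\vee}$ is its inverse. $\mathcal{P}_i$ is the space of (complex) algebraic polynomials on $\mathbb{R}$ of degree strictly less than $i$, with $\mathcal{P}_0=\{0\}$. Maximal function: for $s\in\mathbb{R}$, $1\le p<\infty$, $i\in\mathbb{Z}_+$ and a finite or countable collection $h=\{h_m\}$ of measurable functions on $\mathbb{R}$ (a single function is a collection with one element), $$M_{i,p,s}h(x)=\sup_{Q\ni x}\inf_{P}\frac{1}{|Q|^{s}}\bigg(\frac1{|Q|}\int_Q|h-P|_{l^2}^p\bigg)^{1/p},$$ where the supremum is over all bounded intervals $Q$ containing $x$, the infimum is over all collections $P=\{P_m\}$ of polynomials $P_m\in\mathcal{P}_i$, and $|h-P|_{l^2}=(\sum_m|h_m-P_m|^2)^{1/2}\in[0,\infty]$. Neither $h$ nor $P$ is required to be $l^2$-valued; the value $+\infty$ is allowed. *)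

theory Defs
  imports "HOL-Analysis.Analysis" "HOL-Computational_Algebra.Polynomial"
begin

text \<open>Real powers on \<open>[0,\<infinity>]\<close>; only used with exponent \<open>t > 0\<close>, so that \<open>\<infinity>\<close> is mapped to \<open>\<infinity>\<close>.\<close>

definition ennreal_powr :: "ennreal \<Rightarrow> real \<Rightarrow> ennreal" where
  "ennreal_powr x t = (if x = \<infinity> then \<infinity> else ennreal (enn2real x powr t))"

definition polys_below :: "nat \<Rightarrow> complex poly set" where
  "polys_below i = {q. q = 0 \<or> degree q < i}"

text \<open>A finite or countable collection of functions is a family \<open>h :: nat \<Rightarrow> real \<Rightarrow> complex\<close>
  together with an arbitrary index set \<open>J\<close> of natural numbers; only the members with index
  in \<open>J\<close> matter.\<close>

definition l2_dist :: "nat set \<Rightarrow> (nat \<Rightarrow> complex) \<Rightarrow> (nat \<Rightarrow> complex) \<Rightarrow> ennreal" where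
  "l2_dist J u v = ennreal_powr (\<Sum>\<^sub>\<infinity>m\<in>J. ennreal ((cmod (u m - v m))\<^sup>2)) (1/2)"

text \<open>Bounded intervals of positive length (open, closed or half-open).\<close>

definition bounded_intervals :: "real set set" where
  "bounded_intervals = {Q. is_interval Q \<and> bounded Q \<and> measure lebesgue Q > 0}"

definition maximal_fn ::
    "nat \<Rightarrow> real \<Rightarrow> real \<Rightarrow> nat set \<Rightarrow> (nat \<Rightarrow> real \<Rightarrow> complex) \<Rightarrow> real \<Rightarrow> ennreal" where
  "maximal_fn i p s J h x =
     (SUP Q \<in> {Q \<in> bounded_intervals. x \<in> Q}.
      INF P \<in> {P :: nat \<Rightarrow> complex poly. \<forall>m\<in>J. P m \<in> polys_below i}.
        ennreal (1 / measure lebesgue Q powr s) *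
        ennreal_powr
          (ennreal (1 / measure lebesgue Q) *
           (\<integral>\<^sup>+y\<in>Q. ennreal_powr (l2_dist J (\<lambda>m. h m y) (\<lambda>m. poly (P m) (complex_of_real y))) p
              \<partial>lebesgue))
          (1 / p))"

definition maximal_fn_single :: "nat \<Rightarrow> real \<Rightarrow> real \<Rightarrow> (real \<Rightarrow> complex) \<Rightarrow> real \<Rightarrow> ennreal" where
  "maximal_fn_single i p s f = maximal_fn i p s {0} (\<lambda>_. f)"

definition L2_real :: "(real \<Rightarrow> complex) set" where
  "L2_real = {f \<in> borel_measurable lebesgue. integrable lebesgue (\<lambda>x. (cmod (f x))\<^sup>2)}"

definition fourier_integral :: "(real \<Rightarrow> complex) \<Rightarrow> real \<Rightarrow> complex" where
  "fourier_integral f \<xi> = (LINT x|lebesgue. f x * cis (- (2 * pi * x * \<xi>)))"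

definition inverse_fourier_integral :: "(real \<Rightarrow> complex) \<Rightarrow> real \<Rightarrow> complex" where
  "inverse_fourier_integral g x = (LINT \<xi>|lebesgue. g \<xi> * cis (2 * pi * x * \<xi>))"

text \<open>The Fourier--Plancherel transform on \<open>L\<^sup>2\<close>: the limit in \<open>L\<^sup>2\<close> of the Fourier integrals of
  the truncations of \<open>f\<close> to \<open>[-n,n]\<close>.  It is determined up to null sets; an
  arbitrary representative is chosen.\<close>

definition fourier_L2 :: "(real \<Rightarrow> complex) \<Rightarrow> real \<Rightarrow> complex" where
  "fourier_L2 f = (SOME g. g \<in> L2_real \<and>
     (\<lambda>n. \<integral>\<^sup>+\<xi>. ennreal ((cmod (g \<xi> -
              fourier_integral (\<lambda>x. indicator {- real n..real n} x * f x) \<xi>))\<^sup>2) \<partial>lebesgue)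
       \<longlonglongrightarrow> 0)"

text \<open>\<open>C\<^sup>\<infinity>([0,1])\<close>, with one-sided derivatives at the end points: \<open>D k\<close> is the \<open>k\<close>-th derivative.
  Values of \<open>\<psi>\<close> outside \<open>[0,1]\<close> are irrelevant.\<close>

definition smooth_on_unit :: "(real \<Rightarrow> complex) \<Rightarrow> bool" where
  "smooth_on_unit \<psi> \<longleftrightarrow>
     (\<exists>D :: nat \<Rightarrow> real \<Rightarrow> complex. (\<forall>x\<in>{0..1}. D 0 x = \<psi> x) \<and>
       (\<forall>k. \<forall>x\<in>{0..1}. (D k has_vector_derivative D (Suc k) x) (at x within {0..1})))"

definition supp_unit :: "(real \<Rightarrow> complex) \<Rightarrow> real set" where
  "supp_unit \<psi> = closure {x \<in> {0..1}. \<psi> x \<noteq> 0}"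

definition zero_ext :: "(real \<Rightarrow> complex) \<Rightarrow> real \<Rightarrow> complex" where
  "zero_ext \<psi> x = (if x \<in> {0..1} then \<psi> x else 0)"

definition cutoff :: "(real \<Rightarrow> complex) \<Rightarrow> real \<Rightarrow> real \<Rightarrow> real \<Rightarrow> complex" where
  "cutoff \<psi> a b \<xi> = zero_ext \<psi> ((\<xi> - a) / (b - a))"

text \<open>The product of \<open>fourier_L2 f\<close> and the cutoff is square integrable with bounded support,
  hence integrable, so its inverse Fourier transform is given by the integral.\<close>

definition S1 ::
    "(real \<Rightarrow> complex) \<Rightarrow> (nat \<Rightarrow> real) \<Rightarrow> (nat \<Rightarrow> real) \<Rightarrow> (real \<Rightarrow> complex) \<Rightarrow> nat \<Rightarrow> real \<Rightarrow> complex" where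
  "S1 \<psi>1 a b f m x =
     cis (- (2 * pi * a m * x)) *
     inverse_fourier_integral (\<lambda>\<xi>. fourier_L2 f \<xi> * cutoff \<psi>1 (a m) (b m) \<xi>) x"

definition S2 ::
    "(real \<Rightarrow> complex) \<Rightarrow> (nat \<Rightarrow> real) \<Rightarrow> (nat \<Rightarrow> real) \<Rightarrow> (real \<Rightarrow> complex) \<Rightarrow> nat \<Rightarrow> real \<Rightarrow> complex" where
  "S2 \<psi>2 a b f m x =
     cis (- (2 * pi * b m * x)) *
     inverse_fourier_integral (\<lambda>\<xi>. fourier_L2 f \<xi> * cutoff \<psi>2 (a m) (b m) \<xi>) x"

end

theory Submission
  imports Defs "HOL-Probability.Sinc_Integral"
begin

text \<open>
  Fix an interval \<open>Q\<close> of length \<open>L\<close> containing \<open>x\<close> and put \<open>h = f - P\<close>, where \<open>P\<close> is a nearly optimal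
  polynomial for \<open>f\<close> on \<open>Q\<close>. Telescoping over the dilates \<open>2^k Q\<close> bounds the growth of \<open>h\<close>, with an
  exponent below \<open>r\<close>. The part of \<open>h\<close> on \<open>2Q\<close> is controlled by Plancherel's inequality, because the
  frequency intervals are disjoint. For the rest consider the \<open>r\<close>-th derivative of the \<open>m\<close>-th component:
  it is given by a kernel whose symbol \<open>(2 \<pi> i (\<xi> - e))^r \<psi>((\<xi> - a) / (b - a))\<close>, with \<open>e\<close> the end point of
  \<open>[a, b]\<close> selected by \<open>\<psi>\<close>, vanishes to order \<open>r\<close> at both end points. After \<open>r + 1\<close> integrations by
  parts these kernels, restricted to \<open>\<bar>u\<bar> \<ge> R\<close>, satisfy a Bessel inequality with constant
  \<open>O(R^(-2r-1))\<close>, uniformly in the lengths of the intervals. Hence the sum over the dyadic annuli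
  converges, and the Taylor polynomial at the left end point of \<open>Q\<close> is the required approximant. The
  polynomial \<open>P\<close> does not contribute: its integral against the kernel involves only derivatives of order
  below \<open>r\<close> of the symbol at the frequency 0, which vanish since 0 is not an interior point of \<open>[a, b]\<close>.
\<close>

section \<open>Fourier integrals and Plancherel's inequality\<close>

text \<open>At a fixed point, Bessel's inequality sees the symbols through their squared norms.
  After r integrations by parts the symbol is the bounded function \<open>D r\<close>, whose squared
  norm is of the order of the length of [a, b]; the resulting bound, \<open>R^(-2r)\<close> times
  that length, is not uniform. A further integration by parts meets boundary terms: point values of
  a transform at \<open>a\<close> and \<open>b\<close>, which no L2 norm controls. The way out is to
  replace the length by \<open>1/R\<close>, and this forces a decomposition that depends on the
  scale and treats intervals shorter and longer than \<open>1/R\<close> alike. The power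
  \<open>R^(-2r-1)\<close> is the right one: the error on the annulus at distance
  \<open>R = 2^k * \<rho>\<close> has squared norm of order
  \<open>2^k * 2 powr (2 * k * \<nu>)\<close>, length times growth, which leaves
  \<open>2 powr (- 2 * k * (r - \<nu>))\<close>. Here \<open>\<nu>\<close> lies strictly between
  max(s, n) and r, with n the degree bound of the approximants: an approximant extrapolates with the
  power n, the increments between consecutive scales have the power s, and the strict gap absorbs
  the number k of telescoping terms as well.\<close>

abbreviation sq_norm :: "(real \<Rightarrow> complex) \<Rightarrow> ennreal" where
  "sq_norm g \<equiv> (\<integral>\<^sup>+x. ennreal ((cmod (g x))\<^sup>2) \<partial>lborel)"

abbreviation on_Icc :: "real \<Rightarrow> real \<Rightarrow> (real \<Rightarrow> complex) \<Rightarrow> real \<Rightarrow> complex" where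
  "on_Icc a b v \<equiv> (\<lambda>\<xi>. indicator {a..b} \<xi> * v \<xi>)"

definition ft :: "(real \<Rightarrow> complex) \<Rightarrow> real \<Rightarrow> complex" where
  "ft g \<xi> = (LINT x|lborel. g x * cis (- (2 * pi * x * \<xi>)))"

lemma measurable_cis [measurable]: "cis \<in> borel_measurable borel"
  by (intro borel_measurable_continuous_onI continuous_intros)

lemma measurable_cnj [measurable]: "cnj \<in> borel_measurable borel"
  by (intro borel_measurable_continuous_onI continuous_intros)

lemma integrable_mult_cis:
  assumes "integrable lborel g" "\<phi> \<in> borel_measurable borel"
  shows "integrable lborel (\<lambda>x. g x * cis (\<phi> x))"
proof -
  note [measurable] = borel_measurable_integrable[OF assms(1)] assms(2)
  show ?thesis
    by (rule Bochner_Integration.integrable_bound[OF assms(1)]) (auto simp: norm_mult)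
qed

lemma measurable_ft [measurable]:
  assumes [measurable]: "g \<in> borel_measurable borel"
  shows "ft g \<in> borel_measurable borel"
  unfolding ft_def by measurable

lemma cmod_ft_le:
  assumes "integrable lborel g"
  shows "cmod (ft g \<xi>) \<le> (LINT x|lborel. cmod (g x))"
proof -
  have "cmod (ft g \<xi>) \<le> (LINT x|lborel. norm (g x * cis (- (2 * pi * x * \<xi>))))"
    unfolding ft_def by (rule integral_norm_bound)
  then show ?thesis by (simp add: norm_mult)
qed

lemma ft_diff:
  assumes "integrable lborel g" "integrable lborel h"
  shows "ft (\<lambda>x. g x - h x) \<xi> = ft g \<xi> - ft h \<xi>"
  unfolding ft_def left_diff_distrib
  by (intro Bochner_Integration.integral_diff integrable_mult_cis assms) measurable

lemma integrable_pair_kernel: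
  fixes g h :: "real \<Rightarrow> complex" and k :: "real \<Rightarrow> real \<Rightarrow> complex"
  assumes g: "integrable lborel g" and h: "integrable lborel h"
    and k: "case_prod k \<in> borel_measurable (lborel \<Otimes>\<^sub>M lborel)"
    and b: "\<And>x y. cmod (k x y) \<le> B"
  shows "integrable (lborel \<Otimes>\<^sub>M lborel) (\<lambda>(x, y). g x * h y * k x y)"
proof -
  note [measurable] = borel_measurable_integrable[OF g] borel_measurable_integrable[OF h]
  have "integrable (lborel \<Otimes>\<^sub>M lborel) (\<lambda>(x, y). g x * h y)"
  proof (rule lborel_pair.Fubini_integrable)
    show "integrable lborel (\<lambda>x. LINT y|lborel. norm (case (x, y) of (x, y) \<Rightarrow> g x * h y))"
      using g h by (simp add: norm_mult)
    show "AE x in lborel. integrable lborel (\<lambda>y. case (x, y) of (x, y) \<Rightarrow> g x * h y)"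
      using h by simp
  qed measurable
  then have "integrable (lborel \<Otimes>\<^sub>M lborel) (\<lambda>p. B * norm (case p of (x, y) \<Rightarrow> g x * h y))"
    by (intro integrable_mult_right integrable_norm)
  moreover have "(\<lambda>(x, y). g x * h y * k x y) \<in> borel_measurable (lborel \<Otimes>\<^sub>M lborel)"
    using k by (auto simp: split_beta')
  ultimately show ?thesis
  proof (rule Bochner_Integration.integrable_bound, intro AE_I2)
    fix p :: "real \<times> real"
    show "norm (case p of (x, y) \<Rightarrow> g x * h y * k x y)
        \<le> norm (B * norm (case p of (x, y) \<Rightarrow> g x * h y))"
    proof (cases p)
      case (Pair x y)
      have "0 \<le> B" using b[of x y] norm_ge_zero[of "k x y"] by linarith
      then show ?thesis using Pair mult_left_mono[OF b[of x y], of "cmod (g x) * cmod (h y)"]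
        by (simp add: norm_mult abs_mult mult_ac)
    qed
  qed
qed

text \<open>Fubini's theorem for a bounded kernel, dominated by the tensor product of
  \<open>g\<close> and \<open>h\<close>. Below, \<open>k\<close> is always built from unimodular
  exponentials, whence the bound 1 at each use.\<close>

lemma integral_pair_swap:
  fixes g h :: "real \<Rightarrow> complex" and k :: "real \<Rightarrow> real \<Rightarrow> complex"
  assumes g: "integrable lborel g" and h: "integrable lborel h"
    and k: "case_prod k \<in> borel_measurable (lborel \<Otimes>\<^sub>M lborel)"
    and b: "\<And>x y. cmod (k x y) \<le> B"
  shows "(LINT x|lborel. g x * (LINT y|lborel. h y * k x y))
       = (LINT y|lborel. h y * (LINT x|lborel. g x * k x y))"
proof -
  have "(LINT y|lborel. (LINT x|lborel. g x * h y * k x y))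
      = (LINT x|lborel. (LINT y|lborel. g x * h y * k x y))"
    using lborel_pair.Fubini_integral[OF integrable_pair_kernel[OF assms]] by simp
  moreover have "(LINT y|lborel. g x * h y * k x y) = g x * (LINT y|lborel. h y * k x y)" for x
    by (simp add: mult.assoc)
  moreover have "(LINT x|lborel. g x * h y * k x y) = h y * (LINT x|lborel. g x * k x y)" for y
    by (subst integral_mult_right_zero[symmetric]) (simp add: mult_ac)
  ultimately show ?thesis by simp
qed

text \<open>The multiplication formula. It lets a function be tested against a kernel that is itself
  the transform of a symbol: the test then takes place on the frequency side, where the supports are
  disjoint.\<close>

lemma ft_swap:
  assumes g: "integrable lborel g" and h: "integrable lborel h"
  shows "(LINT x|lborel. g x * ft h x) = (LINT x|lborel. ft g x * h x)"
proof -
  have "(LINT x|lborel. g x * (LINT y|lborel. h y * cis (- (2 * pi * y * x))))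
       = (LINT y|lborel. h y * (LINT x|lborel. g x * cis (- (2 * pi * y * x))))"
    by (rule integral_pair_swap[OF g h, where B = 1]) auto
  then show ?thesis by (simp add: ft_def mult.commute mult.left_commute)
qed

lemma square_integrable_iff:
  fixes g :: "real \<Rightarrow> complex"
  assumes "g \<in> borel_measurable borel"
  shows "integrable lborel (\<lambda>x. (cmod (g x))\<^sup>2) \<longleftrightarrow> sq_norm g < \<infinity>"
  using assms by (auto simp: integrable_iff_bounded)

text \<open>A product that is not integrable has Bochner integral 0, so the bound is trivial for it
  and can be invoked before any finiteness is established.\<close>

lemma Cauchy_Schwarz_lborel:
  fixes g h :: "real \<Rightarrow> complex"
  assumes [measurable]: "g \<in> borel_measurable borel" "h \<in> borel_measurable borel"
  shows "ennreal ((cmod (LINT x|lborel. g x * h x))\<^sup>2) \<le> sq_norm g * sq_norm h"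
proof -
  have "ennreal (cmod (LINT x|lborel. g x * h x)) \<le> (\<integral>\<^sup>+x. ennreal (cmod (g x)) * ennreal (cmod (h x)) \<partial>lborel)"
  proof (cases "integrable lborel (\<lambda>x. g x * h x)")
    case True
    then show ?thesis
      using integral_norm_bound_ennreal[OF True] by (simp add: norm_mult ennreal_mult')
  qed (simp add: not_integrable_integral_eq)
  then have "(ennreal (cmod (LINT x|lborel. g x * h x)))\<^sup>2
      \<le> (\<integral>\<^sup>+x. ennreal (cmod (g x)) * ennreal (cmod (h x)) \<partial>lborel)\<^sup>2"
    by (rule power_mono) simp
  also have "\<dots> \<le> (\<integral>\<^sup>+x. (ennreal (cmod (g x)))\<^sup>2 \<partial>lborel) * (\<integral>\<^sup>+x. (ennreal (cmod (h x)))\<^sup>2 \<partial>lborel)"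
    by (rule Cauchy_Schwarz_nn_integral) auto
  finally show ?thesis by (simp add: ennreal_power)
qed

lemma integrable_mult_square_integrable:
  fixes g h :: "real \<Rightarrow> complex"
  assumes [measurable]: "g \<in> borel_measurable borel" "h \<in> borel_measurable borel"
    and "sq_norm g < \<infinity>" "sq_norm h < \<infinity>"
  shows "integrable lborel (\<lambda>x. g x * h x)"
proof (rule Bochner_Integration.integrable_bound)
  show "integrable lborel (\<lambda>x. (cmod (g x))\<^sup>2 + (cmod (h x))\<^sup>2)"
    using assms by (intro Bochner_Integration.integrable_add) (auto simp: square_integrable_iff)
  have "cmod (g x) * cmod (h x) \<le> (cmod (g x))\<^sup>2 + (cmod (h x))\<^sup>2" for x
    using sum_squares_bound[of "cmod (g x)" "cmod (h x)"]
      mult_nonneg_nonneg[OF norm_ge_zero[of "g x"] norm_ge_zero[of "h x"]] by linarith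
  then show "AE x in lborel. norm (g x * h x) \<le> norm ((cmod (g x))\<^sup>2 + (cmod (h x))\<^sup>2)"
    by (auto simp: norm_mult)
qed measurable

lemma integrable_compact_support:
  fixes g :: "real \<Rightarrow> complex"
  assumes [measurable]: "g \<in> borel_measurable borel" and "sq_norm g < \<infinity>"
    and supp: "\<And>x. x \<notin> {a..b} \<Longrightarrow> g x = 0"
  shows "integrable lborel g"
proof -
  have "sq_norm (indicator {a..b}) = (\<integral>\<^sup>+x. indicator {a..b} x \<partial>lborel)"
    by (intro nn_integral_cong) (auto simp: indicator_def)
  then have "integrable lborel (\<lambda>x. g x * indicator {a..b} x)"
    using assms by (intro integrable_mult_square_integrable) (auto simp: emeasure_lborel_Icc_eq)
  moreover have "(\<lambda>x. g x * indicator {a..b} x) = g"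
    using supp by (force simp: indicator_def fun_eq_iff)
  ultimately show ?thesis by simp
qed

text \<open>Stands in for Minkowski's inequality: with the factor 2, squared norms are added in
  [0,\<infinity>] without taking roots, at the cost of constants only.\<close>

lemma sq_norm_add:
  assumes [measurable]: "g \<in> borel_measurable borel" "h \<in> borel_measurable borel"
  shows "sq_norm (\<lambda>x. g x + h x) \<le> 2 * sq_norm g + 2 * sq_norm h"
proof -
  have *: "(cmod (u + v))\<^sup>2 \<le> 2 * (cmod u)\<^sup>2 + 2 * (cmod v)\<^sup>2" for u v
    using power_mono[OF norm_triangle_ineq[of u v], of 2] sum_squares_bound[of "cmod u" "cmod v"]
    by (auto simp: power2_sum)
  have "sq_norm (\<lambda>x. g x + h x) \<le> (\<integral>\<^sup>+x. 2 * ennreal ((cmod (g x))\<^sup>2) + 2 * ennreal ((cmod (h x))\<^sup>2) \<partial>lborel)"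
    by (intro nn_integral_mono) (use * in \<open>simp add: ennreal_mult'[symmetric] ennreal_plus[symmetric] flip: ennreal_numeral del: ennreal_plus\<close>)
  also have "\<dots> = 2 * sq_norm g + 2 * sq_norm h"
    by (simp add: nn_integral_add nn_integral_cmult)
  finally show ?thesis .
qed

section \<open>Abel weights and the Poisson kernel\<close>

lemma integrable_exp_abs:
  assumes "0 < (e::real)"
  shows "integrable lborel (\<lambda>x. exp (- e * \<bar>x\<bar>))"
proof -
  have "set_integrable lborel (einterval 0 \<infinity>) (\<lambda>x. exp (- e * x))"
  proof (rule interval_integral_FTC_nonneg)
    show "DERIV (\<lambda>x. - exp (- e * x) / e) x :> exp (- e * x)" for x
      using assms by (auto intro!: derivative_eq_intros)
    show "(((\<lambda>x. - exp (- e * x) / e) \<circ> real_of_ereal) \<longlongrightarrow> - 1 / e) (at_right 0)"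
      using assms by (auto simp: zero_ereal_def ereal_tendsto_simps intro!: tendsto_eq_intros)
    have *: "((\<lambda>t. exp (- e * t)) \<longlongrightarrow> 0) at_top"
      using \<open>0 < e\<close>
      by (auto intro!: exp_at_bot[THEN filterlim_compose] filterlim_tendsto_pos_mult_at_top filterlim_ident
               simp: filterlim_uminus_at_bot)
    show "(((\<lambda>x. - exp (- e * x) / e) \<circ> real_of_ereal) \<longlongrightarrow> 0) (at_left \<infinity>)"
      using assms unfolding ereal_tendsto_simps
      using tendsto_divide[OF tendsto_minus[OF *] tendsto_const[of e]] by simp
  qed auto
  then have 1: "integrable lborel (\<lambda>x. indicator {0<..} x * exp (- e * x))"
    by (simp add: set_integrable_def zero_ereal_def einterval_eq_Ici)
  then have 2: "integrable lborel (\<lambda>x. indicator {0<..} (0 + (-1) * x) * exp (- e * (0 + (-1) * x)))"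
    by (rule lborel_integrable_real_affine) simp
  have "integrable lborel (\<lambda>x. indicator {0<..} x * exp (- e * x) + indicator {0<..} (0 + (-1) * x) * exp (- e * (0 + (-1) * x)))"
    by (rule Bochner_Integration.integrable_add[OF 1 2])
  moreover have "AE x in lborel. indicator {0<..} x * exp (- e * x) + indicator {0<..} (0 + (-1) * x) * exp (- e * (0 + (-1) * x)) = exp (- e * \<bar>x\<bar>)"
    using AE_lborel_singleton[of "0::real"] by eventually_elim (auto simp: indicator_def)
  ultimately show ?thesis by (subst integrable_cong_AE[symmetric]) auto
qed

text \<open>The Poisson kernel of the upper half-plane at height \<open>e / (2 * pi)\<close>, which
  is the transform of \<open>exp (- e * \<bar>\<xi>\<bar>)\<close> and has total mass 1.\<close>

definition poisson :: "real \<Rightarrow> real \<Rightarrow> real" where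
  "poisson e u = 2 * e / (e\<^sup>2 + (2 * pi * u)\<^sup>2)"

lemma poisson_nonneg: "0 < e \<Longrightarrow> 0 \<le> poisson e u"
  by (simp add: poisson_def)

lemma measurable_poisson [measurable]: "poisson e \<in> borel_measurable borel"
  unfolding poisson_def by measurable

lemma poisson_minus: "poisson e (- u) = poisson e u"
  by (simp add: poisson_def)

lemma has_bochner_integral_poisson:
  assumes "0 < e"
  shows "has_bochner_integral lborel (poisson e) 1"
proof -
  have "integrable lborel (\<lambda>x::real. inverse (1 + x\<^sup>2))" and I: "(LINT x|lborel. inverse (1 + x\<^sup>2)) = pi"
    using integrable_inverse_1_plus_square LBINT_inverse_1_plus_square
    by (auto simp: set_integrable_def interval_lebesgue_integral_def set_lebesgue_integral_def)
  then have "integrable lborel (\<lambda>x::real. inverse (1 + (0 + (2 * pi / e) * x)\<^sup>2))"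
    using assms by (intro lborel_integrable_real_affine) auto
  moreover have "poisson e = (\<lambda>x. (2 / e) * inverse (1 + (0 + (2 * pi / e) * x)\<^sup>2))"
    using assms unfolding poisson_def by (auto simp: fun_eq_iff field_simps power2_eq_square)
  moreover have "pi = (2 * pi / e) * (LINT x|lborel. inverse (1 + (0 + (2 * pi / e) * x)\<^sup>2))"
    using lborel_integral_real_affine[of "2 * pi / e" "\<lambda>x. inverse (1 + x\<^sup>2)" 0] I assms by simp
  then have "(LINT x|lborel. inverse (1 + (0 + (2 * pi / e) * x)\<^sup>2)) = e / 2"
    using assms by (simp add: field_simps)
  ultimately show ?thesis
    using assms by (simp add: has_bochner_integral_iff)
qed

text \<open>Each half-line contributes the reciprocal of e + 2 pi i u or of its conjugate, and the
  sum of the two is twice the real part.\<close>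

lemma ft_exp_abs:
  assumes "0 < e"
  shows "ft (\<lambda>\<xi>. of_real (exp (- e * \<bar>\<xi>\<bar>))) u = of_real (poisson e u)"
proof -
  have int: "integrable lborel (\<lambda>\<xi>. complex_of_real (exp (- e * \<bar>\<xi>\<bar>)))"
    using integrable_exp_abs[OF assms] by (simp add: integrable_of_real)
  have half: "(CLBINT x=0..\<infinity>. of_real (exp (- e * \<bar>x\<bar>)) * cis (- (2 * pi * x * v))) = 1 / Complex e (2 * pi * v)"
    for v
  proof -
    let ?z = "Complex e (2 * pi * v)"
    have z: "?z \<noteq> 0" using assms by (auto simp: complex_eq_iff)
    have E: "of_real (exp (- e * x)) * cis (- (2 * pi * x * v)) = exp (- ?z * of_real x)" for x
      by (simp add: exp_eq_polar mult_ac)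
    have "(CLBINT x=0..\<infinity>. exp (- ?z * of_real x)) = 0 - (- 1 / ?z)"
    proof (rule interval_integral_FTC_integrable)
      show "((\<lambda>x. - exp (- ?z * of_real x) / ?z) has_vector_derivative exp (- ?z * of_real x)) (at x)" for x
        using z by (auto intro!: derivative_eq_intros has_vector_derivative_real_field simp: field_simps)
      show "set_integrable lborel (einterval 0 \<infinity>) (\<lambda>x. exp (- ?z * of_real x))"
      proof -
        have "integrable lborel (\<lambda>x. of_real (indicator {0<..} x) * (of_real (exp (- e * \<bar>x\<bar>)) * cis (- (2 * pi * x * v))))"
          by (rule Bochner_Integration.integrable_bound[OF int]) (auto simp: norm_mult indicator_def)
        moreover have "of_real (indicator {0<..} x) * (of_real (exp (- e * \<bar>x\<bar>)) * cis (- (2 * pi * x * v)))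
           = indicator {0<..} x *\<^sub>R exp (- ?z * of_real x)" for x
          using E[of x] by (auto simp: indicator_def)
        ultimately show ?thesis by (simp add: set_integrable_def zero_ereal_def einterval_eq_Ici)
      qed
      show "(((\<lambda>x. - exp (- ?z * of_real x) / ?z) \<circ> real_of_ereal) \<longlongrightarrow> - 1 / ?z) (at_right 0)"
        using z by (auto simp: zero_ereal_def ereal_tendsto_simps intro!: tendsto_eq_intros)
      have *: "((\<lambda>t. exp (- e * t)) \<longlongrightarrow> 0) at_top"
        using \<open>0 < e\<close>
        by (auto intro!: exp_at_bot[THEN filterlim_compose] filterlim_tendsto_pos_mult_at_top filterlim_ident
                 simp: filterlim_uminus_at_bot)
      have "((\<lambda>t. exp (- ?z * of_real t)) \<longlongrightarrow> 0) at_top"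
        by (rule tendsto_norm_zero_cancel) (use * in simp)
      from tendsto_divide[OF tendsto_minus[OF this] tendsto_const[of ?z]]
      show "(((\<lambda>x. - exp (- ?z * of_real x) / ?z) \<circ> real_of_ereal) \<longlongrightarrow> 0) (at_left \<infinity>)"
        using z unfolding ereal_tendsto_simps by simp
    qed auto
    moreover have "(CLBINT x=0..\<infinity>. of_real (exp (- e * \<bar>x\<bar>)) * cis (- (2 * pi * x * v)))
        = (CLBINT x=0..\<infinity>. exp (- ?z * of_real x))"
      using E by (intro interval_integral_cong) (auto simp: zero_ereal_def einterval_eq_Ici)
    ultimately show ?thesis by simp
  qed
  \<comment> \<open>\<open>?k\<close> lives on the positive half-line; the negative one is reached
    by the reflection of x, which turns the frequency \<open>u\<close> into
    \<open>- u\<close>.\<close>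
  let ?k = "\<lambda>v x. indicator {0<..} x *\<^sub>R (of_real (exp (- e * \<bar>x\<bar>)) * cis (- (2 * pi * x * v)))"
  have k: "(LINT x|lborel. ?k v x) = 1 / Complex e (2 * pi * v)" for v
    using half[of v] by (simp add: interval_lebesgue_integral_def set_lebesgue_integral_def zero_ereal_def einterval_eq_Ici)
  have ki: "integrable lborel (?k v)" for v
    by (rule Bochner_Integration.integrable_bound[OF int]) (auto simp: norm_mult indicator_def)
  have ki': "integrable lborel (\<lambda>x. ?k (- u) (0 + (-1) * x))"
    by (rule lborel_integrable_real_affine[OF ki]) simp
  have k': "(LINT x|lborel. ?k (- u) (0 + (-1) * x)) = 1 / Complex e (2 * pi * (- u))"
    using lborel_integral_real_affine[of "-1" "?k (- u)" 0] k[of "- u"] by simp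
  have "ft (\<lambda>\<xi>. of_real (exp (- e * \<bar>\<xi>\<bar>))) u = (LINT x|lborel. ?k u x + ?k (- u) (0 + (-1) * x))"
    unfolding ft_def
  proof (rule integral_cong_AE)
    show "AE x in lborel. of_real (exp (- e * \<bar>x\<bar>)) * cis (- (2 * pi * x * u)) = ?k u x + ?k (- u) (0 + (-1) * x)"
      using AE_lborel_singleton[of "0::real"] by eventually_elim (auto simp: indicator_def)
  qed measurable
  also have "\<dots> = 1 / Complex e (2 * pi * u) + 1 / Complex e (2 * pi * (- u))"
    using Bochner_Integration.integral_add[OF ki ki'] k[of u] k' by simp
  also have "\<dots> = of_real (poisson e u)"
    using assms
    by (auto simp: complex_eq_iff poisson_def Re_divide Im_divide power2_eq_square field_simps)
  finally show ?thesis .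
qed

lemma nn_integral_reflect:
  fixes f :: "real \<Rightarrow> ennreal"
  assumes [measurable]: "f \<in> borel_measurable borel"
  shows "(\<integral>\<^sup>+x. f (- x) \<partial>lborel) = (\<integral>\<^sup>+x. f x \<partial>lborel)"
  using nn_integral_real_affine[of f "-1" 0] by simp

lemma nn_integral_shift:
  fixes f :: "real \<Rightarrow> ennreal"
  assumes [measurable]: "f \<in> borel_measurable borel"
  shows "(\<integral>\<^sup>+x. f (c + x) \<partial>lborel) = (\<integral>\<^sup>+x. f x \<partial>lborel)"
  using nn_integral_real_affine[of f 1 c] by simp

text \<open>Schur's test: the product of the two moduli is at most the mean of their squares, and
  the kernel has mass 1 in either variable.\<close>

lemma Schur_poisson:
  assumes [measurable]: "g \<in> borel_measurable borel" and "0 < e"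
  shows "(\<integral>\<^sup>+x. \<integral>\<^sup>+y. ennreal (cmod (g x) * cmod (g y) * poisson e (y - x)) \<partial>lborel \<partial>lborel) \<le> sq_norm g"
proof -
  have p1: "(\<integral>\<^sup>+x. ennreal (poisson e x) \<partial>lborel) = 1"
    using has_bochner_integral_poisson[OF assms(2)] nn_integral_eq_integral[of lborel "poisson e"]
    by (simp add: has_bochner_integral_iff poisson_nonneg[OF assms(2)])
  have p: "(\<integral>\<^sup>+y. ennreal (poisson e (y - x)) \<partial>lborel) = 1"
    "(\<integral>\<^sup>+y. ennreal (poisson e (x - y)) \<partial>lborel) = 1" for x
  proof -
    show 1: "(\<integral>\<^sup>+y. ennreal (poisson e (y - x)) \<partial>lborel) = 1"
      using nn_integral_shift[of "\<lambda>y. ennreal (poisson e y)" "- x"] p1 by simp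
    have "poisson e (x - y) = poisson e (y - x)" for y
      using poisson_minus[of e "y - x"] by simp
    then show "(\<integral>\<^sup>+y. ennreal (poisson e (x - y)) \<partial>lborel) = 1" using 1 by simp
  qed
  let ?p = "\<lambda>x y. ennreal (poisson e (y - x))" and ?q = "\<lambda>x. ennreal ((cmod (g x))\<^sup>2)"
  define c :: real where "c = 1 / 2"
  have c: "0 \<le> c" "ennreal c + ennreal c = 1"
    by (simp add: c_def, subst ennreal_plus[symmetric]) (simp_all add: c_def)
  have "cmod (g x) * cmod (g y) * poisson e (y - x)
      \<le> c * ((cmod (g x))\<^sup>2 * poisson e (y - x)) + c * ((cmod (g y))\<^sup>2 * poisson e (y - x))" for x y
    using mult_right_mono[OF sum_squares_bound[of "cmod (g x)" "cmod (g y)"] poisson_nonneg[OF assms(2), of "y - x"]]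
    by (simp add: algebra_simps c_def)
  then have "(\<integral>\<^sup>+x. \<integral>\<^sup>+y. ennreal (cmod (g x) * cmod (g y) * poisson e (y - x)) \<partial>lborel \<partial>lborel)
      \<le> (\<integral>\<^sup>+x. \<integral>\<^sup>+y. ennreal c * (?q x * ?p x y) + ennreal c * (?q y * ?p x y) \<partial>lborel \<partial>lborel)"
    by (intro nn_integral_mono)
       (simp add: ennreal_mult[symmetric] ennreal_plus[symmetric] poisson_nonneg[OF assms(2)] c(1) del: ennreal_plus)
  also have "\<dots> = ennreal c * (\<integral>\<^sup>+x. \<integral>\<^sup>+y. ?q x * ?p x y \<partial>lborel \<partial>lborel)
      + ennreal c * (\<integral>\<^sup>+x. \<integral>\<^sup>+y. ?q y * ?p x y \<partial>lborel \<partial>lborel)"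
    by (simp add: nn_integral_add nn_integral_cmult)
  also have "(\<integral>\<^sup>+x. \<integral>\<^sup>+y. ?q y * ?p x y \<partial>lborel \<partial>lborel) = (\<integral>\<^sup>+y. \<integral>\<^sup>+x. ?q y * ?p x y \<partial>lborel \<partial>lborel)"
    by (rule lborel_pair.Fubini') measurable
  finally show ?thesis
    by (simp add: nn_integral_cmult p distrib_right[symmetric] c(2))
qed

text \<open>The weight makes everything absolutely integrable. The left side is the pairing of
  \<open>ft g\<close> with \<open>h\<close>, the weighted conjugate of \<open>ft g\<close>; the
  multiplication formula moves the transform onto \<open>h\<close>, and \<open>ft h\<close> is a
  Poisson mean of \<open>cnj g\<close>, so that Schur's test concludes.\<close>

lemma weighted_Plancherel:
  assumes g: "integrable lborel g" and e: "0 < e"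
  shows "(\<integral>\<^sup>+\<xi>. ennreal (exp (- e * \<bar>\<xi>\<bar>) * (cmod (ft g \<xi>))\<^sup>2) \<partial>lborel) \<le> sq_norm g"
proof -
  note [measurable] = borel_measurable_integrable[OF g]
  define w where "w \<xi> = complex_of_real (exp (- e * \<bar>\<xi>\<bar>))" for \<xi>
  have [measurable]: "w \<in> borel_measurable borel" unfolding w_def by measurable
  have w: "integrable lborel w"
    unfolding w_def using integrable_exp_abs[OF e] by (simp add: integrable_of_real)
  define h where "h \<xi> = w \<xi> * cnj (ft g \<xi>)" for \<xi>
  have [measurable]: "h \<in> borel_measurable borel" unfolding h_def by measurable
  have h: "integrable lborel h"
  proof (rule Bochner_Integration.integrable_bound)
    show "integrable lborel (\<lambda>\<xi>. (LINT x|lborel. cmod (g x)) * cmod (w \<xi>))"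
      using w by (intro integrable_mult_right integrable_norm)
    show "AE \<xi> in lborel. norm (h \<xi>) \<le> norm ((LINT x|lborel. cmod (g x)) * cmod (w \<xi>))"
      using cmod_ft_le[OF g] by (auto simp: h_def norm_mult mult.commute abs_mult intro!: mult_left_mono order_trans[OF _ abs_ge_self])
  qed measurable
  have fth: "ft h x = (LINT y|lborel. cnj (g y) * of_real (poisson e (y - x)))" for x
  proof -
    have cg: "integrable lborel (\<lambda>y. cnj (g y))" using g by simp
    have "ft h x = (LINT \<xi>|lborel. w \<xi> * (LINT y|lborel. cnj (g y) * (cis (2 * pi * y * \<xi>) * cis (- (2 * pi * \<xi> * x)))))"
      unfolding ft_def h_def
    proof (rule Bochner_Integration.integral_cong, simp)
      fix \<xi> :: real
      have "cnj (LINT x|lborel. g x * cis (- (2 * pi * x * \<xi>))) = (LINT y|lborel. cnj (g y) * cis (2 * pi * y * \<xi>))"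
        using Bochner_Integration.integral_cnj[of lborel "\<lambda>x. g x * cis (- (2 * pi * x * \<xi>))"] by (simp add: cis_cnj)
      then show "w \<xi> * cnj (LINT x|lborel. g x * cis (- (2 * pi * x * \<xi>))) * cis (- (2 * pi * \<xi> * x))
          = w \<xi> * (LINT y|lborel. cnj (g y) * (cis (2 * pi * y * \<xi>) * cis (- (2 * pi * \<xi> * x))))"
        by (simp add: mult.assoc[symmetric])
    qed
    also have "\<dots> = (LINT y|lborel. cnj (g y) * (LINT \<xi>|lborel. w \<xi> * (cis (2 * pi * y * \<xi>) * cis (- (2 * pi * \<xi> * x)))))"
      by (rule integral_pair_swap[OF w cg, where B = 1]) (auto simp: norm_mult)
    also have "\<dots> = (LINT y|lborel. cnj (g y) * of_real (poisson e (x - y)))"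
      unfolding ft_exp_abs[OF e, symmetric]
      by (intro Bochner_Integration.integral_cong refl)
         (simp add: ft_def w_def cis_mult algebra_simps)
    finally show ?thesis using poisson_minus[of e "_ - x"] by simp
  qed
  have "(\<integral>\<^sup>+\<xi>. ennreal (exp (- e * \<bar>\<xi>\<bar>) * (cmod (ft g \<xi>))\<^sup>2) \<partial>lborel)
      = (\<integral>\<^sup>+\<xi>. ennreal (cmod (ft g \<xi> * h \<xi>)) \<partial>lborel)"
    by (intro nn_integral_cong) (auto simp: h_def w_def norm_mult power2_eq_square mult_ac)
  also have "\<dots> = ennreal (LINT \<xi>|lborel. cmod (ft g \<xi> * h \<xi>))"
  proof (rule nn_integral_eq_integral)
    show "integrable lborel (\<lambda>\<xi>. cmod (ft g \<xi> * h \<xi>))"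
    proof (rule Bochner_Integration.integrable_bound)
      show "integrable lborel (\<lambda>\<xi>. (LINT x|lborel. cmod (g x)) * cmod (h \<xi>))"
        using h by (intro integrable_mult_right integrable_norm)
      show "AE \<xi> in lborel. norm (cmod (ft g \<xi> * h \<xi>)) \<le> norm ((LINT x|lborel. cmod (g x)) * cmod (h \<xi>))"
        using cmod_ft_le[OF g] by (auto simp: norm_mult abs_mult intro!: mult_right_mono order_trans[OF _ abs_ge_self])
    qed measurable
  qed auto
  \<comment> \<open>The integrand is nonnegative, so nothing is lost by moving the modulus outside;
    only in that form does the multiplication formula apply.\<close>
  also have "(LINT \<xi>|lborel. cmod (ft g \<xi> * h \<xi>)) = cmod (LINT \<xi>|lborel. ft g \<xi> * h \<xi>)"
  proof -
    have "ft g \<xi> * h \<xi> = of_real (cmod (ft g \<xi> * h \<xi>))" for \<xi>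
      using complex_norm_square[of "ft g \<xi>"] by (simp add: h_def w_def norm_mult power2_eq_square mult_ac)
    then have "(LINT \<xi>|lborel. ft g \<xi> * h \<xi>) = of_real (LINT \<xi>|lborel. cmod (ft g \<xi> * h \<xi>))"
      by (metis (no_types, lifting) Bochner_Integration.integral_cong integral_complex_of_real)
    then show ?thesis
      by (simp only: norm_of_real) simp
  qed
  also have "(LINT \<xi>|lborel. ft g \<xi> * h \<xi>) = (LINT x|lborel. g x * ft h x)"
    using ft_swap[OF g h] by simp
  also have "ennreal (cmod \<dots>) \<le> (\<integral>\<^sup>+x. ennreal (cmod (g x * ft h x)) \<partial>lborel)"
  proof (cases "integrable lborel (\<lambda>x. g x * ft h x)")
    case True
    then show ?thesis using integral_norm_bound_ennreal[OF True] by simp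
  qed (simp add: not_integrable_integral_eq)
  also have "\<dots> \<le> (\<integral>\<^sup>+x. ennreal (cmod (g x)) * (\<integral>\<^sup>+y. ennreal (cmod (g y) * poisson e (y - x)) \<partial>lborel) \<partial>lborel)"
  proof (rule nn_integral_mono)
    fix x
    have "ennreal (cmod (ft h x)) \<le> (\<integral>\<^sup>+y. ennreal (cmod (g y) * poisson e (y - x)) \<partial>lborel)"
    proof (cases "integrable lborel (\<lambda>y. cnj (g y) * of_real (poisson e (y - x)))")
      case True
      then show ?thesis
        using integral_norm_bound_ennreal[OF True] by (simp add: fth norm_mult poisson_nonneg[OF e])
    qed (simp add: fth not_integrable_integral_eq)
    then show "ennreal (cmod (g x * ft h x)) \<le> ennreal (cmod (g x)) * (\<integral>\<^sup>+y. ennreal (cmod (g y) * poisson e (y - x)) \<partial>lborel)"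
      by (auto simp: norm_mult ennreal_mult intro!: mult_left_mono)
  qed
  also have "\<dots> = (\<integral>\<^sup>+x. \<integral>\<^sup>+y. ennreal (cmod (g x) * cmod (g y) * poisson e (y - x)) \<partial>lborel \<partial>lborel)"
    by (intro nn_integral_cong, subst nn_integral_cmult[symmetric])
       (auto simp: ennreal_mult'[symmetric] mult.assoc intro!: nn_integral_cong)
  also have "\<dots> \<le> sq_norm g"
    by (rule Schur_poisson[OF _ e]) measurable
  finally show ?thesis .
qed

text \<open>Fatou's lemma as the weight increases to 1. The right-hand side is infinite if the
  integrable function \<open>g\<close> is not square integrable.\<close>

theorem Plancherel_le:
  assumes g: "integrable lborel g"
  shows "sq_norm (ft g) \<le> sq_norm g"
proof -
  note [measurable] = borel_measurable_integrable[OF g]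
  let ?f = "\<lambda>n \<xi>. ennreal (exp (- (1 / real (Suc n)) * \<bar>\<xi>\<bar>) * (cmod (ft g \<xi>))\<^sup>2)"
  have "(\<lambda>n. ?f n \<xi>) \<longlonglongrightarrow> ennreal ((cmod (ft g \<xi>))\<^sup>2)" for \<xi>
  proof (rule tendsto_ennrealI)
    have "(\<lambda>n. exp (- (1 / real (Suc n)) * \<bar>\<xi>\<bar>) * (cmod (ft g \<xi>))\<^sup>2) \<longlonglongrightarrow> exp (- 0 * \<bar>\<xi>\<bar>) * (cmod (ft g \<xi>))\<^sup>2"
      by (intro tendsto_intros LIMSEQ_Suc[OF lim_1_over_n])
    then show "(\<lambda>n. exp (- (1 / real (Suc n)) * \<bar>\<xi>\<bar>) * (cmod (ft g \<xi>))\<^sup>2) \<longlonglongrightarrow> (cmod (ft g \<xi>))\<^sup>2"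
      by simp
  qed
  then have "sq_norm (ft g) = (\<integral>\<^sup>+\<xi>. liminf (\<lambda>n. ?f n \<xi>) \<partial>lborel)"
    by (intro nn_integral_cong) (metis lim_imp_Liminf sequentially_bot)
  also have "\<dots> \<le> liminf (\<lambda>n. \<integral>\<^sup>+\<xi>. ?f n \<xi> \<partial>lborel)"
    by (rule nn_integral_liminf) measurable
  also have "\<dots> \<le> liminf (\<lambda>n. sq_norm g)"
    using weighted_Plancherel[OF g, of "1 / real (Suc _)"] by (intro Liminf_mono always_eventually allI) simp
  finally show ?thesis by (simp add: Liminf_const)
qed

section \<open>The Fourier transform of square integrable functions\<close>

text \<open>The Riesz-Fischer theorem: a rapidly convergent subsequence converges almost everywhere,
  and Fatou's lemma transfers the Cauchy condition to its limit.\<close>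

lemma L2_complete:
  fixes F :: "nat \<Rightarrow> real \<Rightarrow> complex"
  assumes [measurable]: "\<And>n. F n \<in> borel_measurable borel"
    and Cauchy: "\<And>e. 0 < e \<Longrightarrow> \<exists>N. \<forall>m\<ge>N. \<forall>n\<ge>N. sq_norm (\<lambda>x. F m x - F n x) \<le> ennreal e"
  obtains G where "G \<in> borel_measurable borel" "(\<lambda>n. sq_norm (\<lambda>x. G x - F n x)) \<longlonglongrightarrow> 0"
proof -
  have "\<exists>N. \<forall>k. \<forall>m\<ge>N k. \<forall>n\<ge>N k. sq_norm (\<lambda>x. F m x - F n x) \<le> ennreal ((1/4) ^ k)"
    by (intro choice allI Cauchy) simp
  then obtain N :: "nat \<Rightarrow> nat"
    where N: "\<And>k m n. N k \<le> m \<Longrightarrow> N k \<le> n \<Longrightarrow> sq_norm (\<lambda>x. F m x - F n x) \<le> ennreal ((1/4) ^ k)"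
    by blast
  define M where "M k = k + (\<Sum>j\<le>k. N j)" for k
  have M: "N k \<le> M k" "M k \<le> M (Suc k)" "k \<le> M k" for k
    unfolding M_def using member_le_sum[of k "{..k}" N] by auto
  define d where "d k x = F (M (Suc k)) x - F (M k) x" for k x
  have [measurable]: "d k \<in> borel_measurable borel" for k unfolding d_def by measurable
  have d: "sq_norm (d k) \<le> ennreal ((1/4) ^ k)" for k
    unfolding d_def using M[of k] by (intro N) auto
  \<comment> \<open>The weight \<open>2 ^ k\<close> is affordable because the squared norms are at
    most \<open>(1/4) ^ k\<close>. Where the weighted series is finite its terms are bounded, so
    \<open>d k x\<close> decays like \<open>2 powr (- k / 2)\<close> and is summable in
    \<open>k\<close>.\<close>
  have "(\<integral>\<^sup>+x. (\<Sum>k. ennreal (2 ^ k * (cmod (d k x))\<^sup>2)) \<partial>lborel) = (\<Sum>k. \<integral>\<^sup>+x. ennreal (2 ^ k * (cmod (d k x))\<^sup>2) \<partial>lborel)"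
    by (intro nn_integral_suminf) measurable
  also have "\<dots> \<le> (\<Sum>k. ennreal ((1/2) ^ k))"
  proof (intro suminf_le)
    fix k
    have "(\<integral>\<^sup>+x. ennreal (2 ^ k * (cmod (d k x))\<^sup>2) \<partial>lborel) = ennreal (2 ^ k) * sq_norm (d k)"
      by (simp add: ennreal_mult nn_integral_cmult)
    also have "\<dots> \<le> ennreal (2 ^ k) * ennreal ((1/4) ^ k)"
      by (intro mult_left_mono d) auto
    also have "\<dots> = ennreal ((1/2) ^ k)"
      by (simp add: ennreal_mult'[symmetric] power_mult_distrib[symmetric] del: power_one_over)
    finally show "(\<integral>\<^sup>+x. ennreal (2 ^ k * (cmod (d k x))\<^sup>2) \<partial>lborel) \<le> ennreal ((1/2) ^ k)" .
  qed auto
  also have "\<dots> < \<infinity>"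
    by (subst suminf_ennreal2) auto
  finally have "AE x in lborel. (\<Sum>k. ennreal (2 ^ k * (cmod (d k x))\<^sup>2)) \<noteq> \<infinity>"
    by (intro nn_integral_PInf_AE) auto
  then have conv: "AE x in lborel. convergent (\<lambda>k. F (M k) x)"
  proof eventually_elim
    case (elim x)
    then have "summable (\<lambda>k. 2 ^ k * (cmod (d k x))\<^sup>2)"
      by (intro summable_suminf_not_top) auto
    then have "Bseq (\<lambda>k. 2 ^ k * (cmod (d k x))\<^sup>2)"
      by (intro convergent_imp_Bseq) (auto dest: summable_LIMSEQ_zero simp: convergent_def)
    then obtain K where K: "0 < K" "\<And>k. norm (2 ^ k * (cmod (d k x))\<^sup>2) \<le> K"
      by (auto simp: Bseq_def)
    have "cmod (d k x) \<le> sqrt K * sqrt (1/2) ^ k" for k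
    proof -
      have "(cmod (d k x))\<^sup>2 \<le> K * (1/2) ^ k"
        using K(2)[of k] by (simp add: field_simps)
      then show ?thesis
        using real_le_rsqrt by (simp only: real_sqrt_mult[symmetric] real_sqrt_power[symmetric])
    qed
    moreover have "norm (sqrt (1/2)) < 1"
      using real_sqrt_lt_1_iff[of "1/2"] by (simp del: real_sqrt_lt_1_iff)
    then have "summable (\<lambda>k. sqrt K * sqrt (1/2) ^ k)"
      by (intro summable_mult summable_geometric)
    ultimately have "summable (\<lambda>k. d k x)"
      by (meson summable_comparison_test)
    then have "convergent (\<lambda>n. F (M 0) x + (\<Sum>k<n. d k x))"
      by (intro convergent_add convergent_const) (simp add: summable_iff_convergent)
    moreover have "F (M 0) x + (\<Sum>k<n. d k x) = F (M n) x" for n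
      by (induction n) (simp, simp add: d_def algebra_simps)
    ultimately show ?case by simp
  qed
  \<comment> \<open>\<open>lim\<close> is taken at every point: it is the true limit almost
    everywhere and an arbitrary value on the exceptional null set.\<close>
  define G where "G x = lim (\<lambda>k. F (M k) x)" for x
  have [measurable]: "G \<in> borel_measurable borel"
    unfolding G_def by measurable
  have conv': "AE x in lborel. (\<lambda>k. F (M k) x) \<longlonglongrightarrow> G x"
    using conv by eventually_elim (simp add: G_def convergent_LIMSEQ_iff)
  have "(\<lambda>n. sq_norm (\<lambda>x. G x - F n x)) \<longlonglongrightarrow> 0"
  proof (rule tendsto_zero_ennreal)
    fix e :: real assume "0 < e"
    then obtain K where K: "\<And>m n. K \<le> m \<Longrightarrow> K \<le> n \<Longrightarrow> sq_norm (\<lambda>x. F m x - F n x) \<le> ennreal (e / 2)"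
      using Cauchy[of "e / 2"] by auto
    have "sq_norm (\<lambda>x. G x - F n x) < ennreal e" if n: "K \<le> n" for n
    proof -
      have "AE x in lborel. ennreal ((cmod (G x - F n x))\<^sup>2) = liminf (\<lambda>k. ennreal ((cmod (F (M k) x - F n x))\<^sup>2))"
        using conv'
      proof eventually_elim
        case (elim x)
        then have "(\<lambda>k. ennreal ((cmod (F (M k) x - F n x))\<^sup>2)) \<longlonglongrightarrow> ennreal ((cmod (G x - F n x))\<^sup>2)"
          by (intro tendsto_intros)
        then show ?case by (metis lim_imp_Liminf sequentially_bot)
      qed
      then have "sq_norm (\<lambda>x. G x - F n x) = (\<integral>\<^sup>+x. liminf (\<lambda>k. ennreal ((cmod (F (M k) x - F n x))\<^sup>2)) \<partial>lborel)"
        by (rule nn_integral_cong_AE)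
      also have "\<dots> \<le> liminf (\<lambda>k. sq_norm (\<lambda>x. F (M k) x - F n x))"
        by (rule nn_integral_liminf) measurable
      also have "\<dots> \<le> liminf (\<lambda>k. ennreal (e / 2))"
        using K M(3) n by (intro Liminf_mono eventually_sequentiallyI[of K]) (meson order_trans)
      also have "\<dots> = ennreal (e / 2)" by (simp add: Liminf_const)
      also have "\<dots> < ennreal e" using \<open>0 < e\<close> by (simp add: ennreal_less_iff)
      finally show ?thesis .
    qed
    then show "\<forall>\<^sub>F n in sequentially. sq_norm (\<lambda>x. G x - F n x) < ennreal e"
      by (rule eventually_sequentiallyI)
  qed
  then show ?thesis by (intro that[of G]) auto
qed

abbreviation trunc :: "(real \<Rightarrow> complex) \<Rightarrow> nat \<Rightarrow> real \<Rightarrow> complex" where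
  "trunc f n \<equiv> (\<lambda>x. indicator {- real n..real n} x * f x)"

abbreviation ft_limit :: "(real \<Rightarrow> complex) \<Rightarrow> (real \<Rightarrow> complex) \<Rightarrow> bool" where
  "ft_limit f F \<equiv> (\<lambda>n. sq_norm (\<lambda>\<xi>. F \<xi> - ft (trunc f n) \<xi>)) \<longlonglongrightarrow> 0"

lemma integrable_trunc:
  assumes [measurable]: "f \<in> borel_measurable borel" and "sq_norm f < \<infinity>"
  shows "integrable lborel (trunc f n)"
proof (rule integrable_compact_support)
  have "sq_norm (trunc f n) \<le> sq_norm f"
    by (intro nn_integral_mono) (auto simp: indicator_def)
  then show "sq_norm (trunc f n) < \<infinity>" using assms(2) by (rule le_less_trans)
  show "trunc f n x = 0" if "x \<notin> {- real n..real n}" for x using that by simp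
qed measurable

lemma trunc_tendsto:
  assumes [measurable]: "f \<in> borel_measurable borel" and fin: "sq_norm f < \<infinity>"
  shows "(\<lambda>n. sq_norm (\<lambda>x. f x - trunc f n x)) \<longlonglongrightarrow> 0"
proof -
  have "(\<lambda>n. sq_norm (\<lambda>x. f x - trunc f n x)) \<longlonglongrightarrow> (\<integral>\<^sup>+x. 0 \<partial>(lborel :: real measure))"
  proof (rule nn_integral_dominated_convergence[where w = "\<lambda>x. ennreal ((cmod (f x))\<^sup>2)"])
    show "AE x in lborel. (\<lambda>n. ennreal ((cmod (f x - trunc f n x))\<^sup>2)) \<longlonglongrightarrow> 0"
    proof (intro AE_I2 tendsto_eventually)
      fix x
      show "\<forall>\<^sub>F n in sequentially. ennreal ((cmod (f x - trunc f n x))\<^sup>2) = 0"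
        using eventually_ge_at_top[of "nat \<lceil>\<bar>x\<bar>\<rceil>"]
      proof eventually_elim
        case (elim n)
        then have "x \<in> {- real n..real n}" by auto
        then show ?case by simp
      qed
    qed
    show "AE x in lborel. ennreal ((cmod (f x - trunc f n x))\<^sup>2) \<le> ennreal ((cmod (f x))\<^sup>2)" for n
      by (auto simp: indicator_def)
  qed (use fin in auto)
  then show ?thesis by simp
qed

text \<open>By Plancherel's inequality the transforms inherit the Cauchy property of the
  truncations. The limit is the witness that makes the choice in \<open>fourier_L2\<close>
  meaningful.\<close>

lemma ft_L2_exists:
  assumes [measurable]: "f \<in> borel_measurable borel" and fin: "sq_norm f < \<infinity>"
  obtains F where "F \<in> borel_measurable borel" "sq_norm F < \<infinity>"
    "ft_limit f F"
proof -
  note int = integrable_trunc[OF assms]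
  have step: "sq_norm (\<lambda>\<xi>. ft (trunc f m) \<xi> - ft (trunc f n) \<xi>)
      \<le> 2 * sq_norm (\<lambda>x. f x - trunc f m x) + 2 * sq_norm (\<lambda>x. f x - trunc f n x)" for m n
  proof -
    have "sq_norm (\<lambda>\<xi>. ft (trunc f m) \<xi> - ft (trunc f n) \<xi>) = sq_norm (ft (\<lambda>x. trunc f m x - trunc f n x))"
      by (simp add: ft_diff[OF int int])
    also have "\<dots> \<le> sq_norm (\<lambda>x. trunc f m x - trunc f n x)"
      by (intro Plancherel_le Bochner_Integration.integrable_diff int)
    also have "\<dots> = sq_norm (\<lambda>x. (trunc f m x - f x) + (f x - trunc f n x))"
      by simp
    also have "\<dots> \<le> 2 * sq_norm (\<lambda>x. trunc f m x - f x) + 2 * sq_norm (\<lambda>x. f x - trunc f n x)"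
      by (rule sq_norm_add) measurable
    finally show ?thesis by (simp add: norm_minus_commute)
  qed
  have Cauchy: "\<exists>N. \<forall>m\<ge>N. \<forall>n\<ge>N. sq_norm (\<lambda>\<xi>. ft (trunc f m) \<xi> - ft (trunc f n) \<xi>) \<le> ennreal e"
    if "0 < e" for e
  proof -
    have "\<forall>\<^sub>F n in sequentially. sq_norm (\<lambda>x. f x - trunc f n x) < ennreal (e / 4)"
      using order_tendstoD(2)[OF trunc_tendsto[OF assms]] that by simp
    then obtain N where N: "\<And>n. N \<le> n \<Longrightarrow> sq_norm (\<lambda>x. f x - trunc f n x) < ennreal (e / 4)"
      by (auto simp: eventually_sequentially)
    have e: "2 * ennreal (e / 4) + 2 * ennreal (e / 4) = ennreal e"
      using that by (simp add: ennreal_mult'[symmetric] ennreal_plus[symmetric] flip: ennreal_numeral del: ennreal_plus)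
    have "sq_norm (\<lambda>\<xi>. ft (trunc f m) \<xi> - ft (trunc f n) \<xi>) \<le> ennreal e" if "N \<le> m" "N \<le> n" for m n
      unfolding e[symmetric]
      using N[OF that(1)] N[OF that(2)]
      by (intro order_trans[OF step] add_mono mult_left_mono) auto
    then show ?thesis by blast
  qed
  obtain F where F[measurable]: "F \<in> borel_measurable borel"
    and lim: "(\<lambda>n. sq_norm (\<lambda>x. F x - ft (trunc f n) x)) \<longlonglongrightarrow> 0"
    by (rule L2_complete[of "\<lambda>n. ft (trunc f n)", OF _ Cauchy]) auto
  obtain n where n: "sq_norm (\<lambda>x. F x - ft (trunc f n) x) < 1"
    using order_tendstoD(2)[OF lim, of 1] by (auto simp: eventually_sequentially)
  have "sq_norm F = sq_norm (\<lambda>x. (F x - ft (trunc f n) x) + ft (trunc f n) x)"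
    by simp
  also have "\<dots> \<le> 2 * sq_norm (\<lambda>x. F x - ft (trunc f n) x) + 2 * sq_norm (ft (trunc f n))"
    by (rule sq_norm_add) measurable
  also have "\<dots> < \<infinity>"
  proof -
    have "sq_norm (ft (trunc f n)) \<le> sq_norm (trunc f n)"
      by (rule Plancherel_le[OF int])
    also have "\<dots> \<le> sq_norm f"
      by (intro nn_integral_mono) (auto simp: indicator_def)
    finally have "sq_norm (ft (trunc f n)) < top" using fin by (simp add: le_less_trans)
    moreover have "sq_norm (\<lambda>x. F x - ft (trunc f n) x) < top"
      using n by (rule less_trans) simp
    ultimately show ?thesis by (simp add: ennreal_mult_less_top)
  qed
  finally show ?thesis using that F lim by blast
qed

section \<open>Borel representatives of Lebesgue measurable functions\<close>

lemma complex_ex_borel_AE: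
  assumes "f \<in> borel_measurable lebesgue"
  obtains g :: "real \<Rightarrow> complex" where "g \<in> borel_measurable borel" "AE x in lebesgue. f x = g x"
proof -
  have "(\<lambda>x. Re (f x)) \<in> borel_measurable lebesgue" "(\<lambda>x. Im (f x)) \<in> borel_measurable lebesgue"
    using assms by auto
  from this[THEN completion_ex_borel_measurable_real]
  obtain u v where [measurable]: "u \<in> borel_measurable lborel" "v \<in> borel_measurable lborel"
    and uv: "AE x in lborel. Re (f x) = u x" "AE x in lborel. Im (f x) = v x"
    by auto
  from uv have "AE x in lborel. f x = Complex (u x) (v x)"
    by eventually_elim (simp add: complex_eq_iff)
  moreover have "(\<lambda>x. Complex (u x) (v x)) \<in> borel_measurable borel"
    unfolding Complex_eq by measurable
  ultimately show ?thesis by (intro that[of "\<lambda>x. Complex (u x) (v x)"] AE_completion) auto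
qed

lemma fourier_integral_eq_ft:
  assumes "g \<in> borel_measurable borel" and "AE x in lebesgue. f x = g x" and "f \<in> borel_measurable lebesgue"
  shows "fourier_integral f = ft g"
proof
  fix \<xi>
  note [measurable] = assms(1)
  have "(\<lambda>x. cis (- (2 * pi * x * \<xi>))) \<in> borel_measurable lebesgue"
    by (rule measurable_completion) measurable
  then have "fourier_integral f \<xi> = (LINT x|lebesgue. g x * cis (- (2 * pi * x * \<xi>)))"
    unfolding fourier_integral_def using assms(2,3) measurable_completion[of g lborel borel] assms(1)
    by (intro integral_cong_AE) auto
  also have "\<dots> = ft g \<xi>"
    unfolding ft_def by (rule integral_completion) measurable
  finally show "fourier_integral f \<xi> = ft g \<xi>" .
qed

lemma L2_real_iff_borel:
  assumes "g \<in> borel_measurable borel" and "AE x in lebesgue. f x = g x" and "f \<in> borel_measurable lebesgue"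
  shows "f \<in> L2_real \<longleftrightarrow> sq_norm g < \<infinity>"
proof -
  note [measurable] = assms(1)
  have "integrable lebesgue (\<lambda>x. (cmod (f x))\<^sup>2) \<longleftrightarrow> integrable lebesgue (\<lambda>x. (cmod (g x))\<^sup>2)"
  proof (rule integrable_cong_AE)
    show "AE x in lebesgue. (cmod (f x))\<^sup>2 = (cmod (g x))\<^sup>2"
      using assms(2) by eventually_elim simp
    show "(\<lambda>x. (cmod (f x))\<^sup>2) \<in> borel_measurable lebesgue"
      using assms(3) by measurable
    show "(\<lambda>x. (cmod (g x))\<^sup>2) \<in> borel_measurable lebesgue"
      by (rule measurable_completion) measurable
  qed
  also have "\<dots> \<longleftrightarrow> integrable lborel (\<lambda>x. (cmod (g x))\<^sup>2)"
    by (rule integrable_completion) measurable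
  finally show ?thesis using assms by (simp add: L2_real_def square_integrable_iff)
qed

text \<open>\<open>fourier_L2 f\<close> is an arbitrary choice, so its properties follow only from
  the existence of some limit. Both \<open>f\<close> and \<open>fourier_L2 f\<close> are replaced by
  Borel functions that agree with them almost everywhere; the kernel estimates are carried out for
  these in \<open>lborel\<close>.\<close>

lemma fourier_L2_borel:
  assumes f: "f \<in> L2_real"
  obtains g F where "g \<in> borel_measurable borel" "AE x in lebesgue. f x = g x" "sq_norm g < \<infinity>"
    "fourier_L2 f \<in> borel_measurable lebesgue"
    "F \<in> borel_measurable borel" "AE \<xi> in lebesgue. fourier_L2 f \<xi> = F \<xi>" "sq_norm F < \<infinity>"
    "ft_limit g F"
proof -
  have fm: "f \<in> borel_measurable lebesgue" using f by (simp add: L2_real_def)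
  then obtain g where g[measurable]: "g \<in> borel_measurable borel" and ae: "AE x in lebesgue. f x = g x"
    by (rule complex_ex_borel_AE)
  have fin: "sq_norm g < \<infinity>" using L2_real_iff_borel[OF g ae fm] f by simp
  have tr: "fourier_integral (\<lambda>x. indicator {- real n..real n} x * f x) = ft (trunc g n)" for n
  proof (rule fourier_integral_eq_ft)
    show "AE x in lebesgue. indicator {- real n..real n} x * f x = trunc g n x"
      using ae by eventually_elim simp
    show "(\<lambda>x. indicator {- real n..real n} x * f x) \<in> borel_measurable lebesgue"
      using fm by (intro borel_measurable_times borel_measurable_indicator) auto
  qed (use fm in auto)
  let ?P = "\<lambda>h. h \<in> L2_real \<and>
     (\<lambda>n. \<integral>\<^sup>+\<xi>. ennreal ((cmod (h \<xi> - fourier_integral (\<lambda>x. indicator {- real n..real n} x * f x) \<xi>))\<^sup>2) \<partial>lebesgue)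
       \<longlonglongrightarrow> 0"
  obtain F0 where F0: "F0 \<in> borel_measurable borel" "sq_norm F0 < \<infinity>"
    "(\<lambda>n. sq_norm (\<lambda>\<xi>. F0 \<xi> - ft (trunc g n) \<xi>)) \<longlonglongrightarrow> 0"
    by (rule ft_L2_exists[OF g fin])
  have "F0 \<in> L2_real"
    using L2_real_iff_borel[OF F0(1) _ measurable_completion] F0(1,2) by simp
  moreover have "(\<integral>\<^sup>+\<xi>. ennreal ((cmod (F0 \<xi> - ft (trunc g n) \<xi>))\<^sup>2) \<partial>lebesgue)
      = sq_norm (\<lambda>\<xi>. F0 \<xi> - ft (trunc g n) \<xi>)" for n
    by (rule nn_integral_completion)
  ultimately have "?P F0"
    unfolding tr using F0(3) by (simp only:)
  then have P: "?P (fourier_L2 f)"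
    unfolding fourier_L2_def by (rule someI[where P = ?P])
  then have Fm: "fourier_L2 f \<in> borel_measurable lebesgue" by (simp add: L2_real_def)
  then obtain F where F: "F \<in> borel_measurable borel" and aeF: "AE x in lebesgue. fourier_L2 f x = F x"
    by (rule complex_ex_borel_AE)
  have eq: "(\<integral>\<^sup>+\<xi>. ennreal ((cmod (fourier_L2 f \<xi> - fourier_integral (\<lambda>x. indicator {- real n..real n} x * f x) \<xi>))\<^sup>2) \<partial>lebesgue)
     = sq_norm (\<lambda>\<xi>. F \<xi> - ft (trunc g n) \<xi>)" for n
  proof -
    have "(\<integral>\<^sup>+\<xi>. ennreal ((cmod (fourier_L2 f \<xi> - fourier_integral (\<lambda>x. indicator {- real n..real n} x * f x) \<xi>))\<^sup>2) \<partial>lebesgue)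
       = (\<integral>\<^sup>+\<xi>. ennreal ((cmod (F \<xi> - ft (trunc g n) \<xi>))\<^sup>2) \<partial>lebesgue)"
      unfolding tr
    proof (rule nn_integral_cong_AE)
      show "AE \<xi> in lebesgue. ennreal ((cmod (fourier_L2 f \<xi> - ft (trunc g n) \<xi>))\<^sup>2)
          = ennreal ((cmod (F \<xi> - ft (trunc g n) \<xi>))\<^sup>2)"
        using aeF by eventually_elim simp
    qed
    then show ?thesis by (simp only: nn_integral_completion)
  qed
  show ?thesis
  proof (rule that[OF g ae fin Fm F aeF])
    show "sq_norm F < \<infinity>" using P L2_real_iff_borel[OF F aeF Fm] by blast
    show "ft_limit g F"
      using P unfolding eq by blast
  qed
qed

text \<open>The multiplication formula for square integrable \<open>f\<close>. It holds for each
  truncation; the space side converges by dominated convergence, the frequency side by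
  Cauchy-Schwarz against \<open>l\<close>.\<close>

lemma ft_L2_pairing:
  assumes f[measurable]: "f \<in> borel_measurable borel" and fin: "sq_norm f < \<infinity>"
    and F[measurable]: "F \<in> borel_measurable borel" and Ffin: "sq_norm F < \<infinity>"
    and lim: "ft_limit f F"
    and l: "integrable lborel l" and lfin: "sq_norm l < \<infinity>"
  shows "(LINT \<xi>|lborel. F \<xi> * l \<xi>) = (LINT x|lborel. f x * ft l x)"
proof -
  note [measurable] = borel_measurable_integrable[OF l]
  note int = integrable_trunc[OF f fin]
  have ftl: "sq_norm (ft l) < \<infinity>" using Plancherel_le[OF l] lfin by (rule le_less_trans)
  have i1: "integrable lborel (\<lambda>x. f x * ft l x)"
    by (rule integrable_mult_square_integrable) (use fin ftl in auto)
  have i2: "integrable lborel (\<lambda>\<xi>. F \<xi> * l \<xi>)"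
    by (rule integrable_mult_square_integrable) (use Ffin lfin in auto)
  have tfin: "sq_norm (ft (trunc f n)) < \<infinity>" for n
  proof -
    have "sq_norm (ft (trunc f n)) \<le> sq_norm (trunc f n)"
      by (rule Plancherel_le[OF int])
    also have "\<dots> \<le> sq_norm f"
      by (intro nn_integral_mono) (auto simp: indicator_def)
    finally show ?thesis using fin by (rule le_less_trans)
  qed
  have i3: "integrable lborel (\<lambda>\<xi>. ft (trunc f n) \<xi> * l \<xi>)" for n
    by (rule integrable_mult_square_integrable) (use tfin lfin in auto)
  have "(\<lambda>n. LINT x|lborel. trunc f n x * ft l x) \<longlonglongrightarrow> (LINT x|lborel. f x * ft l x)"
  proof (rule integral_dominated_convergence[where w = "\<lambda>x. cmod (f x * ft l x)"])
    show "AE x in lborel. (\<lambda>n. trunc f n x * ft l x) \<longlonglongrightarrow> f x * ft l x"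
    proof (intro AE_I2 tendsto_eventually)
      fix x
      show "\<forall>\<^sub>F n in sequentially. trunc f n x * ft l x = f x * ft l x"
        using eventually_ge_at_top[of "nat \<lceil>\<bar>x\<bar>\<rceil>"]
      proof eventually_elim
        case (elim n)
        then have "x \<in> {- real n..real n}" by auto
        then show ?case by simp
      qed
    qed
    show "AE x in lborel. norm (trunc f n x * ft l x) \<le> cmod (f x * ft l x)" for n
      by (auto simp: indicator_def norm_mult)
  qed (use i1 in auto)
  moreover have "(\<lambda>n. LINT x|lborel. trunc f n x * ft l x) \<longlonglongrightarrow> (LINT \<xi>|lborel. F \<xi> * l \<xi>)"
  proof -
    let ?d = "\<lambda>n. (LINT \<xi>|lborel. F \<xi> * l \<xi>) - (LINT x|lborel. trunc f n x * ft l x)"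
    have "(\<lambda>n. ennreal ((cmod (?d n))\<^sup>2)) \<longlonglongrightarrow> 0"
    proof (rule tendsto_sandwich[where f = "\<lambda>_. 0" and h = "\<lambda>n. sq_norm (\<lambda>\<xi>. F \<xi> - ft (trunc f n) \<xi>) * sq_norm l"])
      show "(\<lambda>n. sq_norm (\<lambda>\<xi>. F \<xi> - ft (trunc f n) \<xi>) * sq_norm l) \<longlonglongrightarrow> 0"
        using ennreal_tendsto_cmult[OF _ lim, of "sq_norm l"] lfin by (simp add: mult.commute)
      have "ennreal ((cmod (?d n))\<^sup>2)
          \<le> sq_norm (\<lambda>\<xi>. F \<xi> - ft (trunc f n) \<xi>) * sq_norm l" for n
      proof -
        have "?d n
           = (LINT \<xi>|lborel. (F \<xi> - ft (trunc f n) \<xi>) * l \<xi>)"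
          unfolding ft_swap[OF int l] left_diff_distrib
          by (rule Bochner_Integration.integral_diff[symmetric, OF i2 i3])
        then show ?thesis by (simp add: Cauchy_Schwarz_lborel)
      qed
      then show "\<forall>\<^sub>F n in sequentially. ennreal ((cmod (?d n))\<^sup>2)
          \<le> sq_norm (\<lambda>\<xi>. F \<xi> - ft (trunc f n) \<xi>) * sq_norm l" by simp
    qed auto
    then have "(\<lambda>n. (cmod (?d n))\<^sup>2) \<longlonglongrightarrow> 0"
      using tendsto_ennreal_iff[of "\<lambda>n. (cmod (?d n))\<^sup>2" sequentially 0] by simp
    then have "(\<lambda>n. ?d n) \<longlonglongrightarrow> 0"
      by (simp add: tendsto_norm_zero_iff)
    then show ?thesis
      by (rule Lim_transform2[OF tendsto_const])
  qed
  ultimately show ?thesis by (rule LIMSEQ_unique[symmetric])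
qed

section \<open>Orthogonality over disjoint frequency intervals\<close>

lemma sum_sq_norm_disjoint:
  fixes a b :: "nat \<Rightarrow> real"
  assumes [measurable]: "G \<in> borel_measurable borel"
    and fin: "finite I" and disj: "disjoint_family_on (\<lambda>m. {a m..b m}) I"
  shows "(\<Sum>m\<in>I. sq_norm (on_Icc (a m) (b m) G)) \<le> sq_norm G"
proof -
  have "(\<Sum>m\<in>I. sq_norm (on_Icc (a m) (b m) G))
      = (\<integral>\<^sup>+\<xi>. (\<Sum>m\<in>I. ennreal ((cmod (indicator {a m..b m} \<xi> * G \<xi>))\<^sup>2)) \<partial>lborel)"
    by (rule nn_integral_sum[symmetric]) measurable
  also have "\<dots> \<le> sq_norm G"
  proof (rule nn_integral_mono)
    fix \<xi>
    show "(\<Sum>m\<in>I. ennreal ((cmod (indicator {a m..b m} \<xi> * G \<xi>))\<^sup>2)) \<le> ennreal ((cmod (G \<xi>))\<^sup>2)"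
    proof (cases "\<exists>k\<in>I. \<xi> \<in> {a k..b k}")
      case True
      then obtain k where k: "k \<in> I" "\<xi> \<in> {a k..b k}" by blast
      have "ennreal ((cmod (indicator {a m..b m} \<xi> * G \<xi>))\<^sup>2) = 0" if "m \<in> I - {k}" for m
      proof -
        have "{a m..b m} \<inter> {a k..b k} = {}"
          using disj that k by (intro disjoint_family_onD[OF disj]) auto
        then have "\<xi> \<notin> {a m..b m}" using k(2) by blast
        then show ?thesis by (simp add: indicator_def)
      qed
      then have "(\<Sum>m\<in>I. ennreal ((cmod (indicator {a m..b m} \<xi> * G \<xi>))\<^sup>2))
          = (\<Sum>m\<in>{k}. ennreal ((cmod (indicator {a m..b m} \<xi> * G \<xi>))\<^sup>2))"
        using k by (intro sum.mono_neutral_right fin) auto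
      then show ?thesis using k by simp
    next
      case False
      then have "(\<Sum>m\<in>I. ennreal ((cmod (indicator {a m..b m} \<xi> * G \<xi>))\<^sup>2)) = 0"
        by (intro sum.neutral) auto
      then show ?thesis by simp
    qed
  qed
  finally show ?thesis .
qed

text \<open>With the transform moved onto \<open>g\<close>, the m-th coefficient sees
  \<open>ft g\<close> only on \<open>{a m..b m}\<close>; Cauchy-Schwarz there, disjointness and
  Plancherel's inequality give the sum. The constant is a common bound for the squared norms of the
  symbols, not for their suprema.\<close>

lemma Bessel_disjoint:
  fixes a b :: "nat \<Rightarrow> real"
  assumes g: "integrable lborel g"
    and fin: "finite I" and disj: "disjoint_family_on (\<lambda>m. {a m..b m}) I"
    and \<theta>[measurable]: "\<And>m. m \<in> I \<Longrightarrow> \<theta> m \<in> borel_measurable borel"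
    and supp: "\<And>m x. m \<in> I \<Longrightarrow> x \<notin> {a m..b m} \<Longrightarrow> \<theta> m x = 0"
    and D: "\<And>m. m \<in> I \<Longrightarrow> sq_norm (\<theta> m) \<le> D" "D < \<infinity>"
  shows "(\<Sum>m\<in>I. ennreal ((cmod (LINT x|lborel. g x * ft (\<theta> m) x))\<^sup>2)) \<le> D * sq_norm g"
proof -
  note [measurable] = borel_measurable_integrable[OF g]
  have "(\<Sum>m\<in>I. ennreal ((cmod (LINT x|lborel. g x * ft (\<theta> m) x))\<^sup>2))
      \<le> (\<Sum>m\<in>I. D * sq_norm (on_Icc (a m) (b m) (ft g)))"
  proof (rule sum_mono)
    fix m assume m: "m \<in> I"
    note [measurable] = \<theta>[OF m]
    have "integrable lborel (\<theta> m)"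
      by (rule integrable_compact_support[OF \<theta>[OF m] le_less_trans[OF D(1)[OF m] D(2)] supp[OF m]])
    then have "(LINT x|lborel. g x * ft (\<theta> m) x) = (LINT \<xi>|lborel. ft g \<xi> * \<theta> m \<xi>)"
      by (rule ft_swap[OF g])
    also have "\<dots> = (LINT \<xi>|lborel. \<theta> m \<xi> * (indicator {a m..b m} \<xi> * ft g \<xi>))"
      using supp[OF m] by (intro Bochner_Integration.integral_cong) (auto simp: indicator_def)
    also have "ennreal ((cmod \<dots>)\<^sup>2) \<le> sq_norm (\<theta> m) * sq_norm (on_Icc (a m) (b m) (ft g))"
      by (rule Cauchy_Schwarz_lborel) measurable
    also have "\<dots> \<le> D * sq_norm (on_Icc (a m) (b m) (ft g))"
      by (intro mult_right_mono D m) simp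
    finally show "ennreal ((cmod (LINT x|lborel. g x * ft (\<theta> m) x))\<^sup>2)
        \<le> D * sq_norm (on_Icc (a m) (b m) (ft g))" .
  qed
  also have "\<dots> = D * (\<Sum>m\<in>I. sq_norm (on_Icc (a m) (b m) (ft g)))"
    by (simp add: sum_distrib_left)
  also have "\<dots> \<le> D * sq_norm (ft g)"
    by (intro mult_left_mono sum_sq_norm_disjoint fin disj) auto
  also have "\<dots> \<le> D * sq_norm g"
    by (intro mult_left_mono Plancherel_le g) simp
  finally show ?thesis .
qed

text \<open>Serves the part of the data near the interval, where boundedness of the multipliers is
  enough: each inverse transform is again estimated by Plancherel's inequality, and the frequency
  supports are disjoint.\<close>

lemma sum_sq_norm_multiplier:
  fixes a b :: "nat \<Rightarrow> real"
  assumes g: "integrable lborel g" and gfin: "sq_norm g < \<infinity>"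
    and fin: "finite I" and disj: "disjoint_family_on (\<lambda>m. {a m..b m}) I"
    and \<eta>[measurable]: "\<And>m. m \<in> I \<Longrightarrow> \<eta> m \<in> borel_measurable borel"
    and supp: "\<And>m x. m \<in> I \<Longrightarrow> x \<notin> {a m..b m} \<Longrightarrow> \<eta> m x = 0"
    and B: "\<And>m x. m \<in> I \<Longrightarrow> cmod (\<eta> m x) \<le> B"
  shows "(\<Sum>m\<in>I. sq_norm (\<lambda>x. LINT \<xi>|lborel. ft g \<xi> * \<eta> m \<xi> * cis (2 * pi * x * \<xi>))) \<le> ennreal (B\<^sup>2) * sq_norm g"
proof -
  note [measurable] = borel_measurable_integrable[OF g]
  have "(\<Sum>m\<in>I. sq_norm (\<lambda>x. LINT \<xi>|lborel. ft g \<xi> * \<eta> m \<xi> * cis (2 * pi * x * \<xi>)))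
     \<le> (\<Sum>m\<in>I. ennreal (B\<^sup>2) * sq_norm (on_Icc (a m) (b m) (ft g)))"
  proof (rule sum_mono)
    fix m assume m: "m \<in> I"
    note [measurable] = \<eta>[OF m]
    let ?h = "\<lambda>\<xi>. ft g \<xi> * \<eta> m \<xi>"
    have "sq_norm ?h \<le> (\<integral>\<^sup>+\<xi>. ennreal (B\<^sup>2) * ennreal ((cmod (indicator {a m..b m} \<xi> * ft g \<xi>))\<^sup>2) \<partial>lborel)"
    proof (intro nn_integral_mono)
      fix \<xi>
      have "(cmod (?h \<xi>))\<^sup>2 \<le> B\<^sup>2 * (cmod (indicator {a m..b m} \<xi> * ft g \<xi>))\<^sup>2"
        using supp[OF m, of \<xi>] power_mono[OF B[OF m, of \<xi>], of 2]
        by (cases "\<xi> \<in> {a m..b m}") (auto simp: norm_mult power_mult_distrib mult.commute[of "B\<^sup>2"] intro: mult_left_mono)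
      then show "ennreal ((cmod (?h \<xi>))\<^sup>2) \<le> ennreal (B\<^sup>2) * ennreal ((cmod (indicator {a m..b m} \<xi> * ft g \<xi>))\<^sup>2)"
        by (simp add: ennreal_mult'[symmetric])
    qed
    also have "\<dots> = ennreal (B\<^sup>2) * sq_norm (on_Icc (a m) (b m) (ft g))"
      by (simp add: nn_integral_cmult)
    finally have 1: "sq_norm ?h \<le> ennreal (B\<^sup>2) * sq_norm (on_Icc (a m) (b m) (ft g))" .
    have "sq_norm (on_Icc (a m) (b m) (ft g)) \<le> sq_norm (ft g)"
      by (intro nn_integral_mono) (auto simp: indicator_def)
    also have "\<dots> \<le> sq_norm g" by (rule Plancherel_le[OF g])
    finally have "sq_norm (on_Icc (a m) (b m) (ft g)) < \<infinity>"
      using gfin by (rule le_less_trans)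
    then have "ennreal (B\<^sup>2) * sq_norm (on_Icc (a m) (b m) (ft g)) < \<infinity>"
      by (simp add: ennreal_mult_less_top)
    with 1 have "sq_norm ?h < \<infinity>" by (rule le_less_trans)
    then have h: "integrable lborel ?h"
    proof (rule integrable_compact_support[rotated])
      show "?h \<xi> = 0" if "\<xi> \<notin> {a m..b m}" for \<xi>
        using supp[OF m that] by simp
    qed measurable
    have "sq_norm (\<lambda>x. LINT \<xi>|lborel. ft g \<xi> * \<eta> m \<xi> * cis (2 * pi * x * \<xi>)) = sq_norm (\<lambda>x. ft ?h (- x))"
      by (simp add: ft_def mult_ac)
    also have "\<dots> = sq_norm (ft ?h)"
      by (rule nn_integral_reflect[of "\<lambda>x. ennreal ((cmod (ft ?h x))\<^sup>2)"]) measurable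
    also have "\<dots> \<le> sq_norm ?h" by (rule Plancherel_le[OF h])
    also note 1
    finally show "sq_norm (\<lambda>x. LINT \<xi>|lborel. ft g \<xi> * \<eta> m \<xi> * cis (2 * pi * x * \<xi>))
        \<le> ennreal (B\<^sup>2) * sq_norm (on_Icc (a m) (b m) (ft g))" .
  qed
  also have "\<dots> = ennreal (B\<^sup>2) * (\<Sum>m\<in>I. sq_norm (on_Icc (a m) (b m) (ft g)))"
    by (simp add: sum_distrib_left)
  also have "\<dots> \<le> ennreal (B\<^sup>2) * sq_norm (ft g)"
    by (intro mult_left_mono sum_sq_norm_disjoint fin disj) auto
  also have "\<dots> \<le> ennreal (B\<^sup>2) * sq_norm g"
    by (intro mult_left_mono Plancherel_le g) simp
  finally show ?thesis .
qed

section \<open>Kernels whose symbols vanish at the end points\<close>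

lemma on_Icc_conv_scaleR: "on_Icc a b v \<xi> = indicator {a..b} \<xi> *\<^sub>R v \<xi>"
  by (simp add: indicator_def)

lemma integrable_on_Icc:
  assumes "continuous_on {a..b} v"
  shows "integrable lborel (on_Icc a b v)"
  unfolding on_Icc_conv_scaleR using borel_integrable_atLeastAtMost'[OF assms] by (simp add: set_integrable_def)

lemma measurable_on_Icc:
  assumes "continuous_on {a..b} v"
  shows "on_Icc a b v \<in> borel_measurable borel"
  using borel_measurable_integrable[OF integrable_on_Icc[OF assms]] by simp

lemma sq_norm_on_Icc_le:
  assumes "\<And>\<xi>. \<xi> \<in> {a..b} \<Longrightarrow> cmod (v \<xi>) \<le> M" "a \<le> b" "0 \<le> M"
  shows "sq_norm (on_Icc a b v) \<le> ennreal (M\<^sup>2 * (b - a))"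
proof -
  have "sq_norm (on_Icc a b v) \<le> (\<integral>\<^sup>+\<xi>. ennreal (M\<^sup>2) * indicator {a..b} \<xi> \<partial>lborel)"
    by (intro nn_integral_mono) (use assms(1) in \<open>auto simp: indicator_def intro!: ennreal_leI power_mono\<close>)
  also have "\<dots> = ennreal (M\<^sup>2 * (b - a))"
    using assms by (simp add: nn_integral_cmult ennreal_mult)
  finally show ?thesis .
qed

text \<open>The boundary terms are kept: they vanish in the first r steps and are the obstacle in
  the next one.\<close>

lemma ft_by_parts:
  assumes ab: "a \<le> b"
    and der: "\<And>\<xi>. \<xi> \<in> {a..b} \<Longrightarrow> (v has_vector_derivative v' \<xi>) (at \<xi> within {a..b})"
    and cont: "continuous_on {a..b} v'"
  shows "2 * pi * \<i> * u * ft (on_Icc a b v) u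
       = v a * cis (- (2 * pi * a * u)) - v b * cis (- (2 * pi * b * u)) + ft (on_Icc a b v') u"
proof -
  let ?e = "\<lambda>\<xi>. cis (- (2 * pi * \<xi> * u))"
  have cv: "continuous_on {a..b} v"
    using der by (rule continuous_on_vector_derivative)
  have e: "(?e has_vector_derivative - (2 * pi * \<i> * u) * ?e \<xi>) (at \<xi> within {a..b})" for \<xi>
    unfolding cis_conv_exp
    by (auto intro!: derivative_eq_intros has_vector_derivative_real_field simp: algebra_simps)
  have ce: "continuous_on {a..b} ?e" by (intro continuous_intros)
  have "(LINT \<xi>|lborel. indicator {a..b} \<xi> *\<^sub>R (v \<xi> * (- (2 * pi * \<i> * u) * ?e \<xi>) + v' \<xi> * ?e \<xi>)) = v b * ?e b - v a * ?e a"
  proof (rule integral_FTC_atLeastAtMost[OF ab])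
    show "((\<lambda>\<xi>. v \<xi> * ?e \<xi>) has_vector_derivative v \<xi> * (- (2 * pi * \<i> * u) * ?e \<xi>) + v' \<xi> * ?e \<xi>) (at \<xi> within {a..b})"
      if "a \<le> \<xi>" "\<xi> \<le> b" for \<xi>
      using that by (intro has_vector_derivative_mult der e) auto
    show "continuous_on {a..b} (\<lambda>\<xi>. v \<xi> * (- (2 * pi * \<i> * u) * ?e \<xi>) + v' \<xi> * ?e \<xi>)"
      by (intro continuous_intros cv cont ce)
  qed
  also have "(LINT \<xi>|lborel. indicator {a..b} \<xi> *\<^sub>R (v \<xi> * (- (2 * pi * \<i> * u) * ?e \<xi>) + v' \<xi> * ?e \<xi>))
     = (LINT \<xi>|lborel. - (2 * pi * \<i> * u) * (on_Icc a b v \<xi> * ?e \<xi>) + on_Icc a b v' \<xi> * ?e \<xi>)"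
    by (intro Bochner_Integration.integral_cong) (auto simp: indicator_def)
  also have "\<dots> = - (2 * pi * \<i> * u) * ft (on_Icc a b v) u + ft (on_Icc a b v') u"
    unfolding ft_def
    by (subst Bochner_Integration.integral_add)
       (auto intro!: integrable_mult_cis integrable_on_Icc cv cont)
  finally show ?thesis by (simp add: algebra_simps)
qed

text \<open>Derivatives are taken within the closed interval, hence one-sided at its ends. The
  functions matter only there; \<open>on_Icc\<close> extends them by zero, with a jump wherever an
  end value is nonzero.\<close>

definition derivs_on :: "real \<Rightarrow> real \<Rightarrow> (nat \<Rightarrow> real \<Rightarrow> complex) \<Rightarrow> bool" where
  "derivs_on a b D \<longleftrightarrow> (\<forall>k. \<forall>x\<in>{a..b}. (D k has_vector_derivative D (Suc k) x) (at x within {a..b}))"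

lemma derivs_onD:
  "derivs_on a b D \<Longrightarrow> x \<in> {a..b} \<Longrightarrow> (D k has_vector_derivative D (Suc k) x) (at x within {a..b})"
  by (simp add: derivs_on_def)

lemma derivs_on_continuous: "derivs_on a b D \<Longrightarrow> continuous_on {a..b} (D k)"
  by (rule continuous_on_vector_derivative) (rule derivs_onD)

lemma ft_iterated_by_parts:
  assumes ab: "a \<le> b" and D: "derivs_on a b D"
    and van: "\<And>k. k < r \<Longrightarrow> D k a = 0 \<and> D k b = 0" and "j \<le> r"
  shows "(2 * pi * \<i> * u) ^ j * ft (on_Icc a b (D 0)) u = ft (on_Icc a b (D j)) u"
  using \<open>j \<le> r\<close>
proof (induction j)
  case (Suc j)
  have "2 * pi * \<i> * u * ft (on_Icc a b (D j)) u = ft (on_Icc a b (D (Suc j))) u"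
    using ft_by_parts[OF ab derivs_onD[OF D, where k = j] derivs_on_continuous[OF D, of "Suc j"]] van[of j] Suc.prems
    by simp
  then show ?case using Suc by (simp add: mult.assoc)
qed simp

text \<open>The two terms contribute equally on \<open>\<bar>u\<bar> \<ge> R\<close>:
  \<open>p\<close> has squared norm of order \<open>1/R\<close> and is divided by the r-th power of
  \<open>u\<close>, while \<open>\<theta>\<close> has squared norm of order \<open>R\<close> but
  gains one more division. Either way the square is of order \<open>R^(-2r-1)\<close>.\<close>

definition kernel_split ::
    "nat \<Rightarrow> real \<Rightarrow> real \<Rightarrow> real \<Rightarrow> real \<Rightarrow> (real \<Rightarrow> complex) \<Rightarrow> (real \<Rightarrow> complex) \<Rightarrow> (real \<Rightarrow> complex) \<Rightarrow> bool" where
  "kernel_split r a b R M \<kappa> p \<theta> \<longleftrightarrow> p \<in> borel_measurable borel \<and> \<theta> \<in> borel_measurable borel \<and>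
    (\<forall>\<xi>. \<xi> \<notin> {a..b} \<longrightarrow> p \<xi> = 0) \<and> (\<forall>\<xi>. \<xi> \<notin> {a..b} \<longrightarrow> \<theta> \<xi> = 0) \<and>
    sq_norm p \<le> ennreal (2 * M\<^sup>2 / R) \<and> sq_norm \<theta> \<le> ennreal (6 * M\<^sup>2 * R) \<and>
    (\<forall>u. u \<noteq> 0 \<longrightarrow> ft \<kappa> u = ft p u / (2 * pi * \<i> * u) ^ r + ft \<theta> u / (2 * pi * \<i> * u) ^ Suc r)"

text \<open>The last derivative jumps at the end points. Splitting off \<open>D r * w\<close>, where the weight \<open>w\<close>
  equals 1 at both end points and lives at distance \<open>1/R\<close> from them, makes one more integration by
  parts possible at the scale \<open>R\<close>.\<close>

lemma kernel_decomposition: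
  assumes ab: "a < b" and R: "0 < R" and M: "0 \<le> M" and D: "derivs_on a b D"
    and van: "\<And>k. k < r \<Longrightarrow> D k a = 0 \<and> D k b = 0"
    and M0: "\<And>\<xi>. \<xi> \<in> {a..b} \<Longrightarrow> cmod (D r \<xi>) \<le> M"
    and M1: "\<And>\<xi>. \<xi> \<in> {a..b} \<Longrightarrow> cmod (D (Suc r) \<xi>) \<le> M / (b - a)"
  shows "\<exists>p \<theta>. kernel_split r a b R M (on_Icc a b (D 0)) p \<theta>"
proof -
  \<comment> \<open>A smooth substitute for the distance to the nearer end point: it is at least
    half that distance, and its derivative is at most 1 in modulus on the interval.\<close>
  define \<tau> where "\<tau> \<xi> = (\<xi> - a) * (b - \<xi>) / (b - a)" for \<xi>
  define w where "w \<xi> = exp (- R * \<tau> \<xi>)" for \<xi>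
  define w' where "w' \<xi> = - R * ((a + b - 2 * \<xi>) / (b - a)) * w \<xi>" for \<xi>
  have "(\<tau> has_real_derivative (a + b - 2 * \<xi>) / (b - a)) (at \<xi> within {a..b})" for \<xi>
    unfolding \<tau>_def using ab by (auto intro!: derivative_eq_intros simp: divide_simps)
  then have w: "(w has_vector_derivative w' \<xi>) (at \<xi> within {a..b})" for \<xi>
    unfolding w_def w'_def has_real_derivative_iff_has_vector_derivative[symmetric]
    by (auto intro!: derivative_eq_intros)
  have wab: "w a = 1" "w b = 1" by (auto simp: w_def \<tau>_def)
  define p where "p \<xi> = D r \<xi> * of_real (w \<xi>)" for \<xi>
  define p' where "p' \<xi> = D r \<xi> * of_real (w' \<xi>) + D (Suc r) \<xi> * of_real (w \<xi>)" for \<xi>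
  define q' where "q' \<xi> = D (Suc r) \<xi> - p' \<xi>" for \<xi>
  have cw: "continuous_on {a..b} w" "continuous_on {a..b} w'"
    unfolding w'_def w_def \<tau>_def using ab by (auto intro!: continuous_intros)
  note cD = derivs_on_continuous[OF D]
  have cp: "continuous_on {a..b} p" unfolding p_def by (intro continuous_intros cD cw)
  have cq: "continuous_on {a..b} q'" unfolding q'_def p'_def by (intro continuous_intros cD cw)
  have \<tau>: "0 \<le> \<tau> \<xi>" "\<tau> \<xi> \<le> b - a" "min (\<xi> - a) (b - \<xi>) \<le> 2 * \<tau> \<xi>" if "\<xi> \<in> {a..b}" for \<xi>
  proof -
    show "0 \<le> \<tau> \<xi>" using that ab by (auto simp: \<tau>_def)
    have "(\<xi> - a) * (b - \<xi>) \<le> (b - a) * (b - a)"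
      using that by (intro mult_mono) auto
    then show "\<tau> \<xi> \<le> b - a" using ab by (simp add: \<tau>_def divide_le_eq)
    have "min (\<xi> - a) (b - \<xi>) * (b - a) \<le> min (\<xi> - a) (b - \<xi>) * (2 * max (\<xi> - a) (b - \<xi>))"
      using that by (intro mult_left_mono) (auto simp: max_def)
    also have "\<dots> = 2 * ((\<xi> - a) * (b - \<xi>))" by (auto simp: min_def max_def)
    finally show "min (\<xi> - a) (b - \<xi>) \<le> 2 * \<tau> \<xi>" using ab by (simp add: \<tau>_def le_divide_eq)
  qed
  have w01: "0 < w \<xi>" "w \<xi> \<le> 1" "1 - w \<xi> \<le> R * (b - a)"
     "(w \<xi>)\<^sup>2 \<le> exp (- R * (\<xi> - a)) + exp (- R * (b - \<xi>))"
    if "\<xi> \<in> {a..b}" for \<xi>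
  proof -
    show "0 < w \<xi>" by (simp add: w_def)
    show "w \<xi> \<le> 1" using \<tau>[OF that] R by (simp add: w_def)
    have "1 - w \<xi> \<le> R * \<tau> \<xi>" using exp_ge_add_one_self[of "- R * \<tau> \<xi>"] by (simp add: w_def)
    also have "\<dots> \<le> R * (b - a)" using \<tau>[OF that] R by (intro mult_left_mono) auto
    finally show "1 - w \<xi> \<le> R * (b - a)" .
    have "(w \<xi>)\<^sup>2 = exp (- R * (2 * \<tau> \<xi>))"
      by (simp add: w_def power2_eq_square exp_add[symmetric])
    also have "\<dots> \<le> exp (- R * min (\<xi> - a) (b - \<xi>))"
      using \<tau>[OF that] R by simp
    also have "\<dots> \<le> exp (- R * (\<xi> - a)) + exp (- R * (b - \<xi>))"
      by (auto simp: min_def)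
    finally show "(w \<xi>)\<^sup>2 \<le> exp (- R * (\<xi> - a)) + exp (- R * (b - \<xi>))" .
  qed
  \<comment> \<open>One exponential, of mass at most \<open>1/R\<close>, for each end point.\<close>
  have w2: "(\<integral>\<^sup>+\<xi>. ennreal ((w \<xi>)\<^sup>2) * indicator {a..b} \<xi> \<partial>lborel) \<le> ennreal (2 / R)"
  proof -
    have "(\<integral>\<^sup>+\<xi>. ennreal ((w \<xi>)\<^sup>2) * indicator {a..b} \<xi> \<partial>lborel)
      \<le> (\<integral>\<^sup>+\<xi>. ennreal (exp (- R * (\<xi> - a)) + exp (- R * (b - \<xi>))) * indicator {a..b} \<xi> \<partial>lborel)"
      by (intro nn_integral_mono) (use w01(4) in \<open>auto simp: indicator_def ennreal_leI simp del: ennreal_plus\<close>)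
    also have "\<dots> = ennreal ((- exp (- R * (b - a)) / R + exp (- R * (b - b)) / R) - (- exp (- R * (a - a)) / R + exp (- R * (b - a)) / R))"
      using ab R by (intro nn_integral_FTC_Icc) (auto intro!: derivative_eq_intros simp: add_nonneg_nonneg)
    also have "\<dots> \<le> ennreal (2 / R)" using R by (intro ennreal_leI) (simp add: field_simps)
    finally show ?thesis .
  qed
  have sp: "sq_norm (on_Icc a b p) \<le> ennreal (2 * M\<^sup>2 / R)"
  proof -
    have "sq_norm (on_Icc a b p) \<le> (\<integral>\<^sup>+\<xi>. ennreal (M\<^sup>2) * (ennreal ((w \<xi>)\<^sup>2) * indicator {a..b} \<xi>) \<partial>lborel)"
    proof (rule nn_integral_mono)
      fix \<xi>
      show "ennreal ((cmod (on_Icc a b p \<xi>))\<^sup>2) \<le> ennreal (M\<^sup>2) * (ennreal ((w \<xi>)\<^sup>2) * indicator {a..b} \<xi>)"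
      proof (cases "\<xi> \<in> {a..b}")
        case True
        have "(cmod (p \<xi>))\<^sup>2 \<le> M\<^sup>2 * (w \<xi>)\<^sup>2"
          using power_mono[OF M0[OF True], of 2] by (simp add: p_def norm_mult power_mult_distrib mult_right_mono)
        then show ?thesis using True by (simp add: ennreal_mult[symmetric])
      qed simp
    qed
    also have "\<dots> = ennreal (M\<^sup>2) * (\<integral>\<^sup>+\<xi>. ennreal ((w \<xi>)\<^sup>2) * indicator {a..b} \<xi> \<partial>lborel)"
      by (intro nn_integral_cmult) (simp add: w_def \<tau>_def)
    also have "\<dots> \<le> ennreal (M\<^sup>2) * ennreal (2 / R)" by (intro mult_left_mono w2) simp
    also have "\<dots> = ennreal (2 * M\<^sup>2 / R)" using R by (simp add: ennreal_mult'[symmetric] mult.commute)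
    finally show ?thesis .
  qed
  have sq: "sq_norm (on_Icc a b q') \<le> ennreal (6 * M\<^sup>2 * R)"
  proof -
    have "sq_norm (on_Icc a b q') \<le> (\<integral>\<^sup>+\<xi>. ennreal (2 * M\<^sup>2 * R / (b - a)) * indicator {a..b} \<xi>
        + ennreal (2 * M\<^sup>2 * R\<^sup>2) * (ennreal ((w \<xi>)\<^sup>2) * indicator {a..b} \<xi>) \<partial>lborel)"
    proof (rule nn_integral_mono)
      fix \<xi>
      show "ennreal ((cmod (on_Icc a b q' \<xi>))\<^sup>2) \<le> ennreal (2 * M\<^sup>2 * R / (b - a)) * indicator {a..b} \<xi>
        + ennreal (2 * M\<^sup>2 * R\<^sup>2) * (ennreal ((w \<xi>)\<^sup>2) * indicator {a..b} \<xi>)"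
      proof (cases "\<xi> \<in> {a..b}")
        case True
        define A where "A = M / (b - a) * (1 - w \<xi>)"
        define B where "B = M * (R * w \<xi>)"
        have "\<bar>(a + b - 2 * \<xi>) / (b - a)\<bar> \<le> 1" using True ab by (auto simp: abs_le_iff field_simps)
        from mult_left_mono[OF this, of "R * w \<xi>"]
        have w': "\<bar>w' \<xi>\<bar> \<le> R * w \<xi>" using R w01[OF True] by (simp add: w'_def abs_mult mult_ac)
        have "cmod (q' \<xi>) = cmod (D (Suc r) \<xi> * of_real (1 - w \<xi>) - D r \<xi> * of_real (w' \<xi>))"
          by (simp add: q'_def p'_def algebra_simps)
        also have "\<dots> \<le> cmod (D (Suc r) \<xi>) * (1 - w \<xi>) + cmod (D r \<xi>) * \<bar>w' \<xi>\<bar>"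
          using norm_triangle_ineq4[of "D (Suc r) \<xi> * of_real (1 - w \<xi>)" "D r \<xi> * of_real (w' \<xi>)"] w01[OF True]
          by (simp only: norm_mult norm_of_real abs_of_nonneg diff_ge_0_iff_ge)
        also have "\<dots> \<le> A + B"
          unfolding A_def B_def using M w' w01[OF True] ab
          by (intro add_mono mult_mono M0[OF True] M1[OF True]) auto
        finally have "(cmod (q' \<xi>))\<^sup>2 \<le> (A + B)\<^sup>2" by (intro power_mono) auto
        also have "\<dots> \<le> 2 * A\<^sup>2 + 2 * B\<^sup>2"
          using sum_squares_bound[of A B] by (simp add: power2_sum)
        \<comment> \<open>One factor \<open>1 - w \<xi>\<close> is bounded by 1 and the other by
          \<open>R * (b - a)\<close>. Integrated over the interval, this contributes a multiple of
          \<open>R\<close> whatever the length is.\<close>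
        also have "A\<^sup>2 \<le> M\<^sup>2 * R / (b - a)"
        proof -
          have "(1 - w \<xi>)\<^sup>2 \<le> 1 * (R * (b - a))"
            unfolding power2_eq_square using w01[OF True] by (intro mult_mono) auto
          then have "(M / (b - a))\<^sup>2 * (1 - w \<xi>)\<^sup>2 \<le> (M / (b - a))\<^sup>2 * (R * (b - a))"
            by (intro mult_left_mono) auto
          also have "\<dots> = M\<^sup>2 * R / (b - a)"
          proof -
            have "(M / z)\<^sup>2 * (R * z) = M\<^sup>2 * R / z" for z :: real
              by (simp add: power2_eq_square)
            then show ?thesis by blast
          qed
          finally show ?thesis unfolding A_def power_mult_distrib .
        qed
        finally have "(cmod (q' \<xi>))\<^sup>2 \<le> 2 * M\<^sup>2 * R / (b - a) + 2 * M\<^sup>2 * R\<^sup>2 * (w \<xi>)\<^sup>2"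
          by (simp add: B_def power_mult_distrib mult_ac)
        then show ?thesis using True ab R
          by (simp add: ennreal_mult[symmetric] ennreal_plus[symmetric] del: ennreal_plus)
      qed simp
    qed
    also have "\<dots> = ennreal (2 * M\<^sup>2 * R / (b - a)) * (\<integral>\<^sup>+\<xi>. indicator {a..b} \<xi> \<partial>lborel)
        + ennreal (2 * M\<^sup>2 * R\<^sup>2) * (\<integral>\<^sup>+\<xi>. ennreal ((w \<xi>)\<^sup>2) * indicator {a..b} \<xi> \<partial>lborel)"
      by (subst nn_integral_add) (auto simp: w_def \<tau>_def nn_integral_cmult)
    also have "\<dots> \<le> ennreal (2 * M\<^sup>2 * R / (b - a)) * ennreal (b - a) + ennreal (2 * M\<^sup>2 * R\<^sup>2) * ennreal (2 / R)"
      using ab by (intro add_mono mult_left_mono w2) auto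
    \<comment> \<open>The 6 is 2 + 4: the first comes from \<open>A\<close>, the second from
      \<open>B\<close> and the mass \<open>2 / R\<close> of the squared weight.\<close>
    also have "\<dots> = ennreal (6 * M\<^sup>2 * R)"
    proof -
      have "2 * M\<^sup>2 * R / (b - a) * (b - a) = 2 * M\<^sup>2 * R" "2 * M\<^sup>2 * R\<^sup>2 * (2 / R) = 4 * M\<^sup>2 * R"
        using ab R by (auto simp: power2_eq_square)
      note h = this
      have "ennreal (2 * M\<^sup>2 * R / (b - a)) * ennreal (b - a) = ennreal (2 * M\<^sup>2 * R)"
        using ab by (subst ennreal_mult''[symmetric]) (simp, simp only: h)
      moreover have "ennreal (2 * M\<^sup>2 * R\<^sup>2) * ennreal (2 / R) = ennreal (4 * M\<^sup>2 * R)"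
        using R by (subst ennreal_mult''[symmetric]) (simp, simp only: h)
      ultimately show ?thesis
        using R by (simp add: ennreal_plus[symmetric] del: ennreal_plus)
    qed
    finally show ?thesis .
  qed
  have eq: "ft (on_Icc a b (D 0)) u = ft (on_Icc a b p) u / (2 * pi * \<i> * u) ^ r + ft (on_Icc a b q') u / (2 * pi * \<i> * u) ^ Suc r"
    if u: "u \<noteq> 0" for u
  proof -
    have h1: "2 * pi * \<i> * u * ft (on_Icc a b (\<lambda>\<xi>. D r \<xi> - p \<xi>)) u = ft (on_Icc a b q') u"
    proof (subst ft_by_parts[OF less_imp_le[OF ab] _ cq])
      show "((\<lambda>\<xi>. D r \<xi> - p \<xi>) has_vector_derivative q' \<xi>) (at \<xi> within {a..b})" if "\<xi> \<in> {a..b}" for \<xi>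
        unfolding p_def q'_def p'_def
        by (intro has_vector_derivative_diff has_vector_derivative_mult derivs_onD[OF D that] has_vector_derivative_of_real
            has_real_derivative_iff_has_vector_derivative[THEN iffD2, OF w])
    qed (simp add: p_def wab)
    have h2: "ft (on_Icc a b (\<lambda>\<xi>. D r \<xi> - p \<xi>)) u = ft (on_Icc a b (D r)) u - ft (on_Icc a b p) u"
      by (subst ft_diff[symmetric]) (auto intro: integrable_on_Icc cD cp simp: right_diff_distrib)
    have "2 * pi * \<i> * u * ft (on_Icc a b (D r)) u = 2 * pi * \<i> * u * ft (on_Icc a b p) u + ft (on_Icc a b q') u"
      using h1 unfolding h2 by (simp only: right_diff_distrib[of "complex_of_real (2 * pi) * \<i> * complex_of_real u"] diff_eq_eq add.commute)
    moreover have "(2 * pi * \<i> * u) ^ r * ft (on_Icc a b (D 0)) u = ft (on_Icc a b (D r)) u"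
      by (rule ft_iterated_by_parts[OF less_imp_le[OF ab] D van]) auto
    moreover define z where "z = 2 * pi * \<i> * u"
    moreover have "z \<noteq> 0" using u by (simp add: z_def)
    ultimately show ?thesis unfolding z_def[symmetric] by (simp add: field_simps)
  qed
  show ?thesis
    unfolding kernel_split_def
    using sp sq eq by (intro exI[of _ "on_Icc a b p"] exI[of _ "on_Icc a b q'"] conjI measurable_on_Icc cp cq) auto
qed

lemma sq_norm_divide_power:
  fixes R :: real
  assumes "0 < R" and "\<And>u. \<bar>u\<bar> < R \<Longrightarrow> g u = 0" and [measurable]: "g \<in> borel_measurable borel"
  shows "sq_norm (\<lambda>u. g u / (2 * pi * \<i> * u) ^ k) \<le> ennreal (1 / R ^ (2 * k)) * sq_norm g"
proof -
  have "sq_norm (\<lambda>u. g u / (2 * pi * \<i> * u) ^ k) \<le> (\<integral>\<^sup>+u. ennreal (1 / R ^ (2 * k)) * ennreal ((cmod (g u))\<^sup>2) \<partial>lborel)"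
  proof (rule nn_integral_mono)
    fix u
    have "(cmod (g u / (2 * pi * \<i> * u) ^ k))\<^sup>2 \<le> 1 / R ^ (2 * k) * (cmod (g u))\<^sup>2"
    proof (cases "\<bar>u\<bar> < R")
      case False
      have "R \<le> 1 * \<bar>u\<bar>" using False by simp
      also have "\<dots> \<le> 2 * pi * \<bar>u\<bar>"
        using pi_gt3 by (intro mult_right_mono) auto
      finally have "R ^ k \<le> (2 * pi * \<bar>u\<bar>) ^ k"
        using \<open>0 < R\<close> by (intro power_mono) auto
      then have "cmod (g u) / (2 * pi * \<bar>u\<bar>) ^ k \<le> cmod (g u) / R ^ k"
        using \<open>0 < R\<close> False pi_gt_zero by (intro divide_left_mono mult_pos_pos zero_less_power) auto
      from power_mono[OF this, of 2] show ?thesis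
        by (simp add: norm_divide norm_power norm_mult power_divide power_mult[symmetric] mult.commute[of k 2])
    qed (use assms in simp)
    then show "ennreal ((cmod (g u / (2 * pi * \<i> * u) ^ k))\<^sup>2) \<le> ennreal (1 / R ^ (2 * k)) * ennreal ((cmod (g u))\<^sup>2)"
      using \<open>0 < R\<close> by (simp add: ennreal_mult'[symmetric] ennreal_leI)
  qed
  also have "\<dots> = ennreal (1 / R ^ (2 * k)) * sq_norm g"
    by (simp add: nn_integral_cmult)
  finally show ?thesis .
qed

text \<open>The powers of \<open>2 * pi * \<i> * u\<close> are divided out of \<open>g\<close>,
  which lives on \<open>\<bar>u\<bar> \<ge> R\<close>, so that Bessel's inequality applies to
  \<open>p\<close> and \<open>\<theta>\<close> separately; 16 = 2 * 2 + 2 * 6. The bounded support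
  given by \<open>K\<close> makes the quotients integrable and leaves no trace in the
  constant.\<close>

proposition separated_kernel_estimate:
  fixes a b :: "nat \<Rightarrow> real" and D :: "nat \<Rightarrow> nat \<Rightarrow> real \<Rightarrow> complex"
  assumes fin: "finite I" and disj: "disjoint_family_on (\<lambda>m. {a m..b m}) I"
    and ab: "\<And>m. m \<in> I \<Longrightarrow> a m < b m" and D: "\<And>m. m \<in> I \<Longrightarrow> derivs_on (a m) (b m) (D m)"
    and van: "\<And>m k. m \<in> I \<Longrightarrow> k < r \<Longrightarrow> D m k (a m) = 0 \<and> D m k (b m) = 0"
    and M0: "\<And>m \<xi>. m \<in> I \<Longrightarrow> \<xi> \<in> {a m..b m} \<Longrightarrow> cmod (D m r \<xi>) \<le> M"
    and M1: "\<And>m \<xi>. m \<in> I \<Longrightarrow> \<xi> \<in> {a m..b m} \<Longrightarrow> cmod (D m (Suc r) \<xi>) \<le> M / (b m - a m)"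
    and M: "0 \<le> M" and R: "0 < R"
    and g[measurable]: "g \<in> borel_measurable borel" and gfin: "sq_norm g < \<infinity>"
    and g0: "\<And>u. \<bar>u\<bar> < R \<Longrightarrow> g u = 0" and gK: "\<And>u. u \<notin> {-K..K} \<Longrightarrow> g u = 0"
  shows "(\<Sum>m\<in>I. ennreal ((cmod (LINT u|lborel. g u * ft (on_Icc (a m) (b m) (D m 0)) u))\<^sup>2))
      \<le> ennreal (16 * M\<^sup>2 / R ^ (2 * r + 1)) * sq_norm g"
proof -
  have "\<exists>p \<theta>. kernel_split r (a m) (b m) R M (on_Icc (a m) (b m) (D m 0)) p \<theta>" if m: "m \<in> I" for m
    by (rule kernel_decomposition[OF ab[OF m] R M D[OF m] van[OF m] M0[OF m] M1[OF m]])
  then obtain p \<theta> where P: "\<And>m. m \<in> I \<Longrightarrow> kernel_split r (a m) (b m) R M (on_Icc (a m) (b m) (D m 0)) (p m) (\<theta> m)"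
    by metis
  have pm: "\<And>m. m \<in> I \<Longrightarrow> p m \<in> borel_measurable borel"
    and \<theta>m: "\<And>m. m \<in> I \<Longrightarrow> \<theta> m \<in> borel_measurable borel"
    and p0: "\<And>m \<xi>. m \<in> I \<Longrightarrow> \<xi> \<notin> {a m..b m} \<Longrightarrow> p m \<xi> = 0"
    and \<theta>0: "\<And>m \<xi>. m \<in> I \<Longrightarrow> \<xi> \<notin> {a m..b m} \<Longrightarrow> \<theta> m \<xi> = 0"
    and pn: "\<And>m. m \<in> I \<Longrightarrow> sq_norm (p m) \<le> ennreal (2 * M\<^sup>2 / R)"
    and \<theta>n: "\<And>m. m \<in> I \<Longrightarrow> sq_norm (\<theta> m) \<le> ennreal (6 * M\<^sup>2 * R)"
    and eq: "\<And>m u. m \<in> I \<Longrightarrow> u \<noteq> 0 \<Longrightarrow>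
       ft (on_Icc (a m) (b m) (D m 0)) u = ft (p m) u / (2 * pi * \<i> * u) ^ r + ft (\<theta> m) u / (2 * pi * \<i> * u) ^ Suc r"
    using P unfolding kernel_split_def by fast+
  define G where "G k u = g u / (2 * pi * \<i> * u) ^ k" for k u
  have [measurable]: "G k \<in> borel_measurable borel" for k unfolding G_def by measurable
  have Gn: "sq_norm (G k) \<le> ennreal (1 / R ^ (2 * k)) * sq_norm g" for k
    unfolding G_def by (rule sq_norm_divide_power[OF R g0 g])
  have Gfin: "sq_norm (G k) < \<infinity>" for k
    using Gn[of k] gfin by (auto intro: le_less_trans simp: ennreal_mult_less_top)
  have Gi: "integrable lborel (G k)" for k
    by (rule integrable_compact_support[OF _ Gfin, of _ "-K" K]) (use gK in \<open>auto simp: G_def\<close>)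
  have "(\<Sum>m\<in>I. ennreal ((cmod (LINT u|lborel. g u * ft (on_Icc (a m) (b m) (D m 0)) u))\<^sup>2))
     \<le> (\<Sum>m\<in>I. 2 * ennreal ((cmod (LINT u|lborel. G r u * ft (p m) u))\<^sup>2) + 2 * ennreal ((cmod (LINT u|lborel. G (Suc r) u * ft (\<theta> m) u))\<^sup>2))"
  proof (rule sum_mono)
    fix m assume m: "m \<in> I"
    note [measurable] = pm[OF m] \<theta>m[OF m]
    have pf: "sq_norm (p m) < \<infinity>" and \<theta>f: "sq_norm (\<theta> m) < \<infinity>"
      using pn[OF m] \<theta>n[OF m] by (auto intro: le_less_trans)
    have ftf: "sq_norm (ft (p m)) < \<infinity>" "sq_norm (ft (\<theta> m)) < \<infinity>"
      using le_less_trans[OF Plancherel_le[OF integrable_compact_support[OF pm[OF m] pf p0[OF m]]] pf]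
        le_less_trans[OF Plancherel_le[OF integrable_compact_support[OF \<theta>m[OF m] \<theta>f \<theta>0[OF m]]] \<theta>f]
      by blast+
    have "(LINT u|lborel. g u * ft (on_Icc (a m) (b m) (D m 0)) u) = (LINT u|lborel. G r u * ft (p m) u + G (Suc r) u * ft (\<theta> m) u)"
    proof (rule Bochner_Integration.integral_cong[OF refl])
      fix u
      show "g u * ft (on_Icc (a m) (b m) (D m 0)) u = G r u * ft (p m) u + G (Suc r) u * ft (\<theta> m) u"
      proof (cases "u = 0")
        case True
        then show ?thesis using g0[of 0] R by (simp add: G_def)
      next
        case False
        show ?thesis unfolding eq[OF m False] G_def by (simp add: distrib_left)
      qed
    qed
    also have "\<dots> = (LINT u|lborel. G r u * ft (p m) u) + (LINT u|lborel. G (Suc r) u * ft (\<theta> m) u)"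
      by (intro Bochner_Integration.integral_add integrable_mult_square_integrable Gfin ftf) auto
    finally have *: "(LINT u|lborel. g u * ft (on_Icc (a m) (b m) (D m 0)) u)
       = (LINT u|lborel. G r u * ft (p m) u) + (LINT u|lborel. G (Suc r) u * ft (\<theta> m) u)" .
    have "(cmod (x + y))\<^sup>2 \<le> 2 * (cmod x)\<^sup>2 + 2 * (cmod y)\<^sup>2" for x y
      using power_mono[OF norm_triangle_ineq[of x y], of 2] sum_squares_bound[of "cmod x" "cmod y"]
      by (auto simp: power2_sum)
    then show "ennreal ((cmod (LINT u|lborel. g u * ft (on_Icc (a m) (b m) (D m 0)) u))\<^sup>2)
      \<le> 2 * ennreal ((cmod (LINT u|lborel. G r u * ft (p m) u))\<^sup>2) + 2 * ennreal ((cmod (LINT u|lborel. G (Suc r) u * ft (\<theta> m) u))\<^sup>2)"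
      unfolding * by (simp add: ennreal_mult'[symmetric] ennreal_plus[symmetric] flip: ennreal_numeral del: ennreal_plus)
  qed
  also have "\<dots> = 2 * (\<Sum>m\<in>I. ennreal ((cmod (LINT u|lborel. G r u * ft (p m) u))\<^sup>2))
      + 2 * (\<Sum>m\<in>I. ennreal ((cmod (LINT u|lborel. G (Suc r) u * ft (\<theta> m) u))\<^sup>2))"
    by (simp only: sum.distrib sum_distrib_left)
  also have "\<dots> \<le> 2 * (ennreal (2 * M\<^sup>2 / R) * sq_norm (G r)) + 2 * (ennreal (6 * M\<^sup>2 * R) * sq_norm (G (Suc r)))"
    by (intro add_mono mult_left_mono Bessel_disjoint[OF Gi fin disj] pm \<theta>m p0 \<theta>0 pn \<theta>n) auto
  also have "\<dots> \<le> 2 * (ennreal (2 * M\<^sup>2 / R) * (ennreal (1 / R ^ (2 * r)) * sq_norm g))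
      + 2 * (ennreal (6 * M\<^sup>2 * R) * (ennreal (1 / R ^ (2 * Suc r)) * sq_norm g))"
    by (intro add_mono mult_left_mono Gn) auto
  also have "\<dots> = ennreal (4 * M\<^sup>2 / R / R ^ (2 * r) + 12 * M\<^sup>2 * R / R ^ (2 * Suc r)) * sq_norm g"
  proof -
    have "2 * (ennreal x * (ennreal y * c)) = ennreal (2 * x * y) * c" if "0 \<le> x" "0 \<le> y" for x y c
      using that by (simp add: ennreal_mult mult.assoc)
    from this[of "2 * M\<^sup>2 / R" "1 / R ^ (2 * r)"] this[of "6 * M\<^sup>2 * R" "1 / R ^ (2 * Suc r)"]
    have "2 * (ennreal (2 * M\<^sup>2 / R) * (ennreal (1 / R ^ (2 * r)) * c)) = ennreal (4 * M\<^sup>2 / R / R ^ (2 * r)) * c"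
      "2 * (ennreal (6 * M\<^sup>2 * R) * (ennreal (1 / R ^ (2 * Suc r)) * c)) = ennreal (12 * M\<^sup>2 * R / R ^ (2 * Suc r)) * c" for c
      using R by auto
    then show ?thesis
      unfolding distrib_right[symmetric] using R by (simp only: distrib_right[symmetric]) (subst ennreal_plus, auto)
  qed
  also have "4 * M\<^sup>2 / R / R ^ (2 * r) + 12 * M\<^sup>2 * R / R ^ (2 * Suc r) = 16 * M\<^sup>2 / R ^ (2 * r + 1)"
    using R by (simp add: field_simps)
  finally show ?thesis .
qed

section \<open>Vanishing moments of the kernels\<close>

lemma integrable_ft_twice_by_parts:
  assumes ab: "a < b" and D: "derivs_on a b D" and van: "D 0 a = 0" "D 0 b = 0"
  shows "integrable lborel (ft (on_Icc a b (D 0)))"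
proof -
  have i: "integrable lborel (on_Icc a b (D k))" for k
    by (rule integrable_on_Icc[OF derivs_on_continuous[OF D]])
  note [measurable] = borel_measurable_integrable[OF i]
  define K1 where "K1 = (LINT x|lborel. cmod (on_Icc a b (D 0) x))"
  define K2 where "K2 = cmod (D 1 a) + cmod (D 1 b) + (LINT x|lborel. cmod (on_Icc a b (D 2) x))"
  have K0: "0 \<le> K1" "0 \<le> K2" by (auto simp: K1_def K2_def)
  have b1: "cmod (ft (on_Icc a b (D 0)) u) \<le> K1" for u
    unfolding K1_def by (rule cmod_ft_le[OF i])
  \<comment> \<open>The first integration by parts has no boundary terms and those of the second are
    bounded, so the transform is of order \<open>u^(-2)\<close>.\<close>
  have b2: "u\<^sup>2 * cmod (ft (on_Icc a b (D 0)) u) \<le> K2" for u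
  proof -
    let ?z = "2 * pi * \<i> * u"
    have "?z * ft (on_Icc a b (D 0)) u = ft (on_Icc a b (D 1)) u"
      using ft_by_parts[OF less_imp_le[OF ab] derivs_onD[OF D, where k = 0] derivs_on_continuous[OF D, of "Suc 0"]] van
      by simp
    moreover have "?z * ft (on_Icc a b (D 1)) u = D 1 a * cis (- (2 * pi * a * u)) - D 1 b * cis (- (2 * pi * b * u)) + ft (on_Icc a b (D 2)) u"
      using ft_by_parts[OF less_imp_le[OF ab] derivs_onD[OF D, where k = 1] derivs_on_continuous[OF D, of "Suc 1"]]
      by (simp add: numeral_2_eq_2)
    ultimately have "?z\<^sup>2 * ft (on_Icc a b (D 0)) u = D 1 a * cis (- (2 * pi * a * u)) - D 1 b * cis (- (2 * pi * b * u)) + ft (on_Icc a b (D 2)) u"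
      by (simp only: power2_eq_square mult.assoc)
    also have "cmod \<dots> \<le> cmod (D 1 a * cis (- (2 * pi * a * u))) + cmod (D 1 b * cis (- (2 * pi * b * u))) + cmod (ft (on_Icc a b (D 2)) u)"
      by (meson add_mono norm_triangle_ineq norm_triangle_ineq4 order_refl order_trans)
    also have "\<dots> \<le> K2" using cmod_ft_le[OF i[of 2], of u] by (simp add: norm_mult K2_def)
    finally have "(2 * pi * \<bar>u\<bar>)\<^sup>2 * cmod (ft (on_Icc a b (D 0)) u) \<le> K2" by (simp add: norm_mult norm_power)
    moreover have "1 * u\<^sup>2 \<le> (2 * pi)\<^sup>2 * u\<^sup>2"
      using pi_gt3 by (intro mult_right_mono) (auto simp: power2_eq_square intro!: mult_ge1_I)
    then have "u\<^sup>2 * cmod (ft (on_Icc a b (D 0)) u) \<le> (2 * pi * \<bar>u\<bar>)\<^sup>2 * cmod (ft (on_Icc a b (D 0)) u)"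
      by (intro mult_right_mono) (auto simp: power_mult_distrib)
    ultimately show ?thesis by linarith
  qed
  have bound: "cmod (ft (on_Icc a b (D 0)) u) \<le> (K1 + K2) * inverse (1 + u\<^sup>2)" for u
  proof -
    have "(1 + u\<^sup>2) * cmod (ft (on_Icc a b (D 0)) u) \<le> K1 + K2"
      using b1[of u] b2[of u] by (simp add: distrib_right)
    then show ?thesis by (simp add: field_simps add_pos_nonneg)
  qed
  have "integrable lborel (\<lambda>u::real. (K1 + K2) * inverse (1 + u\<^sup>2))"
    using integrable_inverse_1_plus_square by (simp add: set_integrable_def)
  then show ?thesis
    by (rule Bochner_Integration.integrable_bound)
       (use bound in \<open>auto intro!: measurable_ft order_trans[OF _ abs_ge_self]\<close>)
qed

text \<open>Fourier inversion at the frequency 0, in Abel's sense: the weighted integrals are Poisson means of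
  \<open>D 0\<close>, which is of size \<open>O(\<bar>\<xi>\<bar>)\<close> because 0 is not an interior point of the support.\<close>

lemma integral_ft_eq_0:
  assumes ab: "a < b" and D: "derivs_on a b D" and van: "D 0 a = 0" "D 0 b = 0"
    and zero: "0 \<notin> {a<..<b}"
  shows "(LINT u|lborel. ft (on_Icc a b (D 0)) u) = 0"
proof -
  define V where "V = ft (on_Icc a b (D 0))"
  have i: "integrable lborel (on_Icc a b (D 0))"
    by (rule integrable_on_Icc[OF derivs_on_continuous[OF D]])
  have [measurable]: "on_Icc a b (D 0) \<in> borel_measurable borel"
    using borel_measurable_integrable[OF i] by simp
  have V: "integrable lborel V"
    unfolding V_def by (rule integrable_ft_twice_by_parts[OF ab D van])
  obtain K where K: "\<And>\<xi>. \<xi> \<in> {a..b} \<Longrightarrow> cmod (D 1 \<xi>) \<le> K"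
  proof -
    have "bounded (D 1 ` {a..b})"
      by (intro compact_imp_bounded compact_continuous_image derivs_on_continuous[OF D]) simp
    then obtain K where "\<forall>x\<in>D 1 ` {a..b}. cmod x \<le> K" by (auto simp only: bounded_iff)
    then show ?thesis using that[of K] by blast
  qed
  have K0: "0 \<le> K" by (rule order_trans[OF norm_ge_zero K[of a]]) (use ab in simp)
  have lip: "cmod (D 0 x - D 0 y) \<le> K * \<bar>x - y\<bar>" if "x \<in> {a..b}" "y \<in> {a..b}" for x y
  proof (rule differentiable_bound[of "{a..b}" "D 0" "\<lambda>x h. h *\<^sub>R D 1 x" K x y, unfolded real_norm_def])
    show "(D 0 has_derivative (\<lambda>h. h *\<^sub>R D 1 z)) (at z within {a..b})" if "z \<in> {a..b}" for z
      using derivs_onD[OF D that, of 0] by (simp add: has_vector_derivative_def)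
    show "onorm (\<lambda>h. h *\<^sub>R D 1 z) \<le> K" if "z \<in> {a..b}" for z
      using K[OF that] by (intro onorm_bound K0) (auto simp: mult.commute[of K] intro!: mult_left_mono)
  qed (use that in auto)
  \<comment> \<open>The end point on the side of 0 is at distance at most
    \<open>\<bar>\<xi>\<bar>\<close> from a point \<open>\<xi>\<close> of the interval, and
    \<open>D 0\<close> vanishes there.\<close>
  have small: "cmod (on_Icc a b (D 0) \<xi>) \<le> K * \<bar>\<xi>\<bar>" for \<xi>
  proof (cases "\<xi> \<in> {a..b}")
    case True
    have "0 \<le> a \<or> b \<le> 0" using zero ab by auto
    then show ?thesis
    proof
      assume "0 \<le> a"
      then have "cmod (D 0 \<xi>) \<le> K * \<bar>\<xi> - a\<bar>" "\<bar>\<xi> - a\<bar> \<le> \<bar>\<xi>\<bar>"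
        using lip[OF True, of a] van ab True by auto
      then show ?thesis using True K0 by (auto intro: order_trans mult_left_mono)
    next
      assume "b \<le> 0"
      then have "cmod (D 0 \<xi>) \<le> K * \<bar>\<xi> - b\<bar>" "\<bar>\<xi> - b\<bar> \<le> \<bar>\<xi>\<bar>"
        using lip[OF True, of b] van ab True by auto
      then show ?thesis using True K0 by (auto intro: order_trans mult_left_mono)
    qed
  qed (use K0 in simp)
  define e where "e n = 1 / real (Suc n)" for n
  have e: "0 < e n" for n by (simp add: e_def)
  have elim: "e \<longlonglongrightarrow> 0" unfolding e_def by (rule LIMSEQ_Suc[OF lim_1_over_n])
  have "(\<lambda>n. LINT u|lborel. V u * of_real (exp (- e n * \<bar>u\<bar>))) \<longlonglongrightarrow> (LINT u|lborel. V u)"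
  proof (rule integral_dominated_convergence[where w = "\<lambda>u. cmod (V u)"])
    show "AE u in lborel. (\<lambda>n. V u * of_real (exp (- e n * \<bar>u\<bar>))) \<longlonglongrightarrow> V u"
    proof (rule AE_I2)
      fix u
      have "(\<lambda>n. V u * of_real (exp (- e n * \<bar>u\<bar>))) \<longlonglongrightarrow> V u * of_real (exp (- 0 * \<bar>u\<bar>))"
        by (intro tendsto_mult tendsto_of_real tendsto_exp tendsto_minus tendsto_const elim)
      then show "(\<lambda>n. V u * of_real (exp (- e n * \<bar>u\<bar>))) \<longlonglongrightarrow> V u" by simp
    qed
    show "AE u in lborel. norm (V u * of_real (exp (- e n * \<bar>u\<bar>))) \<le> cmod (V u)" for n
      using e[of n] by (auto simp: norm_mult mult_left_le)
  qed (use V in auto)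
  moreover have "(LINT u|lborel. V u * of_real (exp (- e n * \<bar>u\<bar>))) = (LINT \<xi>|lborel. on_Icc a b (D 0) \<xi> * of_real (poisson (e n) \<xi>))" for n
    unfolding V_def
    using ft_swap[OF i, of "\<lambda>u. of_real (exp (- e n * \<bar>u\<bar>))"] integrable_exp_abs[OF e, of n]
    by (simp add: ft_exp_abs[OF e, simplified] integrable_of_real)
  moreover have "(\<lambda>n. LINT \<xi>|lborel. on_Icc a b (D 0) \<xi> * of_real (poisson (e n) \<xi>)) \<longlonglongrightarrow> (LINT (\<xi>::real)|lborel. (0::complex))"
  proof (rule integral_dominated_convergence[where w = "\<lambda>\<xi>. K * indicator {a..b} \<xi>"])
    show "AE \<xi> in lborel. (\<lambda>n. on_Icc a b (D 0) \<xi> * of_real (poisson (e n) \<xi>)) \<longlonglongrightarrow> 0"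
      using AE_lborel_singleton[of "0::real"]
    proof eventually_elim
      case (elim \<xi>)
      have "(\<lambda>n. on_Icc a b (D 0) \<xi> * of_real (poisson (e n) \<xi>)) \<longlonglongrightarrow> on_Icc a b (D 0) \<xi> * of_real (2 * 0 / (0\<^sup>2 + (2 * pi * \<xi>)\<^sup>2))"
        unfolding poisson_def using elim by (intro tendsto_intros \<open>e \<longlonglongrightarrow> 0\<close>) auto
      then show ?case by simp
    qed
    \<comment> \<open>The linear bound cancels the singularity of the kernel at 0:
      \<open>\<bar>\<xi>\<bar> * poisson (e n) \<xi>\<close> is at most 1 for every
      \<open>n\<close>.\<close>
    show "AE \<xi> in lborel. norm (on_Icc a b (D 0) \<xi> * of_real (poisson (e n) \<xi>)) \<le> K * indicator {a..b} \<xi>" for n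
    proof (rule AE_I2)
      fix \<xi>
      have "\<bar>\<xi>\<bar> * poisson (e n) \<xi> \<le> 1"
      proof -
        have "2 * e n * (1 * \<bar>\<xi>\<bar>) \<le> 2 * e n * (2 * pi * \<bar>\<xi>\<bar>)"
          using pi_gt3 e[of n] by (intro mult_left_mono mult_right_mono) auto
        also have "\<dots> \<le> (e n)\<^sup>2 + (2 * pi * \<xi>)\<^sup>2"
          using sum_squares_bound[of "e n" "2 * pi * \<bar>\<xi>\<bar>"] by (simp add: power_mult_distrib)
        finally show ?thesis using e[of n] by (simp add: poisson_def divide_le_eq add_pos_nonneg mult.commute)
      qed
      then have "K * (\<bar>\<xi>\<bar> * poisson (e n) \<xi>) \<le> K" using K0 by (simp add: mult_left_le)
      moreover have "cmod (on_Icc a b (D 0) \<xi>) * poisson (e n) \<xi> \<le> K * \<bar>\<xi>\<bar> * poisson (e n) \<xi>"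
        by (intro mult_right_mono small poisson_nonneg e)
      ultimately have "cmod (on_Icc a b (D 0) \<xi>) * poisson (e n) \<xi> \<le> K" by (simp add: mult.assoc)
      then show "norm (on_Icc a b (D 0) \<xi> * of_real (poisson (e n) \<xi>)) \<le> K * indicator {a..b} \<xi>"
        using poisson_nonneg[OF e, of n \<xi>] by (auto simp: norm_mult indicator_def split: if_splits)
    qed
  next
    show "integrable lborel (\<lambda>\<xi>. K * indicator {a..b} \<xi>)"
      by (intro integrable_mult_right integrable_real_indicator) (auto simp: emeasure_lborel_Icc_eq)
  qed auto
  ultimately have "(LINT u|lborel. V u) = (LINT (\<xi>::real)|lborel. (0::complex))"
    by (simp only: LIMSEQ_unique)
  then show ?thesis by (simp add: V_def)
qed

text \<open>Up to a constant, multiplying the transform of \<open>D 0\<close> by the j-th power of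
  \<open>u\<close> gives the transform of \<open>D j\<close>, whose end values vanish as long as
  \<open>j < r\<close>; the shifted family therefore falls under
  \<open>integral_ft_eq_0\<close>.\<close>

lemma ft_moment:
  assumes ab: "a < b" and D: "derivs_on a b D"
    and van: "\<And>k. k < r \<Longrightarrow> D k a = 0 \<and> D k b = 0" and zero: "0 \<notin> {a<..<b}" and j: "j < r"
  shows "has_bochner_integral lborel (\<lambda>u. of_real u ^ j * ft (on_Icc a b (D 0)) u) 0"
proof -
  have D': "derivs_on a b (\<lambda>k. D (j + k))" using D by (simp add: derivs_on_def)
  have "has_bochner_integral lborel (ft (on_Icc a b (D j))) 0"
    using integrable_ft_twice_by_parts[OF ab D'] integral_ft_eq_0[OF ab D' _ _ zero] van[OF j]
    by (simp add: has_bochner_integral_iff)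
  then have "has_bochner_integral lborel (\<lambda>u. 1 / (2 * pi * \<i>) ^ j * ft (on_Icc a b (D j)) u) (1 / (2 * pi * \<i>) ^ j * 0)"
    by (intro has_bochner_integral_mult_right) auto
  moreover have "1 / (2 * pi * \<i>) ^ j * ft (on_Icc a b (D j)) u = of_real u ^ j * ft (on_Icc a b (D 0)) u" for u
    using ft_iterated_by_parts[OF less_imp_le[OF ab] D van less_imp_le[OF j], of u, symmetric]
    by (simp add: power_mult_distrib)
  ultimately show ?thesis by simp
qed

text \<open>Recentring at \<open>t\<close> does not change the degree, so only powers of
  \<open>u\<close> below r occur.\<close>

lemma ft_moment_poly:
  assumes ab: "a < b" and D: "derivs_on a b D"
    and van: "\<And>k. k < r \<Longrightarrow> D k a = 0 \<and> D k b = 0" and zero: "0 \<notin> {a<..<b}"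
    and q: "degree q < r"
  shows "has_bochner_integral lborel (\<lambda>u. poly q (of_real (t + u)) * ft (on_Icc a b (D 0)) u) 0"
proof -
  define q' where "q' = q \<circ>\<^sub>p [:of_real t, 1:]"
  have deg: "degree q' < r" using q by (simp add: q'_def degree_pcompose)
  have "has_bochner_integral lborel (\<lambda>u. \<Sum>j\<le>degree q'. coeff q' j * (of_real u ^ j * ft (on_Icc a b (D 0)) u)) (\<Sum>j\<le>degree q'. coeff q' j * 0)"
    by (intro has_bochner_integral_sum has_bochner_integral_mult_right ft_moment[OF ab D van zero]) (use deg in auto)
  moreover have "poly q (of_real (t + u)) = (\<Sum>j\<le>degree q'. coeff q' j * of_real u ^ j)" for u
    unfolding poly_altdef[symmetric] by (simp add: q'_def poly_pcompose)
  ultimately show ?thesis by (simp add: sum_distrib_right mult.assoc)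
qed

section \<open>Growth of local polynomial approximations\<close>

text \<open>Quantitative interpolation: dividing out one node x0, with p(z) = (z - x0) q(z) + p(x0),
  leaves a polynomial of lower degree that is bounded by \<open>2 * M / h\<close> at the remaining
  nodes. Each division costs a factor \<open>1 + 2 * d / h\<close>.\<close>

lemma poly_bound_separated:
  fixes p :: "complex poly" and X :: "real set"
  assumes "finite X" "card X = Suc n" and h: "0 < h"
    and "\<And>x z. x \<in> X \<Longrightarrow> z \<in> X \<Longrightarrow> x \<noteq> z \<Longrightarrow> h \<le> \<bar>x - z\<bar>"
    and "degree p \<le> n" and "\<And>x. x \<in> X \<Longrightarrow> cmod (poly p (of_real x)) \<le> M"
    and "\<And>x. x \<in> X \<Longrightarrow> \<bar>y - x\<bar> \<le> d"
  shows "cmod (poly p (of_real y)) \<le> M * (1 + 2 * d / h) ^ n"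
  using assms(1,2,4-)
proof (induction n arbitrary: p X M)
  case 0
  then obtain x where x: "x \<in> X" by fastforce
  obtain c where "p = [:c:]" using 0 by (metis degree_eq_zeroE le_zero_eq)
  then show ?case using 0(5)[OF x] by simp
next
  case (Suc n)
  then obtain x0 where x0: "x0 \<in> X" by fastforce
  define q where "q = synthetic_div p (of_real x0)"
  have pq: "poly p z = (z - of_real x0) * poly q z + poly p (of_real x0)" for z
    using arg_cong[OF synthetic_div_correct'[of "of_real x0" p], of "\<lambda>p. poly p z"]
    by (simp add: q_def algebra_simps)
  have M: "0 \<le> M" by (rule order_trans[OF norm_ge_zero Suc.prems(5)[OF x0]])
  have d: "0 \<le> d" by (rule order_trans[OF abs_ge_zero Suc.prems(6)[OF x0]])
  have "cmod (poly q (of_real y)) \<le> (2 * M / h) * (1 + 2 * d / h) ^ n"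
  proof (rule Suc.IH[of "X - {x0}"])
    show "card (X - {x0}) = Suc n" using Suc.prems x0 by simp
    show "degree q \<le> n" using Suc.prems by (simp add: q_def degree_synthetic_div)
    show "cmod (poly q (of_real x)) \<le> 2 * M / h" if "x \<in> X - {x0}" for x
    proof -
      have hx: "h \<le> \<bar>x - x0\<bar>" using Suc.prems(3)[of x x0] x0 that by auto
      have "h * cmod (poly q (of_real x)) \<le> \<bar>x - x0\<bar> * cmod (poly q (of_real x))"
        using hx by (intro mult_right_mono) auto
      also have "\<dots> = cmod (poly p (of_real x) - poly p (of_real x0))"
        unfolding pq[of "of_real x"] by (simp add: norm_mult flip: of_real_diff)
      also have "\<dots> \<le> cmod (poly p (of_real x)) + cmod (poly p (of_real x0))"
        by (rule norm_triangle_ineq4)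
      also have "\<dots> \<le> 2 * M" using Suc.prems(5)[of x] Suc.prems(5)[OF x0] that by auto
      finally show ?thesis using h by (simp add: field_simps)
    qed
  qed (use Suc.prems in auto)
  then have q: "\<bar>y - x0\<bar> * cmod (poly q (of_real y)) \<le> d * ((2 * M / h) * (1 + 2 * d / h) ^ n)"
    using Suc.prems(6)[OF x0] d by (intro mult_mono) auto
  have "cmod (poly p (of_real y)) \<le> cmod ((of_real y - of_real x0) * poly q (of_real y)) + cmod (poly p (of_real x0))"
    unfolding pq[of "of_real y"] by (rule norm_triangle_ineq)
  also have "\<dots> \<le> d * ((2 * M / h) * (1 + 2 * d / h) ^ n) + M * 1"
    using q Suc.prems(5)[OF x0] by (simp add: norm_mult flip: of_real_diff)
  also have "\<dots> \<le> d * ((2 * M / h) * (1 + 2 * d / h) ^ n) + M * (1 + 2 * d / h) ^ n"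
    using d h M by (intro add_mono mult_left_mono one_le_power) auto
  also have "\<dots> = M * (1 + 2 * d / h) ^ Suc n" by (simp add: algebra_simps)
  finally show ?case .
qed

text \<open>A mean square bound provides good nodes: in each of n + 1 separated cells, the value at
  the point where the modulus is smallest is controlled by the mean. Interpolation at these points
  then reaches as far as \<open>\<Lambda>\<close> times the length.\<close>

lemma poly_L2_growth:
  fixes p :: "complex poly"
  assumes ab: "\<alpha> < \<beta>" and deg: "degree p \<le> n" and \<Lambda>: "1 \<le> \<Lambda>" and E: "0 \<le> E"
    and int: "(\<integral>\<^sup>+x. ennreal ((cmod (poly p (of_real x)))\<^sup>2) * indicator {\<alpha>..\<beta>} x \<partial>lborel) \<le> ennreal (E\<^sup>2 * (\<beta> - \<alpha>))"
    and y: "\<And>x. x \<in> {\<alpha>..\<beta>} \<Longrightarrow> \<bar>y - x\<bar> \<le> \<Lambda> * (\<beta> - \<alpha>)"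
  shows "cmod (poly p (of_real y)) \<le> sqrt (2 * real (Suc n)) * (1 + 4 * real (Suc n)) ^ n * \<Lambda> ^ n * E"
proof -
  define N where "N = Suc n"
  \<comment> \<open>The interval is cut into \<open>2 * N\<close> cells of length \<open>h\<close>
    and every other one is used, so that points of different cells are at least \<open>h\<close>
    apart.\<close>
  define h where "h = (\<beta> - \<alpha>) / (2 * real N)"
  have h: "0 < h" using ab by (simp add: h_def N_def)
  define I where "I k = {\<alpha> + 2 * real k * h..\<alpha> + (2 * real k + 1) * h}" for k
  have IN: "I k \<subseteq> {\<alpha>..\<beta>}" if "k < N" for k
  proof -
    have "(2 * real k + 1) * h \<le> 2 * real N * h"
      using that h by (intro mult_right_mono) auto
    also have "\<dots> = \<beta> - \<alpha>" by (simp add: h_def N_def)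
    finally show ?thesis using h by (auto simp: I_def intro: order_trans[rotated])
  qed
  have "\<exists>x\<in>I k. \<forall>z\<in>I k. cmod (poly p (of_real x)) \<le> cmod (poly p (of_real z))" for k
    unfolding I_def using h by (intro continuous_attains_inf continuous_intros) (auto simp: mult_right_mono)
  then obtain x where x: "\<And>k. x k \<in> I k" and xmin: "\<And>k z. z \<in> I k \<Longrightarrow> cmod (poly p (of_real (x k))) \<le> cmod (poly p (of_real z))"
    by metis
  have sep: "h \<le> x k - x j" if "j < k" for j k
  proof -
    have "(2 * real j + 2) * h \<le> 2 * real k * h" using that h by (intro mult_right_mono) auto
    then show ?thesis using x[of j] x[of k] by (auto simp: I_def algebra_simps)
  qed
  \<comment> \<open>The minimum over a cell is at most the mean over it, and a cell fills the
    fraction \<open>1 / (2 * N)\<close> of the interval; hence \<open>sqrt (2 * N)\<close>.\<close>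
  have bound: "cmod (poly p (of_real (x k))) \<le> sqrt (2 * real N) * E" if k: "k < N" for k
  proof -
    have "ennreal ((cmod (poly p (of_real (x k))))\<^sup>2 * h) = (\<integral>\<^sup>+z. ennreal ((cmod (poly p (of_real (x k))))\<^sup>2) * indicator (I k) z \<partial>lborel)"
      using h by (simp add: nn_integral_cmult ennreal_mult I_def algebra_simps)
    also have "\<dots> \<le> (\<integral>\<^sup>+z. ennreal ((cmod (poly p (of_real z)))\<^sup>2) * indicator {\<alpha>..\<beta>} z \<partial>lborel)"
      using IN[OF k] xmin by (intro nn_integral_mono) (auto simp: indicator_def intro!: ennreal_leI power_mono)
    also note int
    finally have "(cmod (poly p (of_real (x k))))\<^sup>2 * h \<le> E\<^sup>2 * (\<beta> - \<alpha>)"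
      using ab by (simp add: ennreal_le_iff)
    also have "\<dots> = (sqrt (2 * real N) * E)\<^sup>2 * h"
      by (simp add: h_def power_mult_distrib N_def)
    finally have "(cmod (poly p (of_real (x k))))\<^sup>2 \<le> (sqrt (2 * real N) * E)\<^sup>2" using h by simp
    then show ?thesis by (rule power2_le_imp_le) (use E in simp)
  qed
  have inj: "inj_on x {..<N}"
    using sep h by (intro linorder_inj_onI) fastforce+
  have "cmod (poly p (of_real y)) \<le> (sqrt (2 * real N) * E) * (1 + 2 * (\<Lambda> * (\<beta> - \<alpha>)) / h) ^ n"
  proof (rule poly_bound_separated[where X = "x ` {..<N}", OF _ _ h])
    show "card (x ` {..<N}) = Suc n" using card_image[OF inj] by (simp add: N_def)
    fix u v assume "u \<in> x ` {..<N}" "v \<in> x ` {..<N}" "u \<noteq> v"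
    then obtain j k where "u = x j" "v = x k" "j \<noteq> k" by blast
    then show "h \<le> \<bar>u - v\<bar>" using sep[of j k] sep[of k j] by (cases "j < k") auto
  next
    fix u assume "u \<in> x ` {..<N}"
    then show "\<bar>y - u\<bar> \<le> \<Lambda> * (\<beta> - \<alpha>)" using y x IN by blast
  qed (use deg bound in auto)
  also have "2 * (\<Lambda> * (\<beta> - \<alpha>)) / h = 4 * real N * \<Lambda>"
    using ab by (simp add: h_def field_simps)
  also have "(sqrt (2 * real N) * E) * (1 + 4 * real N * \<Lambda>) ^ n \<le> (sqrt (2 * real N) * E) * ((1 + 4 * real N) * \<Lambda>) ^ n"
    using E \<Lambda> by (intro mult_left_mono power_mono) (auto simp: distrib_right)
  finally show ?thesis by (simp add: N_def power_mult_distrib mult_ac)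
qed

lemma poly_measurable [measurable]: "(\<lambda>x::real. poly (p :: complex poly) (of_real x)) \<in> borel_measurable borel"
  by (intro borel_measurable_continuous_onI continuous_intros)

abbreviation sq_norm_on :: "real \<Rightarrow> real \<Rightarrow> (real \<Rightarrow> complex) \<Rightarrow> ennreal" where
  "sq_norm_on \<alpha> \<beta> g \<equiv> (\<integral>\<^sup>+x. ennreal ((cmod (g x))\<^sup>2) * indicator {\<alpha>..\<beta>} x \<partial>lborel)"

abbreviation sq_norm_near :: "real \<Rightarrow> real \<Rightarrow> (real \<Rightarrow> complex) \<Rightarrow> ennreal" where
  "sq_norm_near c R \<equiv> sq_norm_on (c - R) (c + R)"

abbreviation minus_poly :: "(real \<Rightarrow> complex) \<Rightarrow> complex poly \<Rightarrow> real \<Rightarrow> complex" where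
  "minus_poly f q \<equiv> (\<lambda>x. f x - poly q (of_real x))"

lemma sq_norm_on_triangle_le:
  assumes [measurable]: "f \<in> borel_measurable borel" "g \<in> borel_measurable borel" "h \<in> borel_measurable borel"
  shows "sq_norm_on \<alpha> \<beta> (\<lambda>x. f x - h x)
    \<le> 2 * sq_norm_on \<alpha> \<beta> (\<lambda>x. f x - g x) + 2 * sq_norm_on \<alpha> \<beta> (\<lambda>x. g x - h x)"
proof -
  have *: "(cmod (u - w))\<^sup>2 \<le> 2 * (cmod (u - v))\<^sup>2 + 2 * (cmod (v - w))\<^sup>2" for u v w
    using power_mono[OF norm_triangle_ineq[of "u - v" "v - w"], of 2] sum_squares_bound[of "cmod (u - v)" "cmod (v - w)"]
    by (auto simp: power2_sum)
  have "sq_norm_on \<alpha> \<beta> (\<lambda>x. f x - h x) \<le> (\<integral>\<^sup>+x. 2 * (ennreal ((cmod (f x - g x))\<^sup>2) * indicator {\<alpha>..\<beta>} x)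
       + 2 * (ennreal ((cmod (g x - h x))\<^sup>2) * indicator {\<alpha>..\<beta>} x) \<partial>lborel)"
    by (intro nn_integral_mono) (use * in \<open>simp add: indicator_def ennreal_mult'[symmetric] ennreal_plus[symmetric] flip: ennreal_numeral del: ennreal_plus\<close>)
  also have "\<dots> = 2 * sq_norm_on \<alpha> \<beta> (\<lambda>x. f x - g x) + 2 * sq_norm_on \<alpha> \<beta> (\<lambda>x. g x - h x)"
    by (simp add: nn_integral_add nn_integral_cmult)
  finally show ?thesis .
qed

lemma sq_norm_on_triangle:
  assumes "f \<in> borel_measurable borel" "g \<in> borel_measurable borel" "h \<in> borel_measurable borel"
    and "sq_norm_on \<alpha> \<beta> (\<lambda>x. f x - g x) \<le> ennreal A" "sq_norm_on \<alpha> \<beta> (\<lambda>x. g x - h x) \<le> ennreal B"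
    and "0 \<le> A" "0 \<le> B"
  shows "sq_norm_on \<alpha> \<beta> (\<lambda>x. f x - h x) \<le> ennreal (2 * A + 2 * B)"
proof -
  have "sq_norm_on \<alpha> \<beta> (\<lambda>x. f x - h x)
      \<le> 2 * sq_norm_on \<alpha> \<beta> (\<lambda>x. f x - g x) + 2 * sq_norm_on \<alpha> \<beta> (\<lambda>x. g x - h x)"
    by (rule sq_norm_on_triangle_le[OF assms(1-3)])
  also have "\<dots> \<le> 2 * ennreal A + 2 * ennreal B"
    by (intro add_mono mult_left_mono assms) auto
  also have "\<dots> = ennreal (2 * A + 2 * B)"
    using assms(6,7) by (simp add: ennreal_plus ennreal_mult)
  finally show ?thesis .
qed

lemma sq_norm_on_mono:
  assumes "\<alpha>' \<le> \<alpha>" "\<beta> \<le> \<beta>'"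
  shows "sq_norm_on \<alpha> \<beta> g \<le> sq_norm_on \<alpha>' \<beta>' g"
  using assms by (intro nn_integral_mono) (auto simp: indicator_def)

text \<open>On the j-th dilate, consecutive approximants differ by order B times the s-th power of
  its length; on the k-th dilate this has grown by at most \<open>2 ^ ((k - j) * n)\<close>. Each of
  the k summands thus stays below \<open>2 powr (k * \<nu>)\<close> by a margin that is exponential
  in k.\<close>

lemma polynomial_approximation_growth:
  fixes s \<nu> :: real and n :: nat
  assumes s: "s < \<nu>" and n: "real n < \<nu>"
  obtains C where "0 < C"
    "\<And>f P c \<rho> B k. f \<in> borel_measurable borel \<Longrightarrow> 0 < \<rho> \<Longrightarrow> 0 \<le> B \<Longrightarrow> (\<And>k. degree (P k) \<le> n) \<Longrightarrow>
      (\<And>k. sq_norm_near c (2 ^ k * \<rho>) (minus_poly f (P k))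
         \<le> ennreal (B\<^sup>2 * (2 ^ k * (2 * \<rho>)) powr (2 * s + 1))) \<Longrightarrow>
      sq_norm_near c (2 ^ k * \<rho>) (minus_poly f (P 0))
         \<le> ennreal (C * B\<^sup>2 * (2 * \<rho>) powr (2 * s + 1) * 2 ^ k * 2 powr (2 * real k * \<nu>))"
proof -
  define K where "K = sqrt (2 * real (Suc n)) * (1 + 4 * real (Suc n)) ^ n"
  have K: "0 \<le> K" by (simp add: K_def)
  \<comment> \<open>\<open>A\<close> collects two errors: that of \<open>P (Suc j)\<close> on the
    dilate j + 1 and that of \<open>P j\<close> on the dilate j.\<close>
  define A where "A = sqrt (2 * (2 powr (2 * s + 1) + 1))"
  have A: "0 \<le> A" "A\<^sup>2 = 2 * (2 powr (2 * s + 1) + 1)" by (auto simp: A_def)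
  \<comment> \<open>The margin between \<open>\<nu>\<close> and max(s, n), converted to base e.
    Bounding all summands by the largest costs a factor k, which \<open>exp (- k * \<delta>)\<close>
    absorbs; this includes the case \<open>s = n\<close>, where all have the same size.\<close>
  define \<delta> where "\<delta> = min (\<nu> - s) (\<nu> - real n) * ln 2"
  have \<delta>: "0 < \<delta>" using s n by (simp add: \<delta>_def)
  define C where "C = 2 + 2 * (K * A / \<delta>)\<^sup>2"
  have "0 < C" by (simp add: C_def add_pos_nonneg)
  moreover have "sq_norm_near c (2 ^ k * \<rho>) (minus_poly f (P 0))
         \<le> ennreal (C * B\<^sup>2 * (2 * \<rho>) powr (2 * s + 1) * 2 ^ k * 2 powr (2 * real k * \<nu>))"
    if f[measurable]: "f \<in> borel_measurable borel" and \<rho>: "0 < \<rho>" and B: "0 \<le> B" and deg: "\<And>k. degree (P k) \<le> n"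
      and P: "\<And>k. sq_norm_near c (2 ^ k * \<rho>) (minus_poly f (P k))
         \<le> ennreal (B\<^sup>2 * (2 ^ k * (2 * \<rho>)) powr (2 * s + 1))"
    for f P c \<rho> B k
  proof -
    define L where "L = 2 * \<rho>"
    have L: "0 < L" using \<rho> by (simp add: L_def)
    have pw: "(2 ^ j * L) powr t = 2 powr (real j * t) * L powr t" for j t
      using L by (simp add: powr_mult powr_powr flip: powr_realpow)
    have diff: "cmod (poly (P (Suc j)) (of_real y) - poly (P j) (of_real y))
        \<le> K * A * B * L powr s * 2 powr (real (k - j) * real n + real j * s)"
      if "j < k" and y: "\<bar>y - c\<bar> \<le> 2 ^ k * \<rho>" for j y
    proof -
      let ?a = "c - 2 ^ j * \<rho>" and ?b = "c + 2 ^ j * \<rho>"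
      have len: "?b - ?a = 2 ^ j * L" by (simp add: L_def)
      have 1: "sq_norm_on ?a ?b (\<lambda>x. poly (P (Suc j)) (of_real x) - f x) \<le> ennreal (B\<^sup>2 * (2 ^ Suc j * L) powr (2 * s + 1))"
        using order_trans[OF sq_norm_on_mono P[of "Suc j"]] \<rho> by (simp add: L_def norm_minus_commute)
      have 2: "sq_norm_on ?a ?b (minus_poly f (P j)) \<le> ennreal (B\<^sup>2 * (2 ^ j * L) powr (2 * s + 1))"
        using P[of j] by (simp add: L_def)
      have "sq_norm_on ?a ?b (\<lambda>x. poly (P (Suc j)) (of_real x) - poly (P j) (of_real x))
          \<le> ennreal (2 * (B\<^sup>2 * (2 ^ Suc j * L) powr (2 * s + 1)) + 2 * (B\<^sup>2 * (2 ^ j * L) powr (2 * s + 1)))"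
        by (rule sq_norm_on_triangle[OF _ _ _ 1 2]) auto
      also have "2 * (B\<^sup>2 * (2 ^ Suc j * L) powr (2 * s + 1)) + 2 * (B\<^sup>2 * (2 ^ j * L) powr (2 * s + 1))
          = (A * B * (2 ^ j * L) powr s)\<^sup>2 * (?b - ?a)"
      proof -
        define z where "z = 2 ^ j * L"
        have z: "0 < z" using L by (simp add: z_def)
        have "2 ^ Suc j * L = 2 * z" by (simp add: z_def)
        moreover have "(2 * z) powr (2 * s + 1) = 2 powr (2 * s + 1) * z powr (2 * s + 1)"
          using z by (simp add: powr_mult)
        moreover have "z powr (2 * s + 1) = (z powr s)\<^sup>2 * z"
          using z by (simp add: powr_add powr_power mult.commute)
        ultimately have "(2 ^ Suc j * L) powr (2 * s + 1) = 2 powr (2 * s + 1) * ((z powr s)\<^sup>2 * z)"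
          "(2 ^ j * L) powr (2 * s + 1) = (z powr s)\<^sup>2 * z"
          by (simp_all only: z_def)
        then show ?thesis unfolding len z_def[symmetric] power_mult_distrib A(2)
          by (simp only: distrib_left distrib_right mult_ac mult_1_right mult_1_left)
      qed
      finally have "cmod (poly (P (Suc j) - P j) (of_real y)) \<le> K * (2 ^ (k - j)) ^ n * (A * B * (2 ^ j * L) powr s)"
        unfolding K_def
      proof (intro poly_L2_growth)
        show "?a < ?b" using \<rho> by simp
        show "degree (P (Suc j) - P j) \<le> n" using deg by (intro degree_diff_le) auto
        show "\<bar>y - x\<bar> \<le> 2 ^ (k - j) * (?b - ?a)" if "x \<in> {?a..?b}" for x
        proof -
          have "2 ^ j * \<rho> \<le> 2 ^ k * \<rho>" using \<open>j < k\<close> \<rho> by (intro mult_right_mono power_increasing) auto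
          moreover have "2 ^ (k - j) * (2 ^ j * L) = 2 ^ k * L"
            using \<open>j < k\<close> by (simp flip: power_add)
          ultimately show ?thesis using that y unfolding len by (simp only:) (auto simp: L_def abs_le_iff)
        qed
      qed (use A B in auto)
      also have "(2 ^ (k - j)) ^ n = (2::real) powr (real (k - j) * real n)"
        by (simp flip: powr_realpow add: powr_powr)
      finally show ?thesis unfolding pw powr_add by (simp add: mult_ac)
    qed
    have tele: "cmod (poly (P k) (of_real y) - poly (P 0) (of_real y)) \<le> K * A * B * L powr s * 2 powr (real k * \<nu>) / \<delta>"
      if y: "y \<in> {c - 2 ^ k * \<rho>..c + 2 ^ k * \<rho>}" for y
    proof -
      have "poly (P k) (of_real y) - poly (P 0) (of_real y) = (\<Sum>j<k. poly (P (Suc j)) (of_real y) - poly (P j) (of_real y))"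
        by (simp add: sum_lessThan_telescope[of "\<lambda>j. poly (P j) (of_real y)"])
      also have "cmod \<dots> \<le> (\<Sum>j<k. K * A * B * L powr s * (2 powr (real k * \<nu>) * exp (- real k * \<delta>)))"
      proof (rule sum_norm_le)
        fix j assume j: "j \<in> {..<k}"
        have 1: "real (k - j) * real n \<le> real (k - j) * (\<nu> - \<delta> / ln 2)"
          by (intro mult_left_mono) (auto simp: \<delta>_def)
        have 2: "real j * s \<le> real j * (\<nu> - \<delta> / ln 2)"
          by (intro mult_left_mono) (auto simp: \<delta>_def)
        have "real (k - j) * real n + real j * s \<le> real k * (\<nu> - \<delta> / ln 2)"
        proof -
          have "real (k - j) + real j = real k" using j by simp
          then show ?thesis using add_mono[OF 1 2] by (simp only: distrib_right[symmetric])
        qed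
        then have "2 powr (real (k - j) * real n + real j * s) \<le> 2 powr (real k * (\<nu> - \<delta> / ln 2))"
          by (intro powr_mono) auto
        also have "\<dots> = 2 powr (real k * \<nu>) * exp (- real k * \<delta>)"
          by (simp add: powr_def exp_add[symmetric] field_simps)
        finally have "K * A * B * L powr s * 2 powr (real (k - j) * real n + real j * s)
            \<le> K * A * B * L powr s * (2 powr (real k * \<nu>) * exp (- real k * \<delta>))"
          using K A B by (intro mult_left_mono) auto
        then show "cmod (poly (P (Suc j)) (of_real y) - poly (P j) (of_real y))
            \<le> K * A * B * L powr s * (2 powr (real k * \<nu>) * exp (- real k * \<delta>))"
          using diff[of j y] j y by (force simp: abs_le_iff)
      qed
      also have "\<dots> = K * A * B * L powr s * 2 powr (real k * \<nu>) * (real k * exp (- real k * \<delta>))" by simp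
      also have "\<dots> \<le> K * A * B * L powr s * 2 powr (real k * \<nu>) * (1 / \<delta>)"
      proof (intro mult_left_mono)
        have "real k * \<delta> \<le> exp (real k * \<delta>)" using exp_ge_add_one_self[of "real k * \<delta>"] by linarith
        then show "real k * exp (- real k * \<delta>) \<le> 1 / \<delta>"
          using \<delta> by (simp add: exp_minus field_simps)
      qed (use K A B in auto)
      finally show ?thesis by simp
    qed
    let ?a = "c - 2 ^ k * \<rho>" and ?b = "c + 2 ^ k * \<rho>"
    define T where "T = K * A * B * L powr s * 2 powr (real k * \<nu>) / \<delta>"
    have T: "0 \<le> T" using K A B \<delta> by (simp add: T_def)
    have "sq_norm_on ?a ?b (\<lambda>x. poly (P k) (of_real x) - poly (P 0) (of_real x)) \<le> (\<integral>\<^sup>+x. ennreal (T\<^sup>2) * indicator {?a..?b} x \<partial>lborel)"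
      using tele unfolding T_def[symmetric]
      by (intro nn_integral_mono) (auto simp: indicator_def intro!: ennreal_leI power_mono)
    also have "\<dots> = ennreal (T\<^sup>2 * (2 ^ k * L))"
      using \<rho> by (simp add: nn_integral_cmult ennreal_mult L_def mult_ac)
    finally have 2: "sq_norm_on ?a ?b (\<lambda>x. poly (P k) (of_real x) - poly (P 0) (of_real x)) \<le> ennreal (T\<^sup>2 * (2 ^ k * L))" .
    have "sq_norm_on ?a ?b (minus_poly f (P 0)) \<le> ennreal (2 * (B\<^sup>2 * (2 ^ k * L) powr (2 * s + 1)) + 2 * (T\<^sup>2 * (2 ^ k * L)))"
      by (rule sq_norm_on_triangle[OF _ _ _ P[of k, folded L_def] 2]) (use L in auto)
    also have "\<dots> \<le> ennreal (C * B\<^sup>2 * L powr (2 * s + 1) * 2 ^ k * 2 powr (2 * real k * \<nu>))"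
    proof (rule ennreal_leI)
      define W where "W = B\<^sup>2 * L powr (2 * s + 1) * 2 ^ k * 2 powr (2 * real k * \<nu>)"
      have "(2 ^ k * L) powr (2 * s + 1) = 2 powr (2 * real k * s) * 2 ^ k * L powr (2 * s + 1)"
        unfolding pw by (simp add: powr_add distrib_left mult_ac flip: powr_realpow)
      also have "\<dots> \<le> 2 powr (2 * real k * \<nu>) * 2 ^ k * L powr (2 * s + 1)"
        using s by (intro mult_right_mono powr_mono mult_left_mono) auto
      finally have "B\<^sup>2 * (2 ^ k * L) powr (2 * s + 1) \<le> W"
        unfolding W_def by (simp add: mult_left_mono mult_ac)
      moreover have "T\<^sup>2 * (2 ^ k * L) = (K * A / \<delta>)\<^sup>2 * W"
      proof -
        have "L powr (2 * s + 1) = (L powr s)\<^sup>2 * L" using L by (simp add: powr_add powr_power mult.commute)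
        moreover have "2 powr (2 * real k * \<nu>) = (2 powr (real k * \<nu>))\<^sup>2" by (simp add: powr_power mult_ac)
        ultimately show ?thesis unfolding T_def W_def by (simp only: power_mult_distrib power_divide mult_ac times_divide_eq_left times_divide_eq_right)
      qed
      moreover have "C * B\<^sup>2 * L powr (2 * s + 1) * 2 ^ k * 2 powr (2 * real k * \<nu>) = 2 * W + 2 * ((K * A / \<delta>)\<^sup>2 * W)"
        by (simp add: C_def W_def distrib_right mult.assoc)
      ultimately show "2 * (B\<^sup>2 * (2 ^ k * L) powr (2 * s + 1)) + 2 * (T\<^sup>2 * (2 ^ k * L))
          \<le> C * B\<^sup>2 * L powr (2 * s + 1) * 2 ^ k * 2 powr (2 * real k * \<nu>)"
        by linarith
    qed
    finally show ?thesis by (simp add: L_def)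
  qed
  ultimately show ?thesis using that by blast
qed

section \<open>Taylor approximation of band-limited functions\<close>

text \<open>Taylor's formula in \<open>x\<close> for a single exponential. The remainder carries the
  r-th power of the frequency, which becomes the extra factor of the symbol.\<close>

lemma cis_Taylor_remainder:
  fixes \<eta> \<alpha> x :: real
  assumes "0 < r" "\<alpha> \<le> x"
  defines "z \<equiv> 2 * pi * \<i> * \<eta>"
  shows "cis (2 * pi * x * \<eta>) = (\<Sum>k<r. of_real ((x - \<alpha>) ^ k / fact k) * (z ^ k * cis (2 * pi * \<alpha> * \<eta>)))
     + (LINT t|lborel. on_Icc \<alpha> x (\<lambda>t. of_real ((x - t) ^ (r - 1) / fact (r - 1))) t * (z ^ r * cis (2 * pi * t * \<eta>)))"
proof -
  define Df where "Df k t = z ^ k * cis (2 * pi * t * \<eta>)" for k t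
  have der: "(Df k has_vector_derivative Df (Suc k) t) (at t within S)" for k t S
    unfolding Df_def cis_conv_exp z_def
    by (auto intro!: derivative_eq_intros has_vector_derivative_real_field simp: algebra_simps)
  have cont: "continuous_on S (Df k)" for k S
    using der by (meson continuous_on_vector_derivative)
  let ?i = "\<lambda>t. ((x - t) ^ (r - 1) / fact (r - 1)) *\<^sub>R Df r t"
  have "(?i has_integral Df 0 x - (\<Sum>k<r. ((x - \<alpha>) ^ k / fact k) *\<^sub>R Df k \<alpha>)) {\<alpha>..x}"
    using assms(1,2) der by (intro Taylor_has_integral) auto
  then have 1: "integral {\<alpha>..x} ?i = Df 0 x - (\<Sum>k<r. ((x - \<alpha>) ^ k / fact k) *\<^sub>R Df k \<alpha>)"
    by (rule integral_unique)
  have "continuous_on {\<alpha>..x} ?i" by (intro continuous_intros cont) simp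
  then have "set_integrable lborel {\<alpha>..x} ?i" by (rule borel_integrable_atLeastAtMost')
  then have "(LINT t:{\<alpha>..x}|lborel. ?i t) = integral {\<alpha>..x} ?i"
    by (rule set_borel_integral_eq_integral)
  moreover have "(LINT t:{\<alpha>..x}|lborel. ?i t) = (LINT t|lborel. on_Icc \<alpha> x (\<lambda>t. of_real ((x - t) ^ (r - 1) / fact (r - 1))) t * Df r t)"
    unfolding set_lebesgue_integral_def
    by (intro Bochner_Integration.integral_cong) (auto simp: indicator_def scaleR_conv_of_real)
  ultimately have "Df 0 x = (\<Sum>k<r. ((x - \<alpha>) ^ k / fact k) *\<^sub>R Df k \<alpha>)
      + (LINT t|lborel. on_Icc \<alpha> x (\<lambda>t. of_real ((x - t) ^ (r - 1) / fact (r - 1))) t * Df r t)"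
    using 1 by simp
  then show ?thesis by (simp add: Df_def scaleR_conv_of_real)
qed

lemma integrable_mult_continuous_on_support:
  fixes \<Phi> u :: "real \<Rightarrow> complex"
  assumes \<Phi>: "integrable lborel \<Phi>" and supp: "\<And>\<xi>. \<xi> \<notin> {a..b} \<Longrightarrow> \<Phi> \<xi> = 0"
    and u: "continuous_on UNIV u"
  shows "integrable lborel (\<lambda>\<xi>. \<Phi> \<xi> * u \<xi>)"
proof -
  note [measurable] = borel_measurable_integrable[OF \<Phi>] borel_measurable_continuous_onI[OF u]
  have "bounded (u ` {a..b})"
    by (intro compact_imp_bounded compact_continuous_image continuous_on_subset[OF u]) auto
  then obtain K where K: "\<forall>\<xi>\<in>u ` {a..b}. cmod \<xi> \<le> K" by (auto simp only: bounded_iff)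
  show ?thesis
  proof (rule Bochner_Integration.integrable_bound)
    show "integrable lborel (\<lambda>\<xi>. K * cmod (\<Phi> \<xi>))"
      using \<Phi> by (intro integrable_mult_right integrable_norm)
    show "AE \<xi> in lborel. norm (\<Phi> \<xi> * u \<xi>) \<le> norm (K * cmod (\<Phi> \<xi>))"
    proof (rule AE_I2)
      fix \<xi>
      show "norm (\<Phi> \<xi> * u \<xi>) \<le> norm (K * cmod (\<Phi> \<xi>))"
      proof (cases "\<xi> \<in> {a..b}")
        case True
        then have "cmod (u \<xi>) \<le> \<bar>K\<bar>" using K by force
        then show ?thesis by (simp add: norm_mult abs_mult mult.commute[of "\<bar>K\<bar>"] mult_left_mono)
      qed (simp add: supp)
    qed
  qed measurable
qed

text \<open>The approximant is the Taylor polynomial at \<open>\<alpha>\<close>. Taylor's formula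
  for one exponential is integrated against \<open>\<Phi>\<close>, so nothing has to be
  differentiated under the integral; Cauchy-Schwarz bounds the remainder through \<open>w\<close>,
  which plays the role of the r-th derivative.\<close>

lemma band_limited_polynomial_approximation:
  fixes \<Phi> :: "real \<Rightarrow> complex"
  assumes r: "0 < r" and \<alpha>\<beta>: "\<alpha> < \<beta>"
    and \<Phi>: "integrable lborel \<Phi>" and supp: "\<And>\<xi>. \<xi> \<notin> {a..b} \<Longrightarrow> \<Phi> \<xi> = 0"
  shows "\<exists>p. degree p < r \<and>
    sq_norm_on \<alpha> \<beta> (\<lambda>x. (LINT \<xi>|lborel. \<Phi> \<xi> * cis (2 * pi * x * (\<xi> - e))) - poly p (of_real x))
      \<le> ennreal ((\<beta> - \<alpha>) ^ (2 * r)) *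
        sq_norm_on \<alpha> \<beta> (\<lambda>t. LINT \<xi>|lborel. \<Phi> \<xi> * (2 * pi * \<i> * of_real (\<xi> - e)) ^ r * cis (2 * pi * t * (\<xi> - e)))"
proof -
  note [measurable] = borel_measurable_integrable[OF \<Phi>]
  let ?z = "\<lambda>\<xi>. 2 * pi * \<i> * of_real (\<xi> - e) :: complex"
  define v where "v x = (LINT \<xi>|lborel. \<Phi> \<xi> * cis (2 * pi * x * (\<xi> - e)))" for x
  define w where "w t = (LINT \<xi>|lborel. \<Phi> \<xi> * ?z \<xi> ^ r * cis (2 * pi * t * (\<xi> - e)))" for t
  define c where "c k = (LINT \<xi>|lborel. \<Phi> \<xi> * (?z \<xi> ^ k * cis (2 * pi * \<alpha> * (\<xi> - e))))" for k
  define p where "p = (\<Sum>k<r. smult (c k / fact k) ([:- of_real \<alpha>, 1:] ^ k))"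
  define kr where "kr x t = of_real ((x - t) ^ (r - 1) / fact (r - 1)) * (1::complex)" for x t :: real
  have [measurable]: "v \<in> borel_measurable borel" "w \<in> borel_measurable borel"
    unfolding v_def w_def by measurable
  have ic: "integrable lborel (\<lambda>\<xi>. \<Phi> \<xi> * (?z \<xi> ^ k * cis (2 * pi * \<alpha> * (\<xi> - e))))" for k
    by (intro integrable_mult_continuous_on_support[OF \<Phi> supp] continuous_intros) auto
  have ir: "integrable lborel (\<lambda>\<xi>. \<Phi> \<xi> * ?z \<xi> ^ r)"
    by (intro integrable_mult_continuous_on_support[OF \<Phi> supp] continuous_intros) auto
  have kc: "continuous_on S (kr x)" for S x unfolding kr_def by (intro continuous_intros) auto
  have ik: "integrable lborel (on_Icc \<alpha> x (kr x))" for x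
    by (rule integrable_on_Icc[OF kc])
  have "degree p \<le> r - 1"
    unfolding p_def
    by (intro degree_sum_le order_trans[OF degree_smult_le] order_trans[OF degree_power_le]) auto
  then have deg: "degree p < r" using r by simp
  have rep: "v x - poly p (of_real x) = (LINT t|lborel. on_Icc \<alpha> x (kr x) t * w t)" if x: "\<alpha> \<le> x" for x
  proof -
    let ?R = "\<lambda>\<xi>. (LINT t|lborel. on_Icc \<alpha> x (kr x) t * cis (2 * pi * t * (\<xi> - e)))"
    have T: "cis (2 * pi * x * (\<xi> - e)) = (\<Sum>k<r. of_real ((x - \<alpha>) ^ k / fact k) * (?z \<xi> ^ k * cis (2 * pi * \<alpha> * (\<xi> - e))))
        + ?z \<xi> ^ r * ?R \<xi>" for \<xi>
    proof -
      have "(LINT t|lborel. on_Icc \<alpha> x (\<lambda>t. of_real ((x - t) ^ (r - 1) / fact (r - 1))) t * (?z \<xi> ^ r * cis (2 * pi * t * (\<xi> - e))))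
          = ?z \<xi> ^ r * ?R \<xi>"
        by (subst integral_mult_right_zero[symmetric]) (simp add: kr_def mult_ac)
      then show ?thesis
        using cis_Taylor_remainder[OF r x, of "\<xi> - e"] by simp
    qed
    have iR: "integrable lborel (\<lambda>\<xi>. \<Phi> \<xi> * ?z \<xi> ^ r * ?R \<xi>)"
    proof -
      have "integrable (lborel \<Otimes>\<^sub>M lborel) (\<lambda>(\<xi>, t). (\<Phi> \<xi> * ?z \<xi> ^ r) * on_Icc \<alpha> x (kr x) t * cis (2 * pi * t * (\<xi> - e)))"
        by (rule integrable_pair_kernel[OF ir ik, where B = 1]) auto
      then have "integrable lborel (\<lambda>\<xi>. LINT t|lborel. (\<Phi> \<xi> * ?z \<xi> ^ r) * on_Icc \<alpha> x (kr x) t * cis (2 * pi * t * (\<xi> - e)))"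
        by (rule lborel_pair.integrable_fst)
      then show ?thesis by (simp add: mult.assoc)
    qed
    have "v x = (LINT \<xi>|lborel. (\<Sum>k<r. of_real ((x - \<alpha>) ^ k / fact k) * (\<Phi> \<xi> * (?z \<xi> ^ k * cis (2 * pi * \<alpha> * (\<xi> - e)))))
        + \<Phi> \<xi> * ?z \<xi> ^ r * ?R \<xi>)"
      unfolding v_def
    proof (rule Bochner_Integration.integral_cong[OF refl])
      fix \<xi>
      show "\<Phi> \<xi> * cis (2 * pi * x * (\<xi> - e)) = (\<Sum>k<r. of_real ((x - \<alpha>) ^ k / fact k) * (\<Phi> \<xi> * (?z \<xi> ^ k * cis (2 * pi * \<alpha> * (\<xi> - e)))))
        + \<Phi> \<xi> * ?z \<xi> ^ r * ?R \<xi>"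
        unfolding T distrib_left sum_distrib_left by (simp only: mult_ac)
    qed
    also have "\<dots> = (\<Sum>k<r. of_real ((x - \<alpha>) ^ k / fact k) * c k) + (LINT \<xi>|lborel. \<Phi> \<xi> * ?z \<xi> ^ r * ?R \<xi>)"
      unfolding c_def
      by (subst Bochner_Integration.integral_add[OF Bochner_Integration.integrable_sum iR], intro integrable_mult_right ic,
          subst Bochner_Integration.integral_sum, intro integrable_mult_right ic, simp)
    also have "(\<Sum>k<r. of_real ((x - \<alpha>) ^ k / fact k) * c k) = poly p (of_real x)"
      unfolding p_def poly_sum by (intro sum.cong refl) simp
    also have "(LINT \<xi>|lborel. \<Phi> \<xi> * ?z \<xi> ^ r * ?R \<xi>) = (LINT t|lborel. on_Icc \<alpha> x (kr x) t * w t)"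
      unfolding w_def by (rule integral_pair_swap[OF ir ik, where B = 1]) auto
    finally show ?thesis by simp
  qed
  \<comment> \<open>The exponent \<open>2 * r - 1\<close> is \<open>2 * (r - 1)\<close> from the
    squared kernel plus 1 from the length; integration over \<open>x\<close> supplies the last
    power.\<close>
  have bound: "ennreal ((cmod (v x - poly p (of_real x)))\<^sup>2) \<le> ennreal ((\<beta> - \<alpha>) ^ (2 * r - 1)) * sq_norm_on \<alpha> \<beta> w"
    if x: "x \<in> {\<alpha>..\<beta>}" for x
  proof -
    have "v x - poly p (of_real x) = (LINT t|lborel. on_Icc \<alpha> x (kr x) t * on_Icc \<alpha> \<beta> w t)"
      unfolding rep[of x, OF conjunct1[OF x[unfolded atLeastAtMost_iff]]]
      using x by (intro Bochner_Integration.integral_cong) (auto simp: indicator_def)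
    also have "ennreal ((cmod \<dots>)\<^sup>2) \<le> sq_norm (on_Icc \<alpha> x (kr x)) * sq_norm (on_Icc \<alpha> \<beta> w)"
      by (rule Cauchy_Schwarz_lborel) (use measurable_on_Icc[OF kc] in auto)
    also have "sq_norm (on_Icc \<alpha> x (kr x)) \<le> ennreal (((\<beta> - \<alpha>) ^ (r - 1))\<^sup>2 * (x - \<alpha>))"
    proof (rule sq_norm_on_Icc_le)
      fix t assume t: "t \<in> {\<alpha>..x}"
      have "(x - t) ^ (r - 1) / fact (r - 1) \<le> (x - t) ^ (r - 1) / 1"
        using t by (intro divide_left_mono) auto
      also have "\<dots> \<le> (\<beta> - \<alpha>) ^ (r - 1)" using t x by (auto intro!: power_mono)
      finally show "cmod (kr x t) \<le> (\<beta> - \<alpha>) ^ (r - 1)"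
        using t by (simp add: kr_def norm_divide norm_power flip: of_real_diff)
    qed (use x in auto)
    also have "\<dots> \<le> ennreal (((\<beta> - \<alpha>) ^ (r - 1))\<^sup>2 * (\<beta> - \<alpha>))"
      using x by (intro ennreal_leI mult_left_mono) auto
    also have "((\<beta> - \<alpha>) ^ (r - 1))\<^sup>2 * (\<beta> - \<alpha>) = (\<beta> - \<alpha>) ^ (2 * r - 1)"
    proof -
      have "2 * r - 1 = (r - 1) * 2 + 1" using r by simp
      then show ?thesis by (simp only: power_add power_mult power_one_right)
    qed
    also have "sq_norm (on_Icc \<alpha> \<beta> w) = sq_norm_on \<alpha> \<beta> w"
      by (intro nn_integral_cong) (auto simp: indicator_def)
    finally show ?thesis by (simp add: mult_right_mono)
  qed
  have "sq_norm_on \<alpha> \<beta> (minus_poly v p) \<le> (\<integral>\<^sup>+x. (ennreal ((\<beta> - \<alpha>) ^ (2 * r - 1)) * sq_norm_on \<alpha> \<beta> w) * indicator {\<alpha>..\<beta>} x \<partial>lborel)"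
    using bound by (intro nn_integral_mono) (auto simp: indicator_def)
  also have "\<dots> = (ennreal ((\<beta> - \<alpha>) ^ (2 * r - 1)) * sq_norm_on \<alpha> \<beta> w) * ennreal (\<beta> - \<alpha>)"
    using \<alpha>\<beta> by (subst nn_integral_cmult) auto
  also have "\<dots> = ennreal ((\<beta> - \<alpha>) ^ (2 * r)) * sq_norm_on \<alpha> \<beta> w"
  proof -
    have "(\<beta> - \<alpha>) ^ (2 * r) = (\<beta> - \<alpha>) ^ (2 * r - 1) * (\<beta> - \<alpha>)"
      using r by (cases r) auto
    then show ?thesis using \<alpha>\<beta> by (simp add: ennreal_mult mult_ac)
  qed
  finally have "sq_norm_on \<alpha> \<beta> (minus_poly v p) \<le> ennreal ((\<beta> - \<alpha>) ^ (2 * r)) * sq_norm_on \<alpha> \<beta> w" .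
  then show ?thesis
    unfolding v_def w_def by (intro exI[of _ p] conjI deg)
qed

section \<open>The far field\<close>

text \<open>Cauchy-Schwarz with the weights \<open>\<theta> ^ k\<close> takes the place of
  Minkowski's inequality over \<open>I\<close>. Half of the decay \<open>\<theta> ^ (4 * k)\<close>
  pays for the weights, the other half makes the remaining series converge.\<close>

lemma weighted_sum_bound:
  fixes z :: "nat \<Rightarrow> 'i \<Rightarrow> complex" and \<theta> Y :: real
  assumes \<theta>: "0 < \<theta>" "\<theta> < 1" and Y: "0 \<le> Y"
    and z: "\<And>k. (\<Sum>m\<in>I. (cmod (z k m))\<^sup>2) \<le> Y * \<theta> ^ (4 * k)"
  shows "(\<Sum>m\<in>I. (cmod (\<Sum>k<N. z k m))\<^sup>2) \<le> Y / (1 - \<theta>\<^sup>2)\<^sup>2"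
proof -
  have geo: "(\<Sum>k<N. \<theta> ^ (2 * k)) \<le> 1 / (1 - \<theta>\<^sup>2)"
  proof -
    have q: "\<theta>\<^sup>2 < 1" "0 \<le> \<theta>\<^sup>2" using \<theta> by (auto simp: power_less_one_iff)
    then have "(\<Sum>k<N. (\<theta>\<^sup>2) ^ k) \<le> (\<Sum>k. (\<theta>\<^sup>2) ^ k)"
      by (intro sum_le_suminf summable_geometric) auto
    then show ?thesis using q by (simp add: suminf_geometric power_mult)
  qed
  have "(cmod (\<Sum>k<N. z k m))\<^sup>2 \<le> (1 / (1 - \<theta>\<^sup>2)) * (\<Sum>k<N. (cmod (z k m))\<^sup>2 / \<theta> ^ (2 * k))" for m
  proof -
    have "(cmod (\<Sum>k<N. z k m))\<^sup>2 \<le> (\<Sum>k<N. cmod (z k m))\<^sup>2"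
      by (intro power_mono norm_sum) auto
    also have "\<dots> = (\<Sum>k<N. \<theta> ^ k * (cmod (z k m) / \<theta> ^ k))\<^sup>2"
      using \<theta> by simp
    also have "\<dots> \<le> (\<Sum>k<N. (\<theta> ^ k)\<^sup>2) * (\<Sum>k<N. (cmod (z k m) / \<theta> ^ k)\<^sup>2)"
      by (rule Cauchy_Schwarz_ineq_sum)
    also have "\<dots> \<le> (1 / (1 - \<theta>\<^sup>2)) * (\<Sum>k<N. (cmod (z k m) / \<theta> ^ k)\<^sup>2)"
      using geo by (intro mult_right_mono sum_nonneg) (auto simp: power_mult[symmetric] mult.commute)
    also have "(\<Sum>k<N. (cmod (z k m) / \<theta> ^ k)\<^sup>2) = (\<Sum>k<N. (cmod (z k m))\<^sup>2 / \<theta> ^ (2 * k))"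
      by (simp add: power_divide power_mult[symmetric] mult.commute)
    finally show ?thesis .
  qed
  then have "(\<Sum>m\<in>I. (cmod (\<Sum>k<N. z k m))\<^sup>2) \<le> (\<Sum>m\<in>I. (1 / (1 - \<theta>\<^sup>2)) * (\<Sum>k<N. (cmod (z k m))\<^sup>2 / \<theta> ^ (2 * k)))"
    by (intro sum_mono) auto
  also have "\<dots> = (1 / (1 - \<theta>\<^sup>2)) * (\<Sum>k<N. (\<Sum>m\<in>I. (cmod (z k m))\<^sup>2) / \<theta> ^ (2 * k))"
    by (subst sum_distrib_left[symmetric], subst sum.swap) (simp add: sum_divide_distrib)
  also have "\<dots> \<le> (1 / (1 - \<theta>\<^sup>2)) * (\<Sum>k<N. Y * \<theta> ^ (2 * k))"
  proof (intro mult_left_mono sum_mono)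
    fix k
    have "(\<Sum>m\<in>I. (cmod (z k m))\<^sup>2) / \<theta> ^ (2 * k) \<le> Y * \<theta> ^ (4 * k) / \<theta> ^ (2 * k)"
      using z[of k] \<theta> by (intro divide_right_mono) auto
    also have "\<theta> ^ (4 * k) = \<theta> ^ (2 * k) * \<theta> ^ (2 * k)" by (simp flip: power_add)
    finally show "(\<Sum>m\<in>I. (cmod (z k m))\<^sup>2) / \<theta> ^ (2 * k) \<le> Y * \<theta> ^ (2 * k)" using \<theta> by simp
  qed (use \<theta> in \<open>simp add: power_le_one\<close>)
  also have "\<dots> \<le> (1 / (1 - \<theta>\<^sup>2)) * (Y * (1 / (1 - \<theta>\<^sup>2)))"
    unfolding sum_distrib_left[symmetric] using geo Y \<theta> by (intro mult_left_mono) (auto simp: power_le_one)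
  finally show ?thesis by (simp add: power2_eq_square)
qed

text \<open>The estimate is pointwise in \<open>t\<close>, with the kernels centred there. Once
  \<open>g\<close> and, by the vanishing moments, \<open>p\<close> are removed, what remains is the
  error \<open>f - p\<close> outside the doubled interval; each dyadic annulus is one use of
  \<open>separated_kernel_estimate\<close>.\<close>

proposition far_field_estimate:
  fixes a b :: "nat \<Rightarrow> real" and D :: "nat \<Rightarrow> nat \<Rightarrow> real \<Rightarrow> complex"
  assumes fin: "finite I" and disj: "disjoint_family_on (\<lambda>m. {a m..b m}) I"
    and ab: "\<And>m. m \<in> I \<Longrightarrow> a m < b m" and D: "\<And>m. m \<in> I \<Longrightarrow> derivs_on (a m) (b m) (D m)"
    and van: "\<And>m k. m \<in> I \<Longrightarrow> k < r \<Longrightarrow> D m k (a m) = 0 \<and> D m k (b m) = 0"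
    and M0: "\<And>m \<xi>. m \<in> I \<Longrightarrow> \<xi> \<in> {a m..b m} \<Longrightarrow> cmod (D m r \<xi>) \<le> M"
    and M1: "\<And>m \<xi>. m \<in> I \<Longrightarrow> \<xi> \<in> {a m..b m} \<Longrightarrow> cmod (D m (Suc r) \<xi>) \<le> M / (b m - a m)"
    and M: "0 \<le> M" and zero: "\<And>m. m \<in> I \<Longrightarrow> 0 \<notin> {a m<..<b m}"
    and f[measurable]: "f \<in> borel_measurable borel" and ffin: "sq_norm f < \<infinity>"
    and F[measurable]: "F \<in> borel_measurable borel" and Ffin: "sq_norm F < \<infinity>"
    and lim: "ft_limit f F"
    and \<rho>: "0 < \<rho>" and p: "degree p < r" and X: "0 \<le> X" and \<nu>: "\<nu> < real r"
    and growth: "\<And>k. sq_norm_near c (2 ^ k * \<rho>) (minus_poly f p)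
         \<le> ennreal (X * 2 ^ k * 2 powr (2 * real k * \<nu>))"
    and t: "t \<in> {c - \<rho>..c + \<rho>}"
    and g_def: "g = on_Icc (c - 2 * \<rho>) (c + 2 * \<rho>) (minus_poly f p)"
  shows "(\<Sum>m\<in>I. (cmod (LINT \<xi>|lborel. (F \<xi> - ft g \<xi>) * on_Icc (a m) (b m) (D m 0) \<xi> * cis (2 * pi * t * \<xi>)))\<^sup>2)
    \<le> 64 * M\<^sup>2 * 2 powr (4 * \<nu>) / (1 - 2 powr (\<nu> - real r))\<^sup>2 * (X / \<rho> ^ (2 * r + 1))"
proof -
  define h where "h x = f x - poly p (of_real x)" for x
  have [measurable]: "h \<in> borel_measurable borel" unfolding h_def by measurable
  define Q where "Q k = {c - 2 ^ k * \<rho>..c + 2 ^ k * \<rho>}" for k :: nat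
  have Qmono: "Q j \<subseteq> Q k" if "j \<le> k" for j k
  proof -
    have "2 ^ j * \<rho> \<le> 2 ^ k * \<rho>" using that \<rho> by (intro mult_right_mono power_increasing) auto
    then show ?thesis by (auto simp: Q_def)
  qed
  have [measurable]: "Q k \<in> sets borel" for k by (simp add: Q_def)
  have g: "g x = indicator (Q 1) x * h x" for x by (simp add: g_def Q_def h_def)
  have hQ: "(\<integral>\<^sup>+x. ennreal ((cmod (h x))\<^sup>2) * indicator (Q k) x \<partial>lborel) \<le> ennreal (X * 2 ^ k * 2 powr (2 * real k * \<nu>))" for k
    using growth[of k] by (simp add: h_def Q_def)
  define H where "H N x = indicator (Q (Suc N) - Q 1) x * h x" for N x
  define G where "G k x = indicator (Q (Suc (Suc k)) - Q (Suc k)) x * h x" for k x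
  have [measurable]: "H N \<in> borel_measurable borel" "G N \<in> borel_measurable borel" "g \<in> borel_measurable borel" for N
    unfolding H_def G_def g by measurable
  have HG: "H (Suc k) x = H k x + G k x" for k x
    using Qmono[of 1 "Suc k"] Qmono[of "Suc k" "Suc (Suc k)"] by (auto simp: H_def G_def indicator_def)
  have sub_le: "sq_norm (\<lambda>x. indicator A x * h x) \<le> ennreal (X * 2 ^ k * 2 powr (2 * real k * \<nu>))" if "A \<subseteq> Q k" for A k
    by (rule order_trans[OF nn_integral_mono hQ[of k]]) (use that in \<open>auto simp: indicator_def\<close>)
  have Gn: "sq_norm (G k) \<le> ennreal (X * 2 ^ Suc (Suc k) * 2 powr (2 * real (Suc (Suc k)) * \<nu>))" for k
    unfolding G_def by (rule sub_le) auto
  have gn: "sq_norm g < \<infinity>" "sq_norm (G k) < \<infinity>" "sq_norm (H k) < \<infinity>" for k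
    using sub_le[of "Q 1" 1] Gn[of k] sub_le[of "Q (Suc k) - Q 1" "Suc k"]
    unfolding g H_def by (auto intro: le_less_trans)
  have gi: "integrable lborel g"
    by (rule integrable_compact_support[OF _ gn(1), of "c - 2 * \<rho>" "c + 2 * \<rho>"]) (auto simp: g_def)
  have Gshift: "sq_norm (\<lambda>u. G k (t + u)) = sq_norm (G k)" for k
    by (rule nn_integral_shift[of "\<lambda>x. ennreal ((cmod (G k x))\<^sup>2)"]) measurable
  define \<kappa> where "\<kappa> m = on_Icc (a m) (b m) (D m 0)" for m
  have \<kappa>i: "integrable lborel (\<kappa> m)" if "m \<in> I" for m
    unfolding \<kappa>_def by (rule integrable_on_Icc[OF derivs_on_continuous[OF D[OF that]]])
  have \<kappa>m: "\<kappa> m \<in> borel_measurable borel" if "m \<in> I" for m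
    using borel_measurable_integrable[OF \<kappa>i[OF that]] by simp
  have \<kappa>fin: "sq_norm (\<kappa> m) < \<infinity>" if "m \<in> I" for m
  proof -
    have "bounded (D m 0 ` {a m..b m})"
      by (intro compact_imp_bounded compact_continuous_image derivs_on_continuous[OF D[OF that]]) simp
    then obtain K where "\<forall>x\<in>D m 0 ` {a m..b m}. cmod x \<le> K" by (auto simp only: bounded_iff)
    then have "sq_norm (\<kappa> m) \<le> ennreal ((max 0 K)\<^sup>2 * (b m - a m))"
      unfolding \<kappa>_def using ab[OF that] by (intro sq_norm_on_Icc_le) (auto simp: le_max_iff_disj)
    then show ?thesis by (rule le_less_trans) simp
  qed
  define z where "z k m = (LINT u|lborel. G k (t + u) * ft (\<kappa> m) u)" for k m
  \<comment> \<open>Chosen so that \<open>\<theta> ^ (4 * k)\<close> is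
    \<open>2 powr (2 * k * (\<nu> - r))\<close>, the growth of the error combined with the decay of
    the kernel.\<close>
  define \<theta> :: real where "\<theta> = 2 powr ((\<nu> - real r) / 2)"
  have \<theta>: "0 < \<theta>" "\<theta> < 1" "\<theta>\<^sup>2 = 2 powr (\<nu> - real r)"
  proof -
    show "0 < \<theta>" "\<theta> < 1" using \<nu> by (auto simp: \<theta>_def powr_less_one)
    have "(\<nu> - real r) / 2 + (\<nu> - real r) / 2 = \<nu> - real r" by simp
    then show "\<theta>\<^sup>2 = 2 powr (\<nu> - real r)"
      by (simp only: \<theta>_def power2_eq_square powr_add[symmetric])
  qed
  \<comment> \<open>64 = 16 * 4, where the 4 and the factor \<open>2 powr (4 * \<nu>)\<close> arise
    because the k-th annulus reaches out to the dilate k + 2.\<close>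
  define Y where "Y = 64 * M\<^sup>2 * 2 powr (4 * \<nu>) * (X / \<rho> ^ (2 * r + 1))"
  have Y: "0 \<le> Y" using X \<rho> by (simp add: Y_def)
  have zY: "(\<Sum>m\<in>I. (cmod (z k m))\<^sup>2) \<le> Y * \<theta> ^ (4 * k)" for k
  proof -
    \<comment> \<open>The k-th annulus lies outside the dilate k + 1 and \<open>t\<close> in the
      dilate 0, so they are at distance at least \<open>2 ^ Suc k * \<rho> - \<rho>\<close>, hence
      at least \<open>2 ^ k * \<rho>\<close>.\<close>
    define R where "R = 2 ^ k * \<rho>"
    have R: "0 < R" using \<rho> by (simp add: R_def)
    have "\<rho> \<le> R" using \<rho> by (simp add: R_def)
    have "(\<Sum>m\<in>I. ennreal ((cmod (LINT u|lborel. G k (t + u) * ft (on_Icc (a m) (b m) (D m 0)) u))\<^sup>2))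
      \<le> ennreal (16 * M\<^sup>2 / R ^ (2 * r + 1)) * sq_norm (\<lambda>u. G k (t + u))"
    proof (rule separated_kernel_estimate[OF fin disj ab D van M0 M1 M R])
      show "sq_norm (\<lambda>u. G k (t + u)) < \<infinity>" unfolding Gshift by (rule gn)
      show "G k (t + u) = 0" if "\<bar>u\<bar> < R" for u
      proof -
        have "t + u \<in> Q (Suc k)" using t that \<open>\<rho> \<le> R\<close> by (auto simp: Q_def R_def)
        then show ?thesis by (simp add: G_def)
      qed
      show "G k (t + u) = 0" if "u \<notin> {- (4 * R + \<rho>)..4 * R + \<rho>}" for u
      proof -
        have "t + u \<notin> Q (Suc (Suc k))" using t that by (auto simp: Q_def R_def)
        then show ?thesis by (simp add: G_def)
      qed
    qed measurable
    also have "\<dots> \<le> ennreal (16 * M\<^sup>2 / R ^ (2 * r + 1)) * ennreal (X * 2 ^ Suc (Suc k) * 2 powr (2 * real (Suc (Suc k)) * \<nu>))"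
      unfolding Gshift by (intro mult_left_mono Gn) simp
    also have "\<dots> = ennreal (16 * M\<^sup>2 / R ^ (2 * r + 1) * (X * 2 ^ Suc (Suc k) * 2 powr (2 * real (Suc (Suc k)) * \<nu>)))"
      using R by (simp add: ennreal_mult'[symmetric])
    also have "16 * M\<^sup>2 / R ^ (2 * r + 1) * (X * 2 ^ Suc (Suc k) * 2 powr (2 * real (Suc (Suc k)) * \<nu>)) = Y * \<theta> ^ (4 * k)"
    proof -
      have 1: "R ^ (2 * r + 1) = 2 ^ (k * (2 * r + 1)) * \<rho> ^ (2 * r + 1)"
        unfolding R_def by (simp only: power_mult_distrib power_mult[symmetric])
      have 2: "(2::real) powr (2 * real (Suc (Suc k)) * \<nu>) = 2 powr (4 * \<nu>) * 2 powr (2 * real k * \<nu>)"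
        by (simp add: powr_add[symmetric] algebra_simps)
      have "(2::real) ^ k * 2 powr (2 * real k * \<nu>) / 2 ^ (k * (2 * r + 1)) = 2 powr (real k + 2 * real k * \<nu> - real (k * (2 * r + 1)))"
        by (simp only: powr_add powr_diff powr_realpow zero_less_numeral)
      also have "real k + 2 * real k * \<nu> - real (k * (2 * r + 1)) = real (4 * k) * ((\<nu> - real r) / 2)"
        by (simp add: field_simps)
      also have "2 powr (real (4 * k) * ((\<nu> - real r) / 2)) = \<theta> ^ (4 * k)"
        unfolding \<theta>_def by (rule powr_power[symmetric]) simp
      finally have 3: "(2::real) ^ k * 2 powr (2 * real k * \<nu>) / 2 ^ (k * (2 * r + 1)) = \<theta> ^ (4 * k)" .
      show ?thesis unfolding 1 2 3[symmetric] Y_def by (simp add: mult_ac)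
    qed
    finally have "ennreal (\<Sum>m\<in>I. (cmod (z k m))\<^sup>2) \<le> ennreal (Y * \<theta> ^ (4 * k))"
      by (simp add: z_def \<kappa>_def)
    then show ?thesis using Y \<theta> by (subst (asm) ennreal_le_iff) auto
  qed
  have W: "(\<lambda>N. \<Sum>k<N. z k m) \<longlonglongrightarrow> (LINT \<xi>|lborel. (F \<xi> - ft g \<xi>) * \<kappa> m \<xi> * cis (2 * pi * t * \<xi>))"
    if m: "m \<in> I" for m
  proof -
    note [measurable] = \<kappa>m[OF m]
    define l where "l \<xi> = \<kappa> m \<xi> * cis (2 * pi * t * \<xi>)" for \<xi>
    have li: "integrable lborel l" unfolding l_def by (intro integrable_mult_cis \<kappa>i m) measurable
    have [measurable]: "l \<in> borel_measurable borel" unfolding l_def by measurable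
    have lfin: "sq_norm l < \<infinity>" using \<kappa>fin[OF m] by (simp add: l_def norm_mult)
    \<comment> \<open>Modulating the symbol translates the kernel to the centre
      \<open>t\<close>.\<close>
    have ftl: "ft l y = ft (\<kappa> m) (y - t)" for y
      unfolding ft_def l_def by (intro Bochner_Integration.integral_cong) (auto simp: mult.assoc cis_mult algebra_simps)
    have ftfin: "sq_norm (ft l) < \<infinity>" using Plancherel_le[OF li] lfin by (rule le_less_trans)
    have fi: "integrable lborel (\<lambda>y. f y * ft l y)"
      by (rule integrable_mult_square_integrable[OF _ _ ffin ftfin]) measurable
    have ggi: "integrable lborel (\<lambda>y. g y * ft l y)"
      by (rule integrable_mult_square_integrable[OF _ _ gn(1) ftfin]) measurable
    have ftgfin: "sq_norm (ft g) < \<infinity>" using Plancherel_le[OF gi] gn(1) by (rule le_less_trans)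
    have "(LINT \<xi>|lborel. (F \<xi> - ft g \<xi>) * \<kappa> m \<xi> * cis (2 * pi * t * \<xi>)) = (LINT \<xi>|lborel. F \<xi> * l \<xi> - ft g \<xi> * l \<xi>)"
      by (simp add: l_def algebra_simps)
    also have "\<dots> = (LINT \<xi>|lborel. F \<xi> * l \<xi>) - (LINT \<xi>|lborel. ft g \<xi> * l \<xi>)"
      by (intro Bochner_Integration.integral_diff integrable_mult_square_integrable Ffin ftgfin lfin) measurable
    also have "(LINT \<xi>|lborel. F \<xi> * l \<xi>) = (LINT y|lborel. f y * ft l y)"
      by (rule ft_L2_pairing[OF f ffin F Ffin lim li lfin])
    also have "(LINT \<xi>|lborel. ft g \<xi> * l \<xi>) = (LINT y|lborel. g y * ft l y)"
      by (rule ft_swap[OF gi li, symmetric])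
    also have "(LINT y|lborel. f y * ft l y) - (LINT y|lborel. g y * ft l y) = (LINT y|lborel. f y * ft l y - g y * ft l y)"
      by (rule Bochner_Integration.integral_diff[symmetric, OF fi ggi])
    finally have W1: "(LINT \<xi>|lborel. (F \<xi> - ft g \<xi>) * \<kappa> m \<xi> * cis (2 * pi * t * \<xi>)) = (LINT y|lborel. f y * ft l y - g y * ft l y)" .
    have "has_bochner_integral lborel (\<lambda>u. poly p (of_real (t + u)) * ft (\<kappa> m) u) 0"
      unfolding \<kappa>_def by (rule ft_moment_poly[OF ab[OF m] D[OF m] van[OF m] zero[OF m] p])
    then have "has_bochner_integral lborel (\<lambda>u. poly p (of_real (t + u)) * ft l (t + u)) 0"
      by (simp add: ftl)
    then have pi: "integrable lborel (\<lambda>y. poly p (of_real y) * ft l y)" and p0: "(LINT y|lborel. poly p (of_real y) * ft l y) = 0"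
      using lborel_integrable_real_affine_iff[of 1 "\<lambda>y. poly p (of_real y) * ft l y" t]
        lborel_integral_real_affine[of 1 "\<lambda>y. poly p (of_real y) * ft l y" t]
      by (auto simp: has_bochner_integral_iff)
    \<comment> \<open>A nonzero polynomial is not square integrable, so \<open>f - g - p\<close> is
      paired with the kernel as three separately integrable terms. Their combination is
      \<open>h\<close> times the kernel outside \<open>Q 1\<close>.\<close>
    define h1 where "h1 y = (f y * ft l y - g y * ft l y) - poly p (of_real y) * ft l y" for y
    have h1i: "integrable lborel h1"
      unfolding h1_def by (intro Bochner_Integration.integrable_diff fi ggi pi)
    have W2: "(LINT \<xi>|lborel. (F \<xi> - ft g \<xi>) * \<kappa> m \<xi> * cis (2 * pi * t * \<xi>)) = (LINT y|lborel. h1 y)"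
      unfolding W1 h1_def
      using Bochner_Integration.integral_diff[OF Bochner_Integration.integrable_diff[OF fi ggi] pi] by (simp add: p0)
    have h1: "h1 y = indicator (- Q 1) y * h y * ft l y" for y
      by (auto simp: h1_def g indicator_def h_def algebra_simps)
    \<comment> \<open>\<open>h1\<close> dominates its restrictions to finitely many annuli, so the
      series over \<open>k\<close> converges for each \<open>m\<close>; the quantitative sum over
      \<open>m\<close> is taken on partial sums only.\<close>
    have "(\<lambda>N. LINT y|lborel. H N y * ft l y) \<longlonglongrightarrow> (LINT y|lborel. h1 y)"
    proof (rule integral_dominated_convergence[where w = "\<lambda>y. cmod (h1 y)"])
      show "AE y in lborel. (\<lambda>N. H N y * ft l y) \<longlonglongrightarrow> h1 y"
      proof (intro AE_I2 tendsto_eventually)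
        fix y
        obtain N0 where N0: "\<bar>y - c\<bar> / \<rho> < 2 ^ N0" using real_arch_pow[of 2] by auto
        show "\<forall>\<^sub>F N in sequentially. H N y * ft l y = h1 y"
        proof (rule eventually_sequentiallyI[of N0])
          fix N assume "N0 \<le> N"
          have "\<bar>y - c\<bar> < 2 ^ N0 * \<rho>" using N0 \<rho> by (simp add: divide_less_eq)
          then have "y \<in> Q N0" by (auto simp: Q_def abs_less_iff)
          then have "y \<in> Q (Suc N)" using Qmono[of N0 "Suc N"] \<open>N0 \<le> N\<close> by auto
          then show "H N y * ft l y = h1 y" by (simp add: h1 H_def indicator_def)
        qed
      qed
      show "AE y in lborel. norm (H N y * ft l y) \<le> cmod (h1 y)" for N
        by (auto simp: h1 H_def indicator_def norm_mult)
    qed (use h1i in auto)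
    moreover have "(LINT y|lborel. H N y * ft l y) = (\<Sum>k<N. z k m)" for N
    proof (induction N)
      case 0
      then show ?case by (simp add: H_def)
    next
      case (Suc N)
      have "(LINT y|lborel. H (Suc N) y * ft l y) = (LINT y|lborel. H N y * ft l y + G N y * ft l y)"
        by (simp add: HG distrib_right)
      also have "\<dots> = (LINT y|lborel. H N y * ft l y) + (LINT y|lborel. G N y * ft l y)"
        by (intro Bochner_Integration.integral_add integrable_mult_square_integrable gn ftfin) measurable
      also have "(LINT y|lborel. G N y * ft l y) = z N m"
        unfolding z_def using lborel_integral_real_affine[of 1 "\<lambda>y. G N y * ft l y" t] by (simp add: ftl)
      finally show ?case using Suc by simp
    qed
    ultimately show ?thesis unfolding W2 by simp
  qed
  have "(\<Sum>m\<in>I. (cmod (LINT \<xi>|lborel. (F \<xi> - ft g \<xi>) * \<kappa> m \<xi> * cis (2 * pi * t * \<xi>)))\<^sup>2) \<le> Y / (1 - \<theta>\<^sup>2)\<^sup>2"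
  proof (rule LIMSEQ_le_const2)
    show "(\<lambda>N. \<Sum>m\<in>I. (cmod (\<Sum>k<N. z k m))\<^sup>2) \<longlonglongrightarrow>
        (\<Sum>m\<in>I. (cmod (LINT \<xi>|lborel. (F \<xi> - ft g \<xi>) * \<kappa> m \<xi> * cis (2 * pi * t * \<xi>)))\<^sup>2)"
      by (intro tendsto_sum tendsto_power tendsto_norm W)
    show "\<exists>N. \<forall>n\<ge>N. (\<Sum>m\<in>I. (cmod (\<Sum>k<n. z k m))\<^sup>2) \<le> Y / (1 - \<theta>\<^sup>2)\<^sup>2"
      using weighted_sum_bound[OF \<theta>(1,2) Y zY] by blast
  qed
  then show ?thesis by (simp add: \<kappa>_def Y_def \<theta>(3) mult.commute[of "(1 - 2 powr (\<nu> - real r))\<^sup>2"])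
qed

section \<open>Windowed inverse transforms\<close>

text \<open>Vanishing on a relatively open set passes to the derivatives because one-sided
  derivatives on a closed interval are unique. End points are included; the application is at one of
  them.\<close>

lemma derivs_on_vanish:
  assumes D: "derivs_on a b D" and ab: "a < b" and U: "open U"
    and 0: "\<And>x. x \<in> U \<inter> {a..b} \<Longrightarrow> D 0 x = 0"
  shows "x \<in> U \<inter> {a..b} \<Longrightarrow> D k x = 0"
proof (induction k arbitrary: x)
  case (Suc k)
  obtain d where d: "0 < d" "ball x d \<subseteq> U" using U Suc.prems openE by blast
  have "((\<lambda>_. 0) has_vector_derivative 0) (at x within {a..b})"
    by (rule has_vector_derivative_const)
  then have "(D k has_vector_derivative 0) (at x within {a..b})"
    unfolding has_vector_derivative_def
  proof (rule has_derivative_transform_within[OF _ d(1)])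
    show "0 = D k y" if "y \<in> {a..b}" "dist y x < d" for y
      using Suc.IH[of y] that d(2) by (auto simp: dist_commute mem_ball subset_iff)
  qed (use Suc.prems in auto)
  moreover have "(D k has_vector_derivative D (Suc k) x) (at x within {a..b})"
    using Suc.prems by (intro derivs_onD[OF D]) auto
  ultimately show ?case
    using vector_derivative_unique_within_closed_interval[OF ab, of x "D k"] Suc.prems by auto
qed (use 0 in auto)

text \<open>Leibniz's rule; at \<open>k = 0\<close> the truncated \<open>k - 1\<close> is harmless
  because its coefficient is 0.\<close>

lemma derivs_on_times_linear:
  assumes "derivs_on a b D"
  shows "derivs_on a b (\<lambda>k x. of_real (x - e) * D k x + of_nat k * D (k - 1) x)"
  unfolding derivs_on_def
proof (intro allI ballI)
  fix k x assume x: "x \<in> {a..b}"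
  have 1: "((\<lambda>x. of_real (x - e) * D k x) has_vector_derivative of_real (x - e) * D (Suc k) x + of_real 1 * D k x) (at x within {a..b})"
    by (intro has_vector_derivative_mult derivs_onD[OF assms x] has_vector_derivative_of_real)
       (auto intro!: derivative_eq_intros)
  have 2: "((\<lambda>x. of_nat k * D (k - 1) x) has_vector_derivative of_nat k * D k x) (at x within {a..b})"
  proof (cases k)
    case (Suc j)
    then show ?thesis
      using has_vector_derivative_mult_right[OF derivs_onD[OF assms x, of j], of "of_nat k"] by simp
  qed simp
  show "((\<lambda>x. of_real (x - e) * D k x + of_nat k * D (k - 1) x) has_vector_derivative
      of_real (x - e) * D (Suc k) x + of_nat (Suc k) * D (Suc k - 1) x) (at x within {a..b})"
    using has_vector_derivative_add[OF 1 2] by (simp add: algebra_simps)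
qed

text \<open>In the normalised variable, \<open>e\<close> is the end point to which the frequencies of the operator are
  translated, and \<open>e'\<close> the other one, near which \<open>\<psi>\<close> vanishes.\<close>

lemma symbol_derivs:
  assumes smooth: "smooth_on_unit \<psi>" and e: "{e, e'} = {0, 1::real}"
    and U: "open U" "e' \<in> U" "\<And>x. x \<in> U \<inter> {0..1} \<Longrightarrow> \<psi> x = 0"
  obtains D where "derivs_on 0 1 D" "\<And>x. x \<in> {0..1} \<Longrightarrow> D 0 x = of_real (x - e) ^ r * \<psi> x"
    "\<And>k. k < r \<Longrightarrow> D k 0 = 0 \<and> D k 1 = 0"
proof -
  have ee: "e \<in> {0..1}" "e' \<in> {0..1}" "{0, 1} = {e, e'}" using e by (auto simp: doubleton_eq_iff)
  \<comment> \<open>Each factor \<open>x - e\<close> raises the order of the zero at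
    \<open>e\<close> by one, while at \<open>e'\<close> all derivatives vanish from the
    start.\<close>
  have "\<exists>D. derivs_on 0 1 D \<and> (\<forall>x\<in>{0..1}. D 0 x = of_real (x - e) ^ r * \<psi> x) \<and> (\<forall>k<r. D k e = 0) \<and> (\<forall>k. D k e' = 0)"
  proof (induction r)
    case 0
    obtain D where D: "derivs_on 0 1 D" "\<forall>x\<in>{0..1}. D 0 x = \<psi> x"
      using smooth by (auto simp: smooth_on_unit_def derivs_on_def)
    have "D k e' = 0" for k
      using derivs_on_vanish[OF D(1) zero_less_one U(1), of e' k] D(2) U(2,3) ee by auto
    then show ?case using D by (intro exI[of _ D]) auto
  next
    case (Suc r)
    then obtain D where D: "derivs_on 0 1 D" "\<forall>x\<in>{0..1}. D 0 x = of_real (x - e) ^ r * \<psi> x"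
      "\<forall>k<r. D k e = 0" "\<forall>k. D k e' = 0" by blast
    let ?D = "\<lambda>k x. of_real (x - e) * D k x + of_nat k * D (k - 1) x"
    have "?D k e = 0" if "k < Suc r" for k
      using D(3) that by (cases k) auto
    moreover have "?D k e' = 0" for k using D(4) by simp
    moreover have "\<forall>x\<in>{0..1}. ?D 0 x = of_real (x - e) ^ Suc r * \<psi> x" using D(2) by (simp add: mult.assoc)
    ultimately show ?case using derivs_on_times_linear[OF D(1)] by blast
  qed
  then obtain D where D: "derivs_on 0 1 D" "\<forall>x\<in>{0..1}. D 0 x = of_real (x - e) ^ r * \<psi> x"
      "\<forall>k<r. D k e = 0" "\<forall>k. D k e' = 0" by blast
  have "D k 0 = 0 \<and> D k 1 = 0" if "k < r" for k
  proof -
    have "\<forall>y\<in>{e, e'}. D k y = 0" using D(3,4) that by blast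
    then show ?thesis unfolding ee(3)[symmetric] by blast
  qed
  then show ?thesis using D by (intro that[of D]) auto
qed

text \<open>The powers are normalised so that the r-th derivative is free of the length and the next
  one costs \<open>1 / (b - a)\<close>. The function itself carries \<open>(b - a) ^ r\<close>, as a
  symbol containing the r-th power of the unscaled frequency requires.\<close>

lemma derivs_on_rescale:
  assumes D: "derivs_on 0 1 D" and ab: "a < b"
  shows "derivs_on a b (\<lambda>k \<xi>. w * of_real ((b - a) ^ r / (b - a) ^ k) * D k ((\<xi> - a) / (b - a)))"
  unfolding derivs_on_def
proof (intro allI ballI)
  fix k \<xi> assume \<xi>: "\<xi> \<in> {a..b}"
  let ?f = "\<lambda>\<xi>. (\<xi> - a) / (b - a)"
  have "?f ` {a..b} \<subseteq> {0..1}" using ab by auto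
  then have "(D k has_vector_derivative D (Suc k) (?f \<xi>)) (at (?f \<xi>) within ?f ` {a..b})"
    using \<xi> ab by (intro has_vector_derivative_within_subset[OF derivs_onD[OF D]]) auto
  moreover have "(?f has_vector_derivative 1 / (b - a)) (at \<xi> within {a..b})"
    unfolding has_real_derivative_iff_has_vector_derivative[symmetric]
    by (rule DERIV_cdivide) (auto intro!: derivative_eq_intros)
  ultimately have "((D k \<circ> ?f) has_vector_derivative (1 / (b - a)) *\<^sub>R D (Suc k) (?f \<xi>)) (at \<xi> within {a..b})"
    by (rule vector_diff_chain_within[rotated])
  then have "((\<lambda>\<xi>. w * of_real ((b - a) ^ r / (b - a) ^ k) * D k (?f \<xi>)) has_vector_derivative
      w * of_real ((b - a) ^ r / (b - a) ^ k) * ((1 / (b - a)) *\<^sub>R D (Suc k) (?f \<xi>))) (at \<xi> within {a..b})"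
    by (intro has_vector_derivative_mult_right) (simp add: o_def)
  then show "((\<lambda>\<xi>. w * of_real ((b - a) ^ r / (b - a) ^ k) * D k (?f \<xi>)) has_vector_derivative
      w * of_real ((b - a) ^ r / (b - a) ^ Suc k) * D (Suc k) (?f \<xi>)) (at \<xi> within {a..b})"
    using ab by (simp add: scaleR_conv_of_real mult_ac)
qed

lemma derivs_on_bounded:
  assumes "derivs_on a b D"
  obtains K where "0 \<le> K" "\<And>x. x \<in> {a..b} \<Longrightarrow> cmod (D k x) \<le> K"
proof -
  have "bounded (D k ` {a..b})"
    by (intro compact_imp_bounded compact_continuous_image derivs_on_continuous[OF assms]) simp
  then obtain K where "\<forall>x\<in>D k ` {a..b}. cmod x \<le> K" by (auto simp only: bounded_iff)
  then show ?thesis by (intro that[of "max 0 K"]) (auto simp: le_max_iff_disj)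
qed

text \<open>Common form of the components of \<open>S1\<close> and \<open>S2\<close>: here
  \<open>e\<close> is the frequency itself, \<open>a\<close> or \<open>b\<close>, and
  \<open>F\<close> is a Borel representative of the transform.\<close>

definition windowed_inverse :: "(real \<Rightarrow> complex) \<Rightarrow> real \<Rightarrow> real \<Rightarrow> real \<Rightarrow> (real \<Rightarrow> complex) \<Rightarrow> real \<Rightarrow> complex" where
  "windowed_inverse \<psi> a b e F x = cis (- (2 * pi * e * x)) *
     (LINT \<xi>|lborel. F \<xi> * on_Icc a b (\<lambda>\<xi>. \<psi> ((\<xi> - a) / (b - a))) \<xi> * cis (2 * pi * x * \<xi>))"

lemma smooth_on_unit_continuous:
  assumes "smooth_on_unit \<psi>" shows "continuous_on {0..1} \<psi>"
proof -
  obtain D where D: "derivs_on 0 1 D" "\<forall>x\<in>{0..1}. D 0 x = \<psi> x"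
    using assms by (auto simp: smooth_on_unit_def derivs_on_def)
  show ?thesis by (rule continuous_on_eq[OF derivs_on_continuous[OF D(1), of 0]]) (use D(2) in auto)
qed

lemma measurable_window:
  assumes \<psi>: "continuous_on {0..1} \<psi>" and ab: "a < b"
  shows "on_Icc a b (\<lambda>\<xi>. \<psi> ((\<xi> - a) / (b - a))) \<in> borel_measurable borel"
proof (rule measurable_on_Icc, rule continuous_on_compose2[OF \<psi>])
  show "continuous_on {a..b} (\<lambda>\<xi>. (\<xi> - a) / (b - a))"
    using ab by (intro continuous_intros) auto
qed (use ab in auto)

lemma measurable_windowed_inverse:
  assumes "continuous_on {0..1} \<psi>" and "a < b" and [measurable]: "F \<in> borel_measurable borel"
  shows "windowed_inverse \<psi> a b e F \<in> borel_measurable borel"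
proof -
  define \<eta> where "\<eta> = on_Icc a b (\<lambda>\<xi>. \<psi> ((\<xi> - a) / (b - a)))"
  have [measurable]: "\<eta> \<in> borel_measurable borel"
    unfolding \<eta>_def by (rule measurable_window[OF assms(1,2)])
  have "windowed_inverse \<psi> a b e F = (\<lambda>x. cis (- (2 * pi * e * x)) * (LINT \<xi>|lborel. F \<xi> * \<eta> \<xi> * cis (2 * pi * x * \<xi>)))"
    by (simp add: fun_eq_iff windowed_inverse_def \<eta>_def)
  also have "\<dots> \<in> borel_measurable borel" by measurable
  finally show ?thesis .
qed

text \<open>One choice of polynomials serves all finite subfamilies, which is what monotone
  convergence needs for the passage to \<open>J\<close>.\<close>

abbreviation approximable :: "nat \<Rightarrow> nat set \<Rightarrow> real \<Rightarrow> real \<Rightarrow> (nat \<Rightarrow> real \<Rightarrow> complex) \<Rightarrow> real \<Rightarrow> bool" where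
  "approximable r J c \<rho> G K \<equiv> \<exists>p. (\<forall>m\<in>J. degree (p m) < r) \<and> (\<forall>I. finite I \<longrightarrow> I \<subseteq> J \<longrightarrow>
     (\<Sum>m\<in>I. sq_norm_near c \<rho> (minus_poly (G m) (p m))) \<le> ennreal K)"

text \<open>The operator is split along f = g + (f - g), where \<open>g\<close> is the error
  \<open>f - P 0\<close> cut off to the doubled interval. The part \<open>T\<close> coming from
  \<open>g\<close> is bounded in norm outright and approximated by 0; the part \<open>v\<close> is
  approximated by its Taylor polynomial, with an error governed by the far field.\<close>

proposition windowed_approximation:
  fixes n r :: nat and s e e' :: real
  assumes nr: "n < r" and sr: "s < real r"
    and smooth: "smooth_on_unit \<psi>" and e: "{e, e'} = {0, 1}"
    and U: "open U" "e' \<in> U" "\<And>x. x \<in> U \<inter> {0..1} \<Longrightarrow> \<psi> x = 0"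
  obtains C where "0 < C"
    "\<And>J a b f F c \<rho> B P. (\<And>m. m \<in> J \<Longrightarrow> a m < b m) \<Longrightarrow> disjoint_family_on (\<lambda>m. {a m..b m}) J \<Longrightarrow>
      (\<And>m. m \<in> J \<Longrightarrow> 0 \<notin> {a m<..<b m}) \<Longrightarrow>
      f \<in> borel_measurable borel \<Longrightarrow> sq_norm f < \<infinity> \<Longrightarrow>
      F \<in> borel_measurable borel \<Longrightarrow> sq_norm F < \<infinity> \<Longrightarrow>
      ft_limit f F \<Longrightarrow>
      0 < \<rho> \<Longrightarrow> 0 \<le> B \<Longrightarrow> (\<And>k. degree (P k) \<le> n) \<Longrightarrow>
      (\<And>k. sq_norm_near c (2 ^ k * \<rho>) (minus_poly f (P k))
         \<le> ennreal (B\<^sup>2 * (2 ^ k * (2 * \<rho>)) powr (2 * s + 1))) \<Longrightarrow>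
      approximable r J c \<rho> (\<lambda>m. windowed_inverse \<psi> (a m) (b m) (a m + e * (b m - a m)) F) (C * B\<^sup>2 * (2 * \<rho>) powr (2 * s + 1))"
proof -
  \<comment> \<open>The midpoint of the gap that the hypotheses leave between max(s, n) and
    r.\<close>
  define \<nu> where "\<nu> = (max s (real n) + real r) / 2"
  have \<nu>: "s < \<nu>" "real n < \<nu>" "\<nu> < real r" using nr sr by (auto simp: \<nu>_def max_def)
  obtain C1 where C1: "0 < C1" and growth: "\<And>f P c \<rho> B k. f \<in> borel_measurable borel \<Longrightarrow> 0 < \<rho> \<Longrightarrow> 0 \<le> B \<Longrightarrow> (\<And>k. degree (P k) \<le> n) \<Longrightarrow>
      (\<And>k. sq_norm_near c (2 ^ k * \<rho>) (minus_poly f (P k))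
         \<le> ennreal (B\<^sup>2 * (2 ^ k * (2 * \<rho>)) powr (2 * s + 1))) \<Longrightarrow>
      sq_norm_near c (2 ^ k * \<rho>) (minus_poly f (P 0))
         \<le> ennreal (C1 * B\<^sup>2 * (2 * \<rho>) powr (2 * s + 1) * 2 ^ k * 2 powr (2 * real k * \<nu>))"
    using polynomial_approximation_growth[OF \<nu>(1,2)] by blast
  obtain D where D: "derivs_on 0 1 D" and D0: "\<And>x. x \<in> {0..1} \<Longrightarrow> D 0 x = of_real (x - e) ^ r * \<psi> x"
    and van: "\<And>k. k < r \<Longrightarrow> D k 0 = 0 \<and> D k 1 = 0"
    using symbol_derivs[OF smooth e U] by blast
  obtain D\<psi> where D\<psi>: "derivs_on 0 1 D\<psi>" "\<forall>x\<in>{0..1}. D\<psi> 0 x = \<psi> x"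
    using smooth by (auto simp: smooth_on_unit_def derivs_on_def)
  obtain K0 where K0: "0 \<le> K0" "\<And>x. x \<in> {0..1} \<Longrightarrow> cmod (D r x) \<le> K0"
    using derivs_on_bounded[OF D] by blast
  obtain K1 where K1: "0 \<le> K1" "\<And>x. x \<in> {0..1} \<Longrightarrow> cmod (D (Suc r) x) \<le> K1"
    using derivs_on_bounded[OF D] by blast
  obtain K\<psi> where K\<psi>: "0 \<le> K\<psi>" "\<And>x. x \<in> {0..1} \<Longrightarrow> cmod (\<psi> x) \<le> K\<psi>"
    using derivs_on_bounded[OF D\<psi>(1), of 0] D\<psi>(2) by metis
  have cont\<psi>: "continuous_on {0..1} \<psi>"
    by (rule smooth_on_unit_continuous[OF smooth])
  define M where "M = (2 * pi) ^ r * max K0 K1"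
  have M: "0 \<le> M" using K0 by (simp add: M_def)
  define A where "A = 64 * M\<^sup>2 * 2 powr (4 * \<nu>) / (1 - 2 powr (\<nu> - real r))\<^sup>2"
  have A: "0 \<le> A" by (simp add: A_def)
  \<comment> \<open>The bracket adds the near field, the far field and a 1 that keeps
    \<open>C\<close> positive when both constants vanish.\<close>
  define C where "C = C1 * (2 * K\<psi>\<^sup>2 * (2 * 2 powr (2 * \<nu>)) + 2 * (2 ^ (2 * r + 1) * A) + 1)"
  have C0: "0 < C" using C1 A by (auto simp: C_def intro!: mult_pos_pos add_nonneg_pos)
  have est: "approximable r J c \<rho> (\<lambda>m. windowed_inverse \<psi> (a m) (b m) (a m + e * (b m - a m)) F) (C * B\<^sup>2 * (2 * \<rho>) powr (2 * s + 1))"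
    if ab: "\<And>m. m \<in> J \<Longrightarrow> a m < b m" and disj: "disjoint_family_on (\<lambda>m. {a m..b m}) J"
      and zero: "\<And>m. m \<in> J \<Longrightarrow> 0 \<notin> {a m<..<b m}"
      and f[measurable]: "f \<in> borel_measurable borel" and ffin: "sq_norm f < \<infinity>"
      and F[measurable]: "F \<in> borel_measurable borel" and Ffin: "sq_norm F < \<infinity>"
      and lim: "ft_limit f F"
      and \<rho>: "0 < \<rho>" and B: "0 \<le> B" and deg: "\<And>k. degree (P k) \<le> n"
      and P: "\<And>k. sq_norm_near c (2 ^ k * \<rho>) (minus_poly f (P k))
         \<le> ennreal (B\<^sup>2 * (2 ^ k * (2 * \<rho>)) powr (2 * s + 1))"
    for J :: "nat set" and a b f F c \<rho> B P
  proof -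
    define X where "X = C1 * B\<^sup>2 * (2 * \<rho>) powr (2 * s + 1)"
    have X: "0 \<le> X" using C1 by (simp add: X_def)
    have gr: "sq_norm_near c (2 ^ k * \<rho>) (minus_poly f (P 0))
        \<le> ennreal (X * 2 ^ k * 2 powr (2 * real k * \<nu>))" for k
      unfolding X_def by (rule growth[OF f \<rho> B deg P])
    define g where "g = on_Icc (c - 2 * \<rho>) (c + 2 * \<rho>) (minus_poly f (P 0))"
    have gm[measurable]: "g \<in> borel_measurable borel" unfolding g_def by measurable
    have gn: "sq_norm g \<le> ennreal (X * (2 * 2 powr (2 * \<nu>)))"
    proof -
      have "sq_norm g = sq_norm_near c (2 ^ 1 * \<rho>) (minus_poly f (P 0))"
        unfolding g_def by (intro nn_integral_cong) (auto simp: indicator_def)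
      also have "\<dots> \<le> ennreal (X * 2 ^ 1 * 2 powr (2 * real 1 * \<nu>))" by (rule gr)
      finally show ?thesis by (simp add: mult.assoc)
    qed
    have gfin: "sq_norm g < \<infinity>" using gn by (rule le_less_trans) simp
    have gi: "integrable lborel g"
      by (rule integrable_compact_support[OF gm gfin, of "c - 2 * \<rho>" "c + 2 * \<rho>"]) (auto simp: g_def)
    have ftgfin: "sq_norm (ft g) < \<infinity>" using Plancherel_le[OF gi] gfin by (rule le_less_trans)
    define \<epsilon> where "\<epsilon> m = a m + e * (b m - a m)" for m
    define \<eta> where "\<eta> m = on_Icc (a m) (b m) (\<lambda>\<xi>. \<psi> ((\<xi> - a m) / (b m - a m)))" for m
    have unit: "(\<xi> - a m) / (b m - a m) \<in> {0..1}" if "m \<in> J" "\<xi> \<in> {a m..b m}" for m \<xi>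
      using that ab[OF that(1)] by auto
    have \<eta>m: "\<eta> m \<in> borel_measurable borel" if m: "m \<in> J" for m
      unfolding \<eta>_def by (rule measurable_window[OF cont\<psi> ab[OF m]])
    have \<eta>b: "cmod (\<eta> m \<xi>) \<le> K\<psi>" if m: "m \<in> J" for m \<xi>
      using unit[OF m, of \<xi>] K\<psi> by (auto simp: \<eta>_def indicator_def)
    have \<eta>0: "\<eta> m \<xi> = 0" if "\<xi> \<notin> {a m..b m}" for m \<xi> using that by (simp add: \<eta>_def)
    have \<eta>fin: "sq_norm (\<eta> m) < \<infinity>" if m: "m \<in> J" for m
    proof -
      have "sq_norm (\<eta> m) \<le> ennreal (K\<psi>\<^sup>2 * (b m - a m))"
        unfolding \<eta>_def using ab[OF m] K\<psi> unit[OF m] by (intro sq_norm_on_Icc_le) auto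
      then show ?thesis by (rule le_less_trans) simp
    qed
    have Fi: "integrable lborel (\<lambda>\<xi>. F \<xi> * \<eta> m \<xi>)" if m: "m \<in> J" for m
      by (rule integrable_mult_square_integrable[OF F \<eta>m[OF m] Ffin \<eta>fin[OF m]])
    have ftgi: "integrable lborel (\<lambda>\<xi>. ft g \<xi> * \<eta> m \<xi>)" if m: "m \<in> J" for m
      by (rule integrable_mult_square_integrable[OF measurable_ft[OF gm] \<eta>m[OF m] ftgfin \<eta>fin[OF m]])
    define \<Phi> where "\<Phi> m \<xi> = (F \<xi> - ft g \<xi>) * \<eta> m \<xi>" for m \<xi>
    have \<Phi>i: "integrable lborel (\<Phi> m)" if m: "m \<in> J" for m
      unfolding \<Phi>_def left_diff_distrib by (rule Bochner_Integration.integrable_diff[OF Fi[OF m] ftgi[OF m]])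
    define v where "v m x = (LINT \<xi>|lborel. \<Phi> m \<xi> * cis (2 * pi * x * (\<xi> - \<epsilon> m)))" for m x
    define w where "w m t = (LINT \<xi>|lborel. \<Phi> m \<xi> * (2 * pi * \<i> * of_real (\<xi> - \<epsilon> m)) ^ r * cis (2 * pi * t * (\<xi> - \<epsilon> m)))" for m t
    define T where "T m x = (LINT \<xi>|lborel. ft g \<xi> * \<eta> m \<xi> * cis (2 * pi * x * \<xi>))" for m x
    have "\<forall>m\<in>J. \<exists>p. degree p < r \<and> sq_norm_near c \<rho> (minus_poly (v m) p)
        \<le> ennreal ((2 * \<rho>) ^ (2 * r)) * sq_norm_near c \<rho> (w m)"
    proof
      fix m assume m: "m \<in> J"
      have "c + \<rho> - (c - \<rho>) = 2 * \<rho>" by simp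
      then show "\<exists>p. degree p < r \<and> sq_norm_near c \<rho> (minus_poly (v m) p)
        \<le> ennreal ((2 * \<rho>) ^ (2 * r)) * sq_norm_near c \<rho> (w m)"
        using band_limited_polynomial_approximation[of r "c - \<rho>" "c + \<rho>" "\<Phi> m" "a m" "b m" "\<epsilon> m"] nr \<rho> \<Phi>i[OF m] \<eta>0
        unfolding v_def w_def by (simp add: \<Phi>_def)
    qed
    from bchoice[OF this] obtain p where
      pw: "\<forall>m\<in>J. degree (p m) < r \<and> sq_norm_near c \<rho> (minus_poly (v m) (p m))
        \<le> ennreal ((2 * \<rho>) ^ (2 * r)) * sq_norm_near c \<rho> (w m)" ..
    have p: "degree (p m) < r" "sq_norm_near c \<rho> (minus_poly (v m) (p m))
        \<le> ennreal ((2 * \<rho>) ^ (2 * r)) * sq_norm_near c \<rho> (w m)" if "m \<in> J" for m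
      using bspec[OF pw that] by (rule conjunct1, rule conjunct2)
    have [measurable]: "\<Phi> m \<in> borel_measurable borel" "v m \<in> borel_measurable borel"
      "w m \<in> borel_measurable borel" "T m \<in> borel_measurable borel"
      "windowed_inverse \<psi> (a m) (b m) (\<epsilon> m) F \<in> borel_measurable borel" if "m \<in> J" for m
    proof -
      note [measurable] = \<eta>m[OF that]
      show "\<Phi> m \<in> borel_measurable borel" unfolding \<Phi>_def by measurable
      note [measurable] = this
      show "v m \<in> borel_measurable borel" "w m \<in> borel_measurable borel" "T m \<in> borel_measurable borel"
        unfolding v_def w_def T_def by measurable
      show "windowed_inverse \<psi> (a m) (b m) (\<epsilon> m) F \<in> borel_measurable borel"
        by (rule measurable_windowed_inverse[OF cont\<psi> ab[OF that] F])
    qed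
    \<comment> \<open>The phase in front of \<open>T\<close> has modulus 1 and drops out of the
      norms.\<close>
    have split: "windowed_inverse \<psi> (a m) (b m) (\<epsilon> m) F x = v m x + cis (- (2 * pi * \<epsilon> m * x)) * T m x" if m: "m \<in> J" for m x
    proof -
      have "v m x = (LINT \<xi>|lborel. cis (- (2 * pi * \<epsilon> m * x)) * (F \<xi> * \<eta> m \<xi> * cis (2 * pi * x * \<xi>) - ft g \<xi> * \<eta> m \<xi> * cis (2 * pi * x * \<xi>)))"
        unfolding v_def
      proof (rule Bochner_Integration.integral_cong[OF refl])
        fix \<xi>
        have "cis (2 * pi * x * (\<xi> - \<epsilon> m)) = cis (- (2 * pi * \<epsilon> m * x)) * cis (2 * pi * x * \<xi>)"
          by (simp add: cis_mult algebra_simps)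
        then show "\<Phi> m \<xi> * cis (2 * pi * x * (\<xi> - \<epsilon> m)) = cis (- (2 * pi * \<epsilon> m * x)) * (F \<xi> * \<eta> m \<xi> * cis (2 * pi * x * \<xi>) - ft g \<xi> * \<eta> m \<xi> * cis (2 * pi * x * \<xi>))"
          by (simp add: \<Phi>_def algebra_simps)
      qed
      also have "\<dots> = cis (- (2 * pi * \<epsilon> m * x)) * ((LINT \<xi>|lborel. F \<xi> * \<eta> m \<xi> * cis (2 * pi * x * \<xi>)) - T m x)"
        unfolding T_def
        by (subst integral_mult_right_zero, subst Bochner_Integration.integral_diff)
           (auto intro!: integrable_mult_cis Fi ftgi m)
      finally show ?thesis by (simp add: windowed_inverse_def \<eta>_def right_diff_distrib)
    qed
    have "(\<Sum>m\<in>I. sq_norm_near c \<rho> (minus_poly (windowed_inverse \<psi> (a m) (b m) (\<epsilon> m) F) (p m)))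
          \<le> ennreal (C * B\<^sup>2 * (2 * \<rho>) powr (2 * s + 1))" if fin: "finite I" and IJ: "I \<subseteq> J" for I
    proof -
      have J: "m \<in> J" if "m \<in> I" for m using that IJ by blast
      have disjI: "disjoint_family_on (\<lambda>m. {a m..b m}) I"
        using disjoint_family_on_mono[OF IJ disj] .
      have near: "(\<Sum>m\<in>I. sq_norm (T m)) \<le> ennreal (K\<psi>\<^sup>2 * (X * (2 * 2 powr (2 * \<nu>))))"
      proof -
        have "(\<Sum>m\<in>I. sq_norm (T m)) \<le> ennreal (K\<psi>\<^sup>2) * sq_norm g"
          unfolding T_def by (rule sum_sq_norm_multiplier[OF gi gfin fin disjI]) (use J \<eta>m \<eta>0 \<eta>b in auto)
        also have "\<dots> \<le> ennreal (K\<psi>\<^sup>2) * ennreal (X * (2 * 2 powr (2 * \<nu>)))"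
          by (intro mult_left_mono gn) simp
        finally show ?thesis by (simp add: ennreal_mult'[symmetric])
      qed
      have wt: "(\<Sum>m\<in>I. (cmod (w m t))\<^sup>2) \<le> A * (X / \<rho> ^ (2 * r + 1))" if t: "t \<in> {c - \<rho>..c + \<rho>}" for t
      proof -
        \<comment> \<open>The derivatives of the symbol of the r-th derivative;
          \<open>\<epsilon> m\<close> is the frequency that corresponds to \<open>e\<close> in the
          normalised variable.\<close>
        define E where "E m k \<xi> = (2 * pi * \<i>) ^ r * of_real ((b m - a m) ^ r / (b m - a m) ^ k) * D k ((\<xi> - a m) / (b m - a m))" for m k \<xi>
        have Er: "cmod (E m r \<xi>) \<le> M" "cmod (E m (Suc r) \<xi>) \<le> M / (b m - a m)" if m: "m \<in> I" and \<xi>: "\<xi> \<in> {a m..b m}" for m \<xi>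
        proof -
          have l: "0 < b m - a m" using ab[OF J[OF m]] by simp
          have "cmod (E m r \<xi>) = (2 * pi) ^ r * cmod (D r ((\<xi> - a m) / (b m - a m)))"
            using l by (simp add: E_def norm_mult norm_power)
          also have "\<dots> \<le> M" unfolding M_def
            using K0(2)[OF unit[OF J[OF m] \<xi>]] by (intro mult_left_mono) auto
          finally show "cmod (E m r \<xi>) \<le> M" .
          have "cmod (E m (Suc r) \<xi>) = (2 * pi) ^ r * cmod (D (Suc r) ((\<xi> - a m) / (b m - a m))) / (b m - a m)"
            using l by (simp add: E_def norm_mult norm_power norm_divide flip: of_real_diff)
          also have "\<dots> \<le> M / (b m - a m)" unfolding M_def
            using K1(2)[OF unit[OF J[OF m] \<xi>]] l by (intro divide_right_mono mult_left_mono) auto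
          finally show "cmod (E m (Suc r) \<xi>) \<le> M / (b m - a m)" .
        qed
        have E0: "on_Icc (a m) (b m) (E m 0) \<xi> = (2 * pi * \<i> * of_real (\<xi> - \<epsilon> m)) ^ r * \<eta> m \<xi>" if m: "m \<in> I" for m \<xi>
        proof (cases "\<xi> \<in> {a m..b m}")
          case True
          have l: "0 < b m - a m" using ab[OF J[OF m]] by simp
          have "(b m - a m) * ((\<xi> - a m) / (b m - a m) - e) = \<xi> - \<epsilon> m"
          proof -
            have "z * (y / z - e) = y - e * z" if "z \<noteq> 0" for y z :: real
              using that by (simp add: right_diff_distrib)
            from this[of "b m - a m" "\<xi> - a m"] show ?thesis using l by (simp add: \<epsilon>_def)
          qed
          then have "of_real ((b m - a m) ^ r) * of_real ((\<xi> - a m) / (b m - a m) - e) ^ r = (of_real (\<xi> - \<epsilon> m) :: complex) ^ r"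
            by (metis of_real_mult of_real_power power_mult_distrib)
          then show ?thesis
            using True D0[OF unit[OF J[OF m] True]] by (simp add: E_def \<eta>_def power_mult_distrib mult.assoc[symmetric])
        qed (simp add: \<eta>0)
        have phase: "w m t = cis (- (2 * pi * \<epsilon> m * t)) * (LINT \<xi>|lborel. (F \<xi> - ft g \<xi>) * on_Icc (a m) (b m) (E m 0) \<xi> * cis (2 * pi * t * \<xi>))"
          if m: "m \<in> I" for m
        proof -
          have "cis (2 * pi * t * (\<xi> - \<epsilon> m)) = cis (- (2 * pi * \<epsilon> m * t)) * cis (2 * pi * t * \<xi>)" for \<xi>
            by (simp add: cis_mult algebra_simps)
          then show ?thesis
            unfolding w_def E0[OF m] \<Phi>_def by (subst integral_mult_right_zero[symmetric]) (simp add: mult_ac)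
        qed
        have "(\<Sum>m\<in>I. (cmod (w m t))\<^sup>2) = (\<Sum>m\<in>I. (cmod (LINT \<xi>|lborel. (F \<xi> - ft g \<xi>) * on_Icc (a m) (b m) (E m 0) \<xi> * cis (2 * pi * t * \<xi>)))\<^sup>2)"
          by (intro sum.cong refl) (simp add: phase norm_mult)
        also have "\<dots> \<le> A * (X / \<rho> ^ (2 * r + 1))"
          unfolding A_def
        proof (rule far_field_estimate[OF fin disjI ab[OF J] _ _ Er M zero[OF J] f ffin F Ffin lim \<rho> le_less_trans[OF deg nr] X \<nu>(3) gr t g_def])
          show "derivs_on (a m) (b m) (E m)" if "m \<in> I" for m
            unfolding E_def by (rule derivs_on_rescale[OF D ab[OF J[OF that]]])
          show "E m k (a m) = 0 \<and> E m k (b m) = 0" if "m \<in> I" "k < r" for m k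
            using van[OF that(2)] ab[OF J[OF that(1)]] by (simp add: E_def)
        qed
        finally show ?thesis .
      qed
      have "(\<Sum>m\<in>I. sq_norm_near c \<rho> (w m)) = (\<integral>\<^sup>+t. (\<Sum>m\<in>I. ennreal ((cmod (w m t))\<^sup>2) * indicator {c - \<rho>..c + \<rho>} t) \<partial>lborel)"
        by (rule nn_integral_sum[symmetric]) (use J in measurable)
      also have "\<dots> \<le> (\<integral>\<^sup>+t. ennreal (A * (X / \<rho> ^ (2 * r + 1))) * indicator {c - \<rho>..c + \<rho>} t \<partial>lborel)"
        using wt by (intro nn_integral_mono) (auto simp: indicator_def intro!: ennreal_leI)
      also have "\<dots> = ennreal (A * (X / \<rho> ^ (2 * r + 1))) * ennreal (2 * \<rho>)"
        using \<rho> by (subst nn_integral_cmult) auto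
      also have "\<dots> = ennreal (A * (X / \<rho> ^ (2 * r + 1)) * (2 * \<rho>))"
        using \<rho> by (intro ennreal_mult''[symmetric]) simp
      finally have far0: "(\<Sum>m\<in>I. sq_norm_near c \<rho> (w m)) \<le> ennreal (A * (X / \<rho> ^ (2 * r + 1)) * (2 * \<rho>))" .
      have "(\<Sum>m\<in>I. sq_norm_near c \<rho> (minus_poly (v m) (p m)))
          \<le> (\<Sum>m\<in>I. ennreal ((2 * \<rho>) ^ (2 * r)) * sq_norm_near c \<rho> (w m))"
        by (intro sum_mono p J)
      also have "\<dots> = ennreal ((2 * \<rho>) ^ (2 * r)) * (\<Sum>m\<in>I. sq_norm_near c \<rho> (w m))"
        by (rule sum_distrib_left[symmetric])
      also have "\<dots> \<le> ennreal ((2 * \<rho>) ^ (2 * r)) * ennreal (A * (X / \<rho> ^ (2 * r + 1)) * (2 * \<rho>))"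
        by (intro mult_left_mono far0) simp
      also have "\<dots> = ennreal ((2 * \<rho>) ^ (2 * r) * (A * (X / \<rho> ^ (2 * r + 1)) * (2 * \<rho>)))"
        using \<rho> by (simp only: ennreal_mult'[symmetric] zero_le_power mult_nonneg_nonneg)
      \<comment> \<open>All powers of \<open>\<rho>\<close> cancel: \<open>2 * r\<close> from
        Taylor's formula and one from the length of the interval, against \<open>2 * r + 1\<close>
        from the kernels.\<close>
      also have "(2 * \<rho>) ^ (2 * r) * (A * (X / \<rho> ^ (2 * r + 1)) * (2 * \<rho>)) = 2 ^ (2 * r + 1) * A * X"
        using \<rho> by (simp add: power_mult_distrib field_simps)
      finally have far: "(\<Sum>m\<in>I. sq_norm_near c \<rho> (minus_poly (v m) (p m))) \<le> ennreal (2 ^ (2 * r + 1) * A * X)" .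
      have "(\<Sum>m\<in>I. sq_norm_near c \<rho> (minus_poly (windowed_inverse \<psi> (a m) (b m) (\<epsilon> m) F) (p m)))
         \<le> (\<Sum>m\<in>I. 2 * sq_norm (T m) + 2 * sq_norm_near c \<rho> (minus_poly (v m) (p m)))"
      proof (rule sum_mono)
        fix m assume m: "m \<in> I"
        note J[OF m, measurable]
        have "sq_norm_near c \<rho> (minus_poly (windowed_inverse \<psi> (a m) (b m) (\<epsilon> m) F) (p m))
          \<le> 2 * sq_norm_near c \<rho> (\<lambda>x. windowed_inverse \<psi> (a m) (b m) (\<epsilon> m) F x - v m x)
            + 2 * sq_norm_near c \<rho> (minus_poly (v m) (p m))"
          by (rule sq_norm_on_triangle_le) (use J[OF m] in measurable)
        also have "sq_norm_near c \<rho> (\<lambda>x. windowed_inverse \<psi> (a m) (b m) (\<epsilon> m) F x - v m x) \<le> sq_norm (T m)"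
          by (intro nn_integral_mono) (auto simp: split[OF J[OF m]] norm_mult indicator_def)
        finally show "sq_norm_near c \<rho> (minus_poly (windowed_inverse \<psi> (a m) (b m) (\<epsilon> m) F) (p m))
          \<le> 2 * sq_norm (T m) + 2 * sq_norm_near c \<rho> (minus_poly (v m) (p m))"
          by (simp add: add_right_mono mult_left_mono)
      qed
      also have "\<dots> = 2 * (\<Sum>m\<in>I. sq_norm (T m)) + 2 * (\<Sum>m\<in>I. sq_norm_near c \<rho> (minus_poly (v m) (p m)))"
        by (simp only: sum.distrib sum_distrib_left)
      also have "\<dots> \<le> 2 * ennreal (K\<psi>\<^sup>2 * (X * (2 * 2 powr (2 * \<nu>)))) + 2 * ennreal (2 ^ (2 * r + 1) * A * X)"
        by (intro add_mono mult_left_mono near far) auto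
      also have "\<dots> = ennreal (2 * (K\<psi>\<^sup>2 * (X * (2 * 2 powr (2 * \<nu>)))) + 2 * (2 ^ (2 * r + 1) * A * X))"
        using X A by (simp add: ennreal_mult'[symmetric] ennreal_plus[symmetric] flip: ennreal_numeral del: ennreal_plus)
      also have "\<dots> \<le> ennreal (C * B\<^sup>2 * (2 * \<rho>) powr (2 * s + 1))"
      proof (rule ennreal_leI)
        have "C * B\<^sup>2 * (2 * \<rho>) powr (2 * s + 1) = (2 * K\<psi>\<^sup>2 * (2 * 2 powr (2 * \<nu>)) + 2 * (2 ^ (2 * r + 1) * A) + 1) * X"
          by (simp add: C_def X_def mult_ac)
        then show "2 * (K\<psi>\<^sup>2 * (X * (2 * 2 powr (2 * \<nu>)))) + 2 * (2 ^ (2 * r + 1) * A * X) \<le> C * B\<^sup>2 * (2 * \<rho>) powr (2 * s + 1)"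
          using X by (simp add: algebra_simps)
      qed
      finally show ?thesis .
    qed
    then show ?thesis unfolding \<epsilon>_def using p(1) by blast
  qed
  show ?thesis
    by (rule that[OF C0]) (fact est)
qed

section \<open>Maximal functions\<close>

lemma ennreal_powr_half_two: "ennreal_powr (ennreal_powr T (1/2)) 2 = T"
proof (cases T)
  case (real t)
  then show ?thesis by (simp add: ennreal_powr_def powr_powr)
qed (simp add: ennreal_powr_def)

lemma l2_dist_powr2: "ennreal_powr (l2_dist J u v) 2 = (\<Sum>\<^sub>\<infinity>m\<in>J. ennreal ((cmod (u m - v m))\<^sup>2))"
  unfolding l2_dist_def by (rule ennreal_powr_half_two)

text \<open>Squaring the mean and multiplying by the length turns \<open>B\<close> into
  \<open>(B * L powr s)^2 * L\<close>. An infinite \<open>N\<close> makes both sides false.\<close>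

lemma normalized_norm_le_iff:
  fixes L s B :: real and N :: ennreal
  assumes L: "0 < L" and B: "0 \<le> B"
  shows "ennreal (1 / L powr s) * ennreal_powr (ennreal (1 / L) * N) (1/2) \<le> ennreal B
     \<longleftrightarrow> N \<le> ennreal (B\<^sup>2 * L powr (2 * s + 1))"
proof (cases N)
  case (real v)
  have y: "ennreal_powr (ennreal (1 / L) * N) (1/2) = ennreal (sqrt (v / L))"
    using real L by (simp add: ennreal_mult'[symmetric] ennreal_powr_def powr_half_sqrt)
  have "ennreal (1 / L powr s) * ennreal_powr (ennreal (1 / L) * N) (1/2) \<le> ennreal B \<longleftrightarrow> sqrt (v / L) / L powr s \<le> B"
    unfolding y using B L real by (simp add: ennreal_mult'[symmetric] ennreal_le_iff)
  also have "\<dots> \<longleftrightarrow> sqrt (v / L) \<le> B * L powr s"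
    using L by (simp add: divide_le_eq)
  also have "\<dots> \<longleftrightarrow> v / L \<le> (B * L powr s)\<^sup>2"
    using B L real by (metis abs_of_nonneg mult_nonneg_nonneg powr_ge_zero real_sqrt_abs real_sqrt_le_iff)
  also have "\<dots> \<longleftrightarrow> v \<le> B\<^sup>2 * L powr (2 * s + 1)"
  proof -
    have "L powr (2 * s + 1) = (L powr s)\<^sup>2 * L" using L by (simp add: powr_add powr_power mult.commute)
    then show ?thesis using L by (simp add: divide_le_eq power_mult_distrib mult.assoc)
  qed
  also have "\<dots> \<longleftrightarrow> N \<le> ennreal (B\<^sup>2 * L powr (2 * s + 1))"
    using real by (simp add: ennreal_le_iff)
  finally show ?thesis .
next
  case top
  then show ?thesis using L by (simp add: ennreal_powr_def ennreal_mult_top top_unique)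
qed

text \<open>An interval is replaced by its closure, which has the same length and only enlarges
  integrals of nonnegative functions.\<close>

lemma bounded_intervals_Icc:
  assumes "Q \<in> bounded_intervals"
  obtains c \<rho> where "0 < \<rho>" "Q \<subseteq> {c - \<rho>..c + \<rho>}" "measure lebesgue Q = 2 * \<rho>"
proof -
  have int: "is_interval Q" and pos: "0 < measure lebesgue Q" and "bounded Q"
    using assms by (auto simp: bounded_intervals_def)
  then obtain K where K: "\<And>x. x \<in> Q \<Longrightarrow> \<bar>x\<bar> \<le> K" by (auto simp: bounded_iff)
  have K0: "0 \<le> K"
  proof -
    have "Q \<noteq> {}" using pos by auto
    then show ?thesis using K by (metis abs_ge_zero all_not_in_conv order_trans)
  qed
  \<comment> \<open>The unbounded shapes in the classification of real intervals are excluded by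
    points beyond the bound \<open>K\<close>.\<close>
  have nb: "Q \<noteq> UNIV" "Q \<noteq> {..<b}" "Q \<noteq> {..b}" "Q \<noteq> {a<..}" "Q \<noteq> {a..}" for a b
  proof -
    have "- K - 1 - \<bar>b\<bar> \<notin> Q" "K + 1 + \<bar>a\<bar> \<notin> Q"
      using K[of "- K - 1 - \<bar>b\<bar>"] K[of "K + 1 + \<bar>a\<bar>"] K0 by auto
    moreover have "- K - 1 - \<bar>b\<bar> < b" "a < K + 1 + \<bar>a\<bar>" using K0 by auto
    ultimately obtain y z where y: "y \<notin> Q" "y < b" and z: "z \<notin> Q" "a < z" by blast
    show "Q \<noteq> UNIV" "Q \<noteq> {..<b}" "Q \<noteq> {..b}" using y by auto
    show "Q \<noteq> {a<..}" "Q \<noteq> {a..}" using z by auto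
  qed
  have ne: "Q \<noteq> {}" using pos by auto
  obtain a b where "Q = {} \<or> Q = UNIV \<or> Q = {..<b} \<or> Q = {..b} \<or> Q = {a<..} \<or> Q = {a..} \<or>
      Q = {a<..<b} \<or> Q = {a<..b} \<or> Q = {a..<b} \<or> Q = {a..b}"
    using is_real_interval[OF int] by blast
  then have ab: "Q = {a<..<b} \<or> Q = {a<..b} \<or> Q = {a..<b} \<or> Q = {a..b}"
    by (simp only: nb ne simp_thms)
  have m: "measure lebesgue Q = b - a" if "a \<le> b"
    using ab that by (auto simp: measure_completion)
  have "a < b"
    using ab pos by (cases "a < b") (auto simp: not_less measure_completion split: if_splits)
  have sub: "Q \<subseteq> {a..b}" using ab by auto
  have ends: "(a + b) / 2 - (b - a) / 2 = a" "(a + b) / 2 + (b - a) / 2 = b" by (simp_all add: field_simps)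
  show ?thesis
  proof (rule that[of "(b - a) / 2" "(a + b) / 2"])
    show "0 < (b - a) / 2" using \<open>a < b\<close> by simp
    show "Q \<subseteq> {(a + b) / 2 - (b - a) / 2..(a + b) / 2 + (b - a) / 2}" unfolding ends by (rule sub)
    show "measure lebesgue Q = 2 * ((b - a) / 2)" using m[OF less_imp_le[OF \<open>a < b\<close>]] by simp
  qed
qed

lemma Icc_in_bounded_intervals:
  assumes "0 < \<rho>"
  shows "{c - \<rho>..c + \<rho>} \<in> bounded_intervals" "measure lebesgue {c - \<rho>..c + \<rho>} = 2 * \<rho>"
  using assms by (auto simp: bounded_intervals_def measure_completion is_interval_cc)

text \<open>Initial segments of \<open>J\<close> form an increasing exhausting sequence, so the
  supremum over finite sets becomes a monotone limit that can be interchanged with the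
  integral.\<close>

lemma infsum_ennreal_SUP_nat:
  fixes f :: "nat \<Rightarrow> ennreal"
  shows "infsum f J = (SUP n. \<Sum>m\<in>J \<inter> {..<n}. f m)"
proof -
  have "infsum f J = (SUP F\<in>{F. finite F \<and> F \<subseteq> J}. sum f F)"
    by (rule nonneg_infsum_complete) simp
  also have "\<dots> = (SUP n. \<Sum>m\<in>J \<inter> {..<n}. f m)"
  proof (rule antisym)
    show "(SUP F\<in>{F. finite F \<and> F \<subseteq> J}. sum f F) \<le> (SUP n. \<Sum>m\<in>J \<inter> {..<n}. f m)"
    proof (rule SUP_least)
      fix F assume "F \<in> {F. finite F \<and> F \<subseteq> J}"
      then have F: "finite F" "F \<subseteq> J" by auto
      then obtain n where "F \<subseteq> {..<n}" using finite_nat_iff_bounded by blast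
      then have "sum f F \<le> (\<Sum>m\<in>J \<inter> {..<n}. f m)" using F by (intro sum_mono2) auto
      also have "\<dots> \<le> (SUP n. \<Sum>m\<in>J \<inter> {..<n}. f m)" by (rule SUP_upper) simp
      finally show "sum f F \<le> (SUP n. \<Sum>m\<in>J \<inter> {..<n}. f m)" .
    qed
    show "(SUP n. \<Sum>m\<in>J \<inter> {..<n}. f m) \<le> (SUP F\<in>{F. finite F \<and> F \<subseteq> J}. sum f F)"
      by (intro SUP_least SUP_upper) auto
  qed
  finally show ?thesis .
qed

lemma nn_integral_infsum_le:
  fixes \<phi> :: "nat \<Rightarrow> real \<Rightarrow> ennreal"
  assumes m: "\<And>m. m \<in> J \<Longrightarrow> \<phi> m \<in> borel_measurable borel"
    and bound: "\<And>I. finite I \<Longrightarrow> I \<subseteq> J \<Longrightarrow> (\<Sum>m\<in>I. \<integral>\<^sup>+x. \<phi> m x * indicator A x \<partial>lborel) \<le> K"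
    and A: "A \<in> sets borel"
  shows "(\<integral>\<^sup>+x. (\<Sum>\<^sub>\<infinity>m\<in>J. \<phi> m x) * indicator A x \<partial>lborel) \<le> K"
proof -
  define S where "S n x = (\<Sum>m\<in>J \<inter> {..<n}. \<phi> m x * indicator A x)" for n x
  have S: "S n \<in> borel_measurable lborel" for n
    unfolding S_def using m A by (intro borel_measurable_sum borel_measurable_times_ennreal) auto
  have "(\<Sum>\<^sub>\<infinity>m\<in>J. \<phi> m x) * indicator A x = (SUP n. S n x)" for x
    unfolding infsum_ennreal_SUP_nat S_def sum_distrib_right[symmetric]
    by (cases "x \<in> A") auto
  then have "(\<integral>\<^sup>+x. (\<Sum>\<^sub>\<infinity>m\<in>J. \<phi> m x) * indicator A x \<partial>lborel) = (\<integral>\<^sup>+x. (SUP n. S n x) \<partial>lborel)"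
    by simp
  also have "\<dots> = (SUP n. \<integral>\<^sup>+x. S n x \<partial>lborel)"
  proof (rule nn_integral_monotone_convergence_SUP)
    show "incseq S" unfolding incseq_def le_fun_def S_def by (auto intro!: sum_mono2)
  qed (rule S)
  also have "\<dots> \<le> K"
  proof (rule SUP_least)
    fix n
    have "(\<integral>\<^sup>+x. S n x \<partial>lborel) = (\<Sum>m\<in>J \<inter> {..<n}. \<integral>\<^sup>+x. \<phi> m x * indicator A x \<partial>lborel)"
      unfolding S_def using m A by (intro nn_integral_sum borel_measurable_times_ennreal) auto
    also have "\<dots> \<le> K" by (rule bound) auto
    finally show "(\<integral>\<^sup>+x. S n x \<partial>lborel) \<le> K" .
  qed
  finally show ?thesis .
qed

lemma cutoff_eq_window:
  assumes "a < b"
  shows "cutoff \<psi> a b \<xi> = on_Icc a b (\<lambda>\<xi>. \<psi> ((\<xi> - a) / (b - a))) \<xi>"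
  using assms by (auto simp: cutoff_def zero_ext_def indicator_def divide_le_eq zero_le_divide_iff)

text \<open>A change of the transform on a null set leaves the integral untouched, so the equality
  holds at every \<open>x\<close>.\<close>

lemma inverse_fourier_integral_cutoff:
  assumes \<psi>: "continuous_on {0..1} \<psi>" and ab: "a < b" and F[measurable]: "F \<in> borel_measurable borel"
    and ae: "AE \<xi> in lebesgue. F0 \<xi> = F \<xi>" and F0: "F0 \<in> borel_measurable lebesgue"
  shows "cis (- (2 * pi * e * x)) * inverse_fourier_integral (\<lambda>\<xi>. F0 \<xi> * cutoff \<psi> a b \<xi>) x = windowed_inverse \<psi> a b e F x"
proof -
  define \<eta> where "\<eta> = on_Icc a b (\<lambda>\<xi>. \<psi> ((\<xi> - a) / (b - a)))"
  have [measurable]: "\<eta> \<in> borel_measurable borel"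
    unfolding \<eta>_def by (rule measurable_window[OF \<psi> ab])
  have cut: "cutoff \<psi> a b = \<eta>" using cutoff_eq_window[OF ab] by (simp add: fun_eq_iff \<eta>_def)
  have "inverse_fourier_integral (\<lambda>\<xi>. F0 \<xi> * \<eta> \<xi>) x = (LINT \<xi>|lebesgue. F \<xi> * \<eta> \<xi> * cis (2 * pi * x * \<xi>))"
    unfolding inverse_fourier_integral_def
  proof (rule integral_cong_AE)
    have "(\<lambda>\<xi>. \<eta> \<xi> * cis (2 * pi * x * \<xi>)) \<in> borel_measurable lebesgue"
      by (rule measurable_completion) measurable
    with F0 have "(\<lambda>\<xi>. F0 \<xi> * (\<eta> \<xi> * cis (2 * pi * x * \<xi>))) \<in> borel_measurable lebesgue"
      by (rule borel_measurable_times)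
    then show "(\<lambda>\<xi>. F0 \<xi> * \<eta> \<xi> * cis (2 * pi * x * \<xi>)) \<in> borel_measurable lebesgue" by (simp add: mult.assoc)
    show "(\<lambda>\<xi>. F \<xi> * \<eta> \<xi> * cis (2 * pi * x * \<xi>)) \<in> borel_measurable lebesgue"
      by (rule measurable_completion) measurable
    show "AE \<xi> in lebesgue. F0 \<xi> * \<eta> \<xi> * cis (2 * pi * x * \<xi>) = F \<xi> * \<eta> \<xi> * cis (2 * pi * x * \<xi>)"
      using ae by eventually_elim simp
  qed
  also have "\<dots> = (LINT \<xi>|lborel. F \<xi> * \<eta> \<xi> * cis (2 * pi * x * \<xi>))"
    by (rule integral_completion) measurable
  finally show ?thesis by (simp add: cut windowed_inverse_def \<eta>_def)
qed

text \<open>The strict inequality turns the infimum into an actual polynomial. Any closed interval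
  around \<open>x\<close> qualifies, so one \<open>B\<close> serves all scales.\<close>

lemma maximal_fn_single_lessD:
  assumes less: "maximal_fn_single i 2 s f x < ennreal B" and B: "0 \<le> B" and \<rho>: "0 < \<rho>" and x: "x \<in> {c - \<rho>..c + \<rho>}"
    and ae: "AE y in lebesgue. f y = g y"
  shows "\<exists>q. degree q \<le> i - 1 \<and>
    sq_norm_near c \<rho> (minus_poly g q) \<le> ennreal (B\<^sup>2 * (2 * \<rho>) powr (2 * s + 1))"
proof -
  let ?Q = "{c - \<rho>..c + \<rho>}"
  let ?N = "\<lambda>P. \<integral>\<^sup>+y\<in>?Q. ennreal_powr (l2_dist {0} (\<lambda>m. f y) (\<lambda>m. poly (P m) (complex_of_real y))) 2 \<partial>lebesgue"
  have "(INF P \<in> {P :: nat \<Rightarrow> complex poly. \<forall>m\<in>{0}. P m \<in> polys_below i}.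
      ennreal (1 / measure lebesgue ?Q powr s) * ennreal_powr (ennreal (1 / measure lebesgue ?Q) * ?N P) (1 / 2))
      \<le> maximal_fn_single i 2 s f x"
    unfolding maximal_fn_single_def maximal_fn_def
    using Icc_in_bounded_intervals(1)[OF \<rho>, of c] x by (intro SUP_upper) simp
  with less have "(INF P \<in> {P :: nat \<Rightarrow> complex poly. \<forall>m\<in>{0}. P m \<in> polys_below i}.
      ennreal (1 / measure lebesgue ?Q powr s) * ennreal_powr (ennreal (1 / measure lebesgue ?Q) * ?N P) (1 / 2)) < ennreal B"
    by (rule le_less_trans[rotated])
  then obtain P where P: "P 0 \<in> polys_below i"
    and PB: "ennreal (1 / measure lebesgue ?Q powr s) * ennreal_powr (ennreal (1 / measure lebesgue ?Q) * ?N P) (1 / 2) < ennreal B"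
    unfolding INF_less_iff by auto
  have le: "?N P \<le> ennreal (B\<^sup>2 * (2 * \<rho>) powr (2 * s + 1))"
    using less_imp_le[OF PB] \<rho> B unfolding Icc_in_bounded_intervals(2)[OF \<rho>, of c]
    by (subst (asm) normalized_norm_le_iff) auto
  have "?N P = (\<integral>\<^sup>+y\<in>?Q. ennreal ((cmod (f y - poly (P 0) (of_real y)))\<^sup>2) \<partial>lebesgue)"
    by (simp add: l2_dist_powr2)
  also have "\<dots> = (\<integral>\<^sup>+y\<in>?Q. ennreal ((cmod (g y - poly (P 0) (of_real y)))\<^sup>2) \<partial>lebesgue)"
    by (rule nn_integral_cong_AE) (use ae in eventually_elim, simp)
  also have "\<dots> = sq_norm_near c \<rho> (minus_poly g (P 0))"
    by (rule nn_integral_completion)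
  finally show ?thesis using le P by (intro exI[of _ "P 0"]) (auto simp: polys_below_def)
qed

text \<open>The value of the single maximal function is exceeded by some real \<open>B\<close>,
  which supplies approximants; letting the excess tend to 0 restores the constant. An infinite value
  leaves nothing to show, as \<open>K\<close> is positive.\<close>

lemma maximal_fn_leI:
  assumes K: "0 < K"
    and bound: "\<And>B c \<rho>. maximal_fn_single i 2 s f x < ennreal B \<Longrightarrow> 0 \<le> B \<Longrightarrow> 0 < \<rho> \<Longrightarrow> x \<in> {c - \<rho>..c + \<rho>} \<Longrightarrow>
      approximable r J c \<rho> S ((K * B)\<^sup>2 * (2 * \<rho>) powr (2 * s + 1))"
    and S: "\<And>m. m \<in> J \<Longrightarrow> S m \<in> borel_measurable borel"
  shows "maximal_fn r 2 s J S x \<le> ennreal K * maximal_fn_single i 2 s f x"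
proof (cases "maximal_fn_single i 2 s f x")
  case top
  then show ?thesis using K by (simp add: ennreal_mult_top)
next
  case (real \<alpha>)
  let ?E = "\<lambda>Q P. ennreal (1 / measure lebesgue Q powr s) * ennreal_powr (ennreal (1 / measure lebesgue Q) *
      (\<integral>\<^sup>+y\<in>Q. ennreal_powr (l2_dist J (\<lambda>m. S m y) (\<lambda>m. poly (P m) (complex_of_real y))) 2 \<partial>lebesgue)) (1 / 2)"
  show ?thesis
    unfolding maximal_fn_def
  proof (rule SUP_least)
    fix Q assume "Q \<in> {Q \<in> bounded_intervals. x \<in> Q}"
    then have Q: "Q \<in> bounded_intervals" "x \<in> Q" by auto
    obtain c \<rho> where \<rho>: "0 < \<rho>" and sub: "Q \<subseteq> {c - \<rho>..c + \<rho>}" and len: "measure lebesgue Q = 2 * \<rho>"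
      by (rule bounded_intervals_Icc[OF Q(1)])
    show "(INF P \<in> {P. \<forall>m\<in>J. P m \<in> polys_below r}. ?E Q P) \<le> ennreal K * maximal_fn_single i 2 s f x"
    proof (rule ennreal_le_epsilon)
      fix \<epsilon> :: real assume \<epsilon>: "0 < \<epsilon>"
      \<comment> \<open>With this choice \<open>K * B\<close> exceeds \<open>K * \<alpha>\<close> by
        exactly \<open>\<epsilon>\<close>.\<close>
      define B where "B = \<alpha> + \<epsilon> / K"
      have B: "0 \<le> B" "\<alpha> < B" using real \<epsilon> K by (auto simp: B_def add_nonneg_pos)
      have "maximal_fn_single i 2 s f x < ennreal B" using real B by (simp add: ennreal_less_iff)
      from bound[OF this B(1) \<rho>, of c] obtain p where p: "\<forall>m\<in>J. degree (p m) < r"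
        "\<And>I. finite I \<Longrightarrow> I \<subseteq> J \<Longrightarrow> (\<Sum>m\<in>I. sq_norm_near c \<rho> (minus_poly (S m) (p m)))
          \<le> ennreal ((K * B)\<^sup>2 * (2 * \<rho>) powr (2 * s + 1))"
        using sub Q(2) by blast
      have "(\<integral>\<^sup>+y\<in>Q. ennreal_powr (l2_dist J (\<lambda>m. S m y) (\<lambda>m. poly (p m) (complex_of_real y))) 2 \<partial>lebesgue)
        \<le> (\<integral>\<^sup>+y\<in>{c - \<rho>..c + \<rho>}. (\<Sum>\<^sub>\<infinity>m\<in>J. ennreal ((cmod (S m y - poly (p m) (of_real y)))\<^sup>2)) \<partial>lborel)"
        unfolding l2_dist_powr2 nn_integral_completion
        by (rule nn_integral_mono) (use sub in \<open>auto simp: indicator_def\<close>)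
      also have "\<dots> \<le> ennreal ((K * B)\<^sup>2 * (2 * \<rho>) powr (2 * s + 1))"
      proof (rule nn_integral_infsum_le)
        show "(\<lambda>y. ennreal ((cmod (S m y - poly (p m) (of_real y)))\<^sup>2)) \<in> borel_measurable borel" if "m \<in> J" for m
        proof -
          note [measurable] = S[OF that]
          show ?thesis by measurable
        qed
      qed (use p(2) in auto)
      finally have Ep: "?E Q p \<le> ennreal (K * B)"
        unfolding len using \<rho> K B by (subst normalized_norm_le_iff) auto
      have "(INF P \<in> {P. \<forall>m\<in>J. P m \<in> polys_below r}. ?E Q P) \<le> ?E Q p"
        using p(1) by (intro INF_lower) (auto simp: polys_below_def)
      also note Ep
      also have "ennreal (K * B) = ennreal K * maximal_fn_single i 2 s f x + ennreal \<epsilon>"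
        using real K \<epsilon> by (simp add: B_def distrib_left ennreal_mult')
      finally show "(INF P \<in> {P. \<forall>m\<in>J. P m \<in> polys_below r}. ?E Q P) \<le> ennreal K * maximal_fn_single i 2 s f x + ennreal \<epsilon>" .
    qed
  qed
qed

text \<open>If an interval contains \<open>x\<close>, so do its dilates about its centre; one bound
  for the maximal function at \<open>x\<close> thus supplies approximants at every scale, the input
  of \<open>windowed_approximation\<close>. Leaving open which of 0 and 1 is \<open>e\<close> treats
  both operators at once.\<close>

lemma windowed_maximal_estimate:
  fixes i r :: nat and s e e' :: real
  assumes r: "1 \<le> r" and rs: "real r > max s (real i - 1)"
    and smooth: "smooth_on_unit \<psi>" and e: "{e, e'} = {0, 1}"
    and U: "open U" "e' \<in> U" "\<And>x. x \<in> U \<inter> {0..1} \<Longrightarrow> \<psi> x = 0"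
  shows "\<exists>K>0. \<forall>J a b f x. (\<forall>m\<in>J. a m < b m) \<longrightarrow> disjoint_family_on (\<lambda>m. {a m..b m}) J \<longrightarrow>
       (\<forall>m\<in>J. 0 \<notin> {a m<..<b m}) \<longrightarrow> f \<in> L2_real \<longrightarrow>
       maximal_fn r 2 s J (\<lambda>m x. cis (- (2 * pi * (a m + e * (b m - a m)) * x)) *
           inverse_fourier_integral (\<lambda>\<xi>. fourier_L2 f \<xi> * cutoff \<psi> (a m) (b m) \<xi>) x) x
         \<le> ennreal K * maximal_fn_single i 2 s f x"
proof -
  define n where "n = i - 1" \<comment> \<open>truncated if \<open>i = 0\<close>, harmless since then only the zero polynomial is admitted\<close>
  have nr: "n < r" and sr: "s < real r" using r rs by (auto simp: n_def)
  have cont: "continuous_on {0..1} \<psi>" by (rule smooth_on_unit_continuous[OF smooth])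
  show ?thesis
  proof (rule windowed_approximation[OF nr sr smooth e U])
    fix C :: real
    assume C: "0 < C" and est:
      "\<And>J a b f F c \<rho> B P. (\<And>m. m \<in> J \<Longrightarrow> a m < b m) \<Longrightarrow> disjoint_family_on (\<lambda>m. {a m..b m}) J \<Longrightarrow>
        (\<And>m. m \<in> J \<Longrightarrow> 0 \<notin> {a m<..<b m}) \<Longrightarrow>
        f \<in> borel_measurable borel \<Longrightarrow> sq_norm f < \<infinity> \<Longrightarrow>
        F \<in> borel_measurable borel \<Longrightarrow> sq_norm F < \<infinity> \<Longrightarrow>
        ft_limit f F \<Longrightarrow>
        0 < \<rho> \<Longrightarrow> 0 \<le> B \<Longrightarrow> (\<And>k. degree (P k) \<le> n) \<Longrightarrow>
        (\<And>k. sq_norm_near c (2 ^ k * \<rho>) (minus_poly f (P k))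
           \<le> ennreal (B\<^sup>2 * (2 ^ k * (2 * \<rho>)) powr (2 * s + 1))) \<Longrightarrow>
        approximable r J c \<rho> (\<lambda>m. windowed_inverse \<psi> (a m) (b m) (a m + e * (b m - a m)) F) (C * B\<^sup>2 * (2 * \<rho>) powr (2 * s + 1))"
    \<comment> \<open>\<open>C\<close> bounds squared norms, hence the root.\<close>
    have K: "0 < sqrt C" using C by simp
    have main: "maximal_fn r 2 s J (\<lambda>m x. cis (- (2 * pi * (a m + e * (b m - a m)) * x)) *
             inverse_fourier_integral (\<lambda>\<xi>. fourier_L2 f \<xi> * cutoff \<psi> (a m) (b m) \<xi>) x) x
           \<le> ennreal (sqrt C) * maximal_fn_single i 2 s f x"
      if ab: "\<forall>m\<in>J. a m < b m" and disj: "disjoint_family_on (\<lambda>m. {a m..b m}) J"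
        and zero: "\<forall>m\<in>J. 0 \<notin> {a m<..<b m}" and f: "f \<in> L2_real" for J a b f x
    proof -
      obtain g F where g: "g \<in> borel_measurable borel" "AE x in lebesgue. f x = g x" "sq_norm g < \<infinity>"
        and Fm: "fourier_L2 f \<in> borel_measurable lebesgue"
        and F: "F \<in> borel_measurable borel" "AE \<xi> in lebesgue. fourier_L2 f \<xi> = F \<xi>" "sq_norm F < \<infinity>"
        and lim: "ft_limit g F"
        by (rule fourier_L2_borel[OF f])
      define S where "S = (\<lambda>m x. cis (- (2 * pi * (a m + e * (b m - a m)) * x)) *
             inverse_fourier_integral (\<lambda>\<xi>. fourier_L2 f \<xi> * cutoff \<psi> (a m) (b m) \<xi>) x)"
      have S: "S m = windowed_inverse \<psi> (a m) (b m) (a m + e * (b m - a m)) F" if "m \<in> J" for m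
        unfolding S_def using inverse_fourier_integral_cutoff[OF cont _ F(1,2) Fm] ab that by (simp add: fun_eq_iff)
      show ?thesis
        unfolding S_def[symmetric]
      proof (rule maximal_fn_leI[OF K])
        show "S m \<in> borel_measurable borel" if "m \<in> J" for m
          unfolding S[OF that] using ab that by (intro measurable_windowed_inverse cont F) auto
        fix B c \<rho> assume less: "maximal_fn_single i 2 s f x < ennreal B" and B: "0 \<le> B" and \<rho>: "0 < \<rho>" and x: "x \<in> {c - \<rho>..c + \<rho>}"
        have "\<forall>k. \<exists>q. degree q \<le> n \<and> sq_norm_near c (2 ^ k * \<rho>) (minus_poly g q)
            \<le> ennreal (B\<^sup>2 * (2 ^ k * (2 * \<rho>)) powr (2 * s + 1))"
        proof
          fix k
          have "\<rho> \<le> 2 ^ k * \<rho>" using \<rho> by simp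
          then have xk: "x \<in> {c - 2 ^ k * \<rho>..c + 2 ^ k * \<rho>}" using x by auto
          have pos: "0 < 2 ^ k * \<rho>" using \<rho> by simp
          have len: "2 * (2 ^ k * \<rho>) = 2 ^ k * (2 * \<rho>)" by simp
          from maximal_fn_single_lessD[OF less B pos xk g(2)]
          show "\<exists>q. degree q \<le> n \<and> sq_norm_near c (2 ^ k * \<rho>) (minus_poly g q)
            \<le> ennreal (B\<^sup>2 * (2 ^ k * (2 * \<rho>)) powr (2 * s + 1))"
            unfolding n_def len .
        qed
        from choice[OF this] obtain P where
          P: "\<forall>k. degree (P k) \<le> n \<and> sq_norm_near c (2 ^ k * \<rho>) (minus_poly g (P k))
            \<le> ennreal (B\<^sup>2 * (2 ^ k * (2 * \<rho>)) powr (2 * s + 1))" ..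
        from est[OF bspec[OF ab] disj bspec[OF zero] g(1,3) F(1,3) lim \<rho> B
            conjunct1[OF spec[OF P]] conjunct2[OF spec[OF P]]]
        obtain p where p0: "(\<forall>m\<in>J. degree (p m) < r) \<and> (\<forall>I. finite I \<longrightarrow> I \<subseteq> J \<longrightarrow>
          (\<Sum>m\<in>I. sq_norm_near c \<rho>
              (minus_poly (windowed_inverse \<psi> (a m) (b m) (a m + e * (b m - a m)) F) (p m)))
            \<le> ennreal (C * B\<^sup>2 * (2 * \<rho>) powr (2 * s + 1)))" ..
        note p = conjunct1[OF p0] conjunct2[OF p0, rule_format]
        have "(\<Sum>m\<in>I. sq_norm_near c \<rho> (minus_poly (S m) (p m)))
            \<le> ennreal ((sqrt C * B)\<^sup>2 * (2 * \<rho>) powr (2 * s + 1))" if I: "finite I" "I \<subseteq> J" for I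
        proof -
          have "(\<Sum>m\<in>I. sq_norm_near c \<rho> (minus_poly (S m) (p m)))
             = (\<Sum>m\<in>I. sq_norm_near c \<rho>
              (minus_poly (windowed_inverse \<psi> (a m) (b m) (a m + e * (b m - a m)) F) (p m)))"
            using S I(2) by (intro sum.cong refl) auto
          also note p(2)[OF I]
          finally show ?thesis using C by (simp add: power_mult_distrib)
        qed
        then show "approximable r J c \<rho> S ((sqrt C * B)\<^sup>2 * (2 * \<rho>) powr (2 * s + 1))"
          using p(1) by blast
      qed
    qed
    then show ?thesis using K by blast
  qed
qed

lemma supp_unit_zero:
  assumes "supp_unit \<psi> \<subseteq> {\<alpha>..\<beta>}" "x \<in> {0..1}" "x \<notin> {\<alpha>..\<beta>}"
  shows "\<psi> x = 0"
proof (rule ccontr)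
  assume "\<psi> x \<noteq> 0"
  with assms(2) have "x \<in> {x \<in> {0..1}. \<psi> x \<noteq> 0}" by simp
  then have "x \<in> supp_unit \<psi>"
    unfolding supp_unit_def by (rule subsetD[OF closure_subset])
  with assms(1,3) show False by blast
qed

theorem theorem1:
  fixes i r :: nat and s :: real and \<psi>1 \<psi>2 :: "real \<Rightarrow> complex"
  assumes "r \<ge> 1"
    and "- 1/2 < s" and "s \<le> real i"
    and "real r > max s (real i - 1)"
    and "smooth_on_unit \<psi>1" and "smooth_on_unit \<psi>2"
    and "supp_unit \<psi>1 \<subseteq> {0..2/3}" and "supp_unit \<psi>2 \<subseteq> {1/3..1}"
    and "\<forall>x\<in>{0..1}. \<psi>1 x + \<psi>2 x = 1"
  shows "\<exists>C::real. C > 0 \<and>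
    (\<forall>(J :: nat set) (a :: nat \<Rightarrow> real) (b :: nat \<Rightarrow> real).
       (\<forall>m\<in>J. a m < b m) \<longrightarrow>
       disjoint_family_on (\<lambda>m. {a m..b m}) J \<longrightarrow>
       (\<forall>m\<in>J. 0 \<notin> {a m<..<b m}) \<longrightarrow>
       (\<forall>f\<in>L2_real. \<forall>x.
          maximal_fn r 2 s J (S1 \<psi>1 a b f) x \<le> ennreal C * maximal_fn_single i 2 s f x \<and>
          maximal_fn r 2 s J (S2 \<psi>2 a b f) x \<le> ennreal C * maximal_fn_single i 2 s f x))"
proof -
  \<comment> \<open>The first operator has \<open>e = 0\<close> and the second \<open>e = 1\<close>.
    Near the other end point the cutoff vanishes: beyond 2/3 for the first, below 1/3 for the
    second.\<close>
  have S1: "S1 \<psi>1 a b f = (\<lambda>m x. cis (- (2 * pi * (a m + 0 * (b m - a m)) * x)) *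
           inverse_fourier_integral (\<lambda>\<xi>. fourier_L2 f \<xi> * cutoff \<psi>1 (a m) (b m) \<xi>) x)" for a b f
    by (simp add: fun_eq_iff S1_def)
  have S2: "S2 \<psi>2 a b f = (\<lambda>m x. cis (- (2 * pi * (a m + 1 * (b m - a m)) * x)) *
           inverse_fourier_integral (\<lambda>\<xi>. fourier_L2 f \<xi> * cutoff \<psi>2 (a m) (b m) \<xi>) x)" for a b f
    by (simp add: fun_eq_iff S2_def)
  have "\<exists>K>0. \<forall>J a b f x. (\<forall>m\<in>J. a m < b m) \<longrightarrow> disjoint_family_on (\<lambda>m. {a m..b m}) J \<longrightarrow>
       (\<forall>m\<in>J. 0 \<notin> {a m<..<b m}) \<longrightarrow> f \<in> L2_real \<longrightarrow>
       maximal_fn r 2 s J (S1 \<psi>1 a b f) x \<le> ennreal K * maximal_fn_single i 2 s f x"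
    unfolding S1
    by (rule windowed_maximal_estimate[OF assms(1,4,5), of 0 1 "{2/3<..}"])
       (use supp_unit_zero[OF assms(7)] in auto)
  then obtain K1 where K1: "K1 > 0 \<and> (\<forall>J a b f x. (\<forall>m\<in>J. a m < b m) \<longrightarrow> disjoint_family_on (\<lambda>m. {a m..b m}) J \<longrightarrow>
       (\<forall>m\<in>J. 0 \<notin> {a m<..<b m}) \<longrightarrow> f \<in> L2_real \<longrightarrow>
       maximal_fn r 2 s J (S1 \<psi>1 a b f) x \<le> ennreal K1 * maximal_fn_single i 2 s f x)" ..
  note 1 = conjunct2[OF K1, THEN spec, THEN spec, THEN spec, THEN spec, THEN spec, THEN mp, THEN mp, THEN mp, THEN mp]
  have "\<exists>K>0. \<forall>J a b f x. (\<forall>m\<in>J. a m < b m) \<longrightarrow> disjoint_family_on (\<lambda>m. {a m..b m}) J \<longrightarrow>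
       (\<forall>m\<in>J. 0 \<notin> {a m<..<b m}) \<longrightarrow> f \<in> L2_real \<longrightarrow>
       maximal_fn r 2 s J (S2 \<psi>2 a b f) x \<le> ennreal K * maximal_fn_single i 2 s f x"
    unfolding S2
    by (rule windowed_maximal_estimate[OF assms(1,4,6), of 1 0 "{..<1/3}"])
       (use supp_unit_zero[OF assms(8)] in auto)
  then obtain K2 where K2: "K2 > 0 \<and> (\<forall>J a b f x. (\<forall>m\<in>J. a m < b m) \<longrightarrow> disjoint_family_on (\<lambda>m. {a m..b m}) J \<longrightarrow>
       (\<forall>m\<in>J. 0 \<notin> {a m<..<b m}) \<longrightarrow> f \<in> L2_real \<longrightarrow>
       maximal_fn r 2 s J (S2 \<psi>2 a b f) x \<le> ennreal K2 * maximal_fn_single i 2 s f x)" ..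
  note 2 = conjunct2[OF K2, THEN spec, THEN spec, THEN spec, THEN spec, THEN spec, THEN mp, THEN mp, THEN mp, THEN mp]
  have mono: "ennreal K1 * A \<le> ennreal (max K1 K2) * A" "ennreal K2 * A \<le> ennreal (max K1 K2) * A" for A
    by (auto intro!: mult_right_mono ennreal_leI)
  show ?thesis
  proof (intro exI[of _ "max K1 K2"] conjI allI impI ballI)
    show "0 < max K1 K2" using conjunct1[OF K1] by simp
    fix J :: "nat set" and a b :: "nat \<Rightarrow> real" and f x
    assume H: "\<forall>m\<in>J. a m < b m" "disjoint_family_on (\<lambda>m. {a m..b m}) J" "\<forall>m\<in>J. 0 \<notin> {a m<..<b m}" "f \<in> L2_real"
    show "maximal_fn r 2 s J (S1 \<psi>1 a b f) x \<le> ennreal (max K1 K2) * maximal_fn_single i 2 s f x"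
      by (rule order_trans[OF 1[OF H] mono(1)])
    show "maximal_fn r 2 s J (S2 \<psi>2 a b f) x \<le> ennreal (max K1 K2) * maximal_fn_single i 2 s f x"
      by (rule order_trans[OF 2[OF H] mono(2)])
  qed
qed

end
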